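(* Let $v\in L^2(\mathbb{R})$ and let $V: W^{1,2}(\mathbb{R})\subseteq L^2(\mathbb{R})\to L^2(\mathbb{R})$ be the operator $(Vx)(t)=v(t)x(-t)$, $t\in\mathbb{R}$. Consider the operator $\mathscr{L}=-i\frac{d}{dt}-V: W^{1,2}(\mathbb{R})\subseteq L^2(\mathbb{R})\to L^2(\mathbb{R})$. Then there exists a continuous real-valued function $f\in L^2(\mathbb{R})$ such that for every $\lambda$ in the spectrum $\sigma(\mathscr{L})$ one has $|\operatorname{Im}\lambda|\le f(\operatorname{Re}\lambda)$.
   Context: $L^2(\mathbb{R})$ consists of complex-valued functions. $W^{1,2}(\mathbb{R})$ is the Sobolev space of absolutely continuous functions $x\in L^2(\mathbb{R})$ whose almost everywhere derivative belongs to $L^2(\mathbb{R})$. *)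

theory Defs
  imports "HOL-Analysis.Analysis"
begin

text \<open>
  Elements of $L^2$ are represented by square-integrable functions; two functions represent the
  same element iff they agree almost everywhere. There is no quotient type, so equality in
  $L^2$ appears below as an explicit \<open>AE\<close> statement.
\<close>

definition L2 :: "(real \<Rightarrow> 'a::{banach, second_countable_topology}) set" where
  "L2 = {x \<in> borel_measurable lebesgue. integrable lebesgue (\<lambda>t. (norm (x t))\<^sup>2)}"

definition L2_norm :: "(real \<Rightarrow> 'a::{banach, second_countable_topology}) \<Rightarrow> real" where
  "L2_norm x = sqrt (LINT t|lebesgue. (norm (x t))\<^sup>2)"

text \<open>
  Absolute continuity of a function of a real variable (the library constant
  \<open>absolutely_continuous\<close> is about measures). The set \<open>D\<close> is a finite family of compact intervals
  with disjoint interiors contained in \<open>S\<close>; \<open>Inf K\<close> and \<open>Sup K\<close> are the endpoints of \<open>K\<close>.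
\<close>

definition absolutely_continuous_on ::
    "real set \<Rightarrow> (real \<Rightarrow> 'a::real_normed_vector) \<Rightarrow> bool" where
  "absolutely_continuous_on S x \<longleftrightarrow>
    (\<forall>\<epsilon>>0. \<exists>\<delta>>0. \<forall>D. D division_of \<Union>D \<and> \<Union>D \<subseteq> S \<and> (\<Sum>K\<in>D. Sup K - Inf K) < \<delta> \<longrightarrow>
      (\<Sum>K\<in>D. norm (x (Sup K) - x (Inf K))) < \<epsilon>)"

text \<open>
  On the whole line, absolute continuity is required on every compact interval. For functions whose
  derivative is in $L^2$ this is the same as \<open>absolutely_continuous_on UNIV\<close>. Distinct members of
  \<open>W12\<close> are distinct elements of $L^2$, since continuous functions that agree almost everywhere
  are equal.
\<close>

definition W12 :: "(real \<Rightarrow> complex) set" where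
  "W12 = {x \<in> L2. (\<forall>a b. absolutely_continuous_on {a..b} x) \<and>
    (\<exists>x'\<in>L2. AE t in lebesgue. (x has_vector_derivative x' t) (at t))}"

text \<open>
  The resolvent set of a linear operator \<open>A\<close> in $L^2$ with domain \<open>D\<close>: all \<open>\<mu>\<close> such that
  $A - \mu$ is a bijection from \<open>D\<close> onto $L^2$ whose inverse is bounded. The operator is given on
  representatives, so \<open>A x\<close> matters only up to null sets.
\<close>

definition L2_resolvent_set ::
    "(real \<Rightarrow> complex) set \<Rightarrow> ((real \<Rightarrow> complex) \<Rightarrow> real \<Rightarrow> complex) \<Rightarrow> complex set" where
  "L2_resolvent_set D A = {\<mu>.
    (\<forall>y\<in>L2. \<exists>x\<in>D. (AE t in lebesgue. A x t - \<mu> * x t = y t) \<and>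
      (\<forall>z\<in>D. (AE t in lebesgue. A z t - \<mu> * z t = y t) \<longrightarrow> (AE t in lebesgue. z t = x t))) \<and>
    (\<exists>C. \<forall>x\<in>D. L2_norm x \<le> C * L2_norm (\<lambda>t. A x t - \<mu> * x t))}"

definition L2_spectrum ::
    "(real \<Rightarrow> complex) set \<Rightarrow> ((real \<Rightarrow> complex) \<Rightarrow> real \<Rightarrow> complex) \<Rightarrow> complex set" where
  "L2_spectrum D A = - L2_resolvent_set D A"

definition opV :: "(real \<Rightarrow> complex) \<Rightarrow> (real \<Rightarrow> complex) \<Rightarrow> real \<Rightarrow> complex" where
  "opV v x = (\<lambda>t. v t * x (- t))"

definition opL :: "(real \<Rightarrow> complex) \<Rightarrow> (real \<Rightarrow> complex) \<Rightarrow> real \<Rightarrow> complex" where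
  "opL v x = (\<lambda>t. - \<i> * vector_derivative x (at t) - opV v x t)"

end

theory Submission
  imports Defs "HOL-Probability.Characteristic_Functions" "HOL-Real_Asymp.Real_Asymp"
begin

text \<open>
  Let \<open>\<mu> = a + i b\<close> with \<open>b > 0\<close>. The equation \<open>(L - \<mu>) x = y\<close> is \<open>x' + c x = i (v x(-\<cdot>) + y)\<close> with
  \<open>c = b - i a\<close>, and \<open>d/dt + c\<close> is inverted by convolution with a decaying exponential
  (\<open>decay_conv c\<close>). It thus becomes a fixed point equation \<open>x = T x + w\<close> for bounded continuous
  functions, where \<open>T u\<close> is the convolution of \<open>i v u(-\<cdot>)\<close> (\<open>refl_op v c\<close>). If \<open>T\<^sup>2\<close> is a contraction
  for the supremum norm, then \<open>\<mu>\<close> belongs to the resolvent set.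

  Cauchy--Schwarz bounds the norm of \<open>T\<close> by \<open>\<parallel>v\<parallel> / sqrt (2 b)\<close>. This confines the spectrum to a strip,
  but it does not see \<open>a\<close>. The dependence on \<open>a\<close> comes from oscillation: \<open>T u\<close> oscillates like
  \<open>exp (i a t)\<close>, its reflection like \<open>exp (- i a t)\<close>, and the second application of \<open>T\<close> feels the
  potential only at the frequency \<open>2 a\<close> needed to turn one into the other. To exploit this, let
  \<open>G\<close> be the solution of \<open>G' + (2 - 2 i a) G = v\<close> and integrate by parts in \<open>T\<^sup>2\<close>
  (\<open>refl_op_refl_op\<close>). Every resulting term contains a factor \<open>G\<close>, and \<open>G\<close> is controlled by its
  \<open>L2\<close> norm, also uniformly (\<open>norm_decay_conv_square_le\<close>). The outcome is that \<open>T\<^sup>2\<close> contracts as soon as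
  \<open>b\<close> exceeds a constant, which depends only on \<open>\<parallel>v\<parallel>\<close>, times \<open>\<parallel>G\<parallel>\<close> (\<open>refl_op_contraction\<close>).

  The function \<open>a \<mapsto> \<parallel>G\<parallel>\<close> (\<open>spectral_profile v\<close>) is continuous by dominated convergence. It is
  square-integrable because, for fixed \<open>t\<close> and up to a phase, \<open>G t\<close> is the Fourier transform at the
  frequency \<open>2 a\<close> of \<open>v\<close> cut off by a decaying exponential: Plancherel's inequality in \<open>a\<close> followed by
  integration over \<open>t\<close> yields a multiple of \<open>\<parallel>v\<parallel>\<^sup>2\<close> (\<open>spectral_profile_L2\<close>).

  The lower half plane is reduced to the upper one by the reflection \<open>x \<mapsto> x(-\<cdot>)\<close>, which replaces
  \<open>v\<close> by \<open>- v(-\<cdot>)\<close> and \<open>\<mu>\<close> by \<open>- \<mu>\<close>. The bound \<open>f a\<close> is the sum of the profile of \<open>v\<close> at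
  \<open>a\<close> and that of \<open>- v(-\<cdot>)\<close> at \<open>- a\<close>, each multiplied by its constant.

  Membership in \<open>W12\<close> is tied to integral equations by two facts from real analysis: an absolutely
  continuous function is the integral of its derivative
  (\<open>has_integral_of_absolutely_continuous\<close>), and a primitive is differentiable almost everywhere
  (\<open>primitive_has_vector_derivative_AE\<close>).
\<close>

section \<open>Absolutely continuous functions and primitives\<close>

lemma negligible_of_AE:
  assumes "AE t in lebesgue. P t"
  shows "negligible {t. \<not> P t}"
proof -
  obtain M where "{t \<in> space lebesgue. \<not> P t} \<subseteq> M" "M \<in> null_sets lebesgue"
    using assms by (auto simp: eventually_ae_filter)
  then have "{t. \<not> P t} \<subseteq> M" "negligible M"
    by (auto simp: negligible_iff_null_sets)
  then show ?thesis
    by (rule negligible_subset[rotated])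
qed

text \<open>
  The fundamental theorem of calculus for absolutely continuous functions, in gauge form. Off the
  exceptional null set \<open>N\<close> the gauge comes from differentiability. On \<open>N\<close> the integrand may be taken
  to be \<open>0\<close>, and the gauge keeps the intervals tagged in \<open>N\<close> inside an open set of measure less than
  \<open>\<delta>\<close>; absolute continuity then makes the increments of \<open>F\<close> over these intervals sum to little.
\<close>

lemma has_integral_of_absolutely_continuous:
  fixes F :: "real \<Rightarrow> 'a::banach"
  assumes "a \<le> b" and AC: "absolutely_continuous_on {a..b} F"
    and deriv: "AE t in lebesgue. (F has_vector_derivative h t) (at t)"
  shows "(h has_integral F b - F a) {a..b}"
proof -
  define N where "N = {t. \<not> (F has_vector_derivative h t) (at t)}"
  have N: "negligible N"
    using deriv unfolding N_def by (rule negligible_of_AE)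
  define h0 where "h0 = (\<lambda>t. if t \<in> N then 0 else h t)"
  have "(h0 has_integral F b - F a) {a..b}"
    unfolding has_integral_real
  proof (intro allI impI)
    fix e :: real assume "e > 0"
    obtain \<delta> where \<delta>: "\<delta> > 0"
      and AC': "\<forall>D. D division_of \<Union>D \<and> \<Union>D \<subseteq> {a..b} \<and> (\<Sum>K\<in>D. Sup K - Inf K) < \<delta> \<longrightarrow>
        (\<Sum>K\<in>D. norm (F (Sup K) - F (Inf K))) < e / 2"
      using AC[unfolded absolutely_continuous_on_def, rule_format, OF half_gt_zero[OF \<open>e > 0\<close>]]
      by (elim exE conjE)
    have AC\<delta>: "(\<Sum>K\<in>D. norm (F (Sup K) - F (Inf K))) < e / 2"
      if "D division_of \<Union>D" "\<Union>D \<subseteq> {a..b}" "(\<Sum>K\<in>D. Sup K - Inf K) < \<delta>" for D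
      using AC'[rule_format, OF conjI[OF that(1) conjI[OF that(2,3)]]] .
    obtain U where U: "open U" "N \<subseteq> U" and mU: "U \<in> lmeasurable" "measure lebesgue U < \<delta>"
    proof -
      have "N \<in> sets lebesgue" using N by (simp add: negligible_imp_sets)
      then obtain T where T: "open T" "N \<subseteq> T" "(T - N) \<in> lmeasurable"
          "emeasure lebesgue (T - N) < ennreal \<delta>"
        using \<delta> by (blast intro: sets_lebesgue_outer_open)
      have "T = (T - N) \<union> N" using T by auto
      then have "T \<in> lmeasurable" using T N
        by (metis fmeasurable.Un negligible_imp_measurable)
      moreover have "measure lebesgue T = measure lebesgue (T - N)"
        using N T by (metis \<open>T \<in> lmeasurable\<close> measure_Diff_null_set negligible_iff_null_sets fmeasurableD)
      moreover have "measure lebesgue (T - N) < \<delta>"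
        using T \<delta> by (metis emeasure_eq_measure2 ennreal_less_iff measure_nonneg)
      ultimately show thesis using that T by auto
    qed
    define e' where "e' = e / (2 * (b - a + 1))"
    have e': "e' > 0" using \<open>e > 0\<close> \<open>a \<le> b\<close> by (simp add: e'_def)
    have "\<exists>d>0. (t \<in> N \<longrightarrow> ball t d \<subseteq> U) \<and> (t \<notin> N \<longrightarrow>
         (\<forall>y. norm (y-t) < d \<longrightarrow> norm (F y - F t - (y-t) *\<^sub>R h t) \<le> e' * norm (y-t)))" for t
    proof (cases "t \<in> N")
      case True
      then show ?thesis using U by (metis open_contains_ball subsetD)
    next
      case False
      then have "(F has_vector_derivative h t) (at t)" by (simp add: N_def)
      then show ?thesis using e' False
        unfolding has_vector_derivative_def has_derivative_at_alt by blast
    qed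
    then obtain d where d: "\<And>t. d t > 0" and dN: "\<And>t. t \<in> N \<Longrightarrow> ball t (d t) \<subseteq> U"
      and dn: "\<And>t y. t \<notin> N \<Longrightarrow> norm (y-t) < d t \<Longrightarrow>
            norm (F y - F t - (y-t) *\<^sub>R h t) \<le> e' * norm (y-t)"
      by metis
    show "\<exists>\<gamma>. gauge \<gamma> \<and> (\<forall>p. p tagged_division_of {a..b} \<and> \<gamma> fine p \<longrightarrow>
        norm ((\<Sum>(x,k)\<in>p. measure lborel k *\<^sub>R h0 x) - (F b - F a)) < e)"
    proof (rule exI[of _ "\<lambda>x. ball x (d x)"], intro conjI allI impI)
      show "gauge (\<lambda>x. ball x (d x))" using d gauge_ball_dependent by blast
      fix p assume p': "p tagged_division_of {a..b} \<and> (\<lambda>x. ball x (d x)) fine p"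
      then have p: "p tagged_division_of {a..b}" and fine: "(\<lambda>x. ball x (d x)) fine p" by auto
      have fin: "finite p" using p by (rule tagged_division_of_finite)
      have K: "K \<subseteq> {a..b} \<and> x \<in> K \<and> Inf K \<le> x \<and> x \<le> Sup K \<and> measure lborel K = Sup K - Inf K
          \<and> K \<subseteq> ball x (d x)" if "(x, K) \<in> p" for x K
      proof -
        note pK = that
        have "x \<in> K" "K \<subseteq> {a..b}" using tagged_division_ofD(2,3)[OF p pK] by auto
        moreover obtain u v where "K = cbox u v" using tagged_division_ofD(4)[OF p pK] by auto
        moreover have "K \<subseteq> ball x (d x)" using fine pK by (auto simp: fine_def)
        ultimately show ?thesis by auto
      qed
      have ne: "(x, {}) \<notin> p" for x using K[of x "{}"] by auto
      define q where "q = {z \<in> p. fst z \<in> N}"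
      have qp: "q \<subseteq> p" by (auto simp: q_def)
      have q: "q tagged_partial_division_of {a..b}"
        using p qp tagged_partial_division_subset unfolding tagged_division_of_def by blast
      have Fba: "F b - F a = (\<Sum>(x,K)\<in>p. F(Sup K) - F(Inf K))"
        using additive_tagged_division_1[OF \<open>a \<le> b\<close> p, of F] by simp
      have S1: "norm (\<Sum>(x,K)\<in>p-q. measure lborel K *\<^sub>R h0 x - (F (Sup K) - F (Inf K))) \<le> e / 2"
      proof -
        have "norm (\<Sum>(x,K)\<in>p-q. measure lborel K *\<^sub>R h0 x - (F (Sup K) - F (Inf K)))
            \<le> (\<Sum>(x,K)\<in>p-q. e' * (Sup K - Inf K))"
        proof (rule sum_norm_le, safe)
          fix x K assume "(x, K) \<in> p" "(x, K) \<notin> q"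
          then have xN: "x \<notin> N" by (auto simp: q_def)
          obtain u0 v0 where "K = cbox u0 v0" using tagged_division_ofD(4)[OF p \<open>(x, K) \<in> p\<close>] by auto
          note KK = K[OF \<open>(x, K) \<in> p\<close>]
          define u v where "u = Inf K" and "v = Sup K"
          have uv: "u \<le> x" "x \<le> v" "K = {u..v}"
            using KK \<open>K = cbox u0 v0\<close> by (auto simp: u_def v_def)
          have "u \<in> K" "v \<in> K" using uv by auto
          then have "u \<in> ball x (d x)" "v \<in> ball x (d x)" using KK by blast+
          then have nd: "norm (u - x) < d x" "norm (v - x) < d x" by (simp_all add: dist_real_def)
          have nu: "norm (u - x) = x - u" "norm (v - x) = v - x" using uv by auto
          have *: "norm (F u - F x - (u-x) *\<^sub>R h x) \<le> e' * (x - u)"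
               "norm (F v - F x - (v-x) *\<^sub>R h x) \<le> e' * (v - x)"
            using dn[OF xN nd(1)] dn[OF xN nd(2)] unfolding nu by auto
          have "measure lborel K = v - u" using KK by (simp add: u_def v_def)
          moreover have "h0 x = h x" using xN by (simp add: h0_def)
          ultimately have "measure lborel K *\<^sub>R h0 x - (F v - F u) =
             (F u - F x - (u-x) *\<^sub>R h x) - (F v - F x - (v-x) *\<^sub>R h x)"
            by (simp add: scaleR_diff_left)
          also have "norm \<dots> \<le> e' * (v - u)"
            using norm_triangle_ineq4[of "F u - F x - (u-x) *\<^sub>R h x" "F v - F x - (v-x) *\<^sub>R h x"] *
              distrib_left[of e' "x - u" "v - x"] by simp
          finally show "norm (measure lborel K *\<^sub>R h0 x - (F (Sup K) - F (Inf K))) \<le> e' * (Sup K - Inf K)"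
            by (simp add: u_def v_def)
        qed
        also have "\<dots> \<le> (\<Sum>(x,K)\<in>p. e' * (Sup K - Inf K))"
          using fin e'
        proof (intro sum_mono2)
          fix z assume "z \<in> p - (p - q)"
          then obtain x L where z: "z = (x, L)" "(x, L) \<in> p" by (cases z) auto
          then have "Inf L \<le> Sup L" using K[OF z(2)] by linarith
          then show "0 \<le> (case z of (x, K) \<Rightarrow> e' * (Sup K - Inf K))" using e' z by simp
        qed auto
        also have "\<dots> = e' * (b - a)"
          using additive_tagged_division_1[OF \<open>a \<le> b\<close> p, of "\<lambda>x. x"]
          by (simp add: sum_distrib_left[symmetric] case_prod_unfold)
        also have "\<dots> \<le> e / 2" using \<open>e > 0\<close> \<open>a \<le> b\<close> by (simp add: e'_def field_simps)
        finally show ?thesis .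
      qed
      have S2: "norm (\<Sum>(x,K)\<in>q. measure lborel K *\<^sub>R h0 x - (F (Sup K) - F (Inf K))) < e / 2"
      proof -
        define D where "D = snd ` q"
        have D: "D division_of \<Union>D" unfolding D_def using q by (rule partial_division_of_tagged_division)
        have DU: "\<Union>D \<subseteq> U" "\<Union>D \<subseteq> {a..b}"
          using K dN by (fastforce simp: D_def q_def)+
        have "(\<Sum>K\<in>D. Sup K - Inf K) = sum (measure lborel) D"
          by (rule sum.cong) (use K qp in \<open>auto simp: D_def\<close>)
        also have "\<dots> = sum (measure lebesgue) D"
          by (intro sum.cong refl) (use division_ofD(4)[OF D] in force)
        also have "\<dots> = measure lebesgue (\<Union>D)" using content_division[OF D] .
        also have "\<dots> \<le> measure lebesgue U"
          using DU(1) fmeasurableD[OF lmeasurable_division[OF D]] mU(1)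
          by (rule measure_mono_fmeasurable)
        finally have "(\<Sum>K\<in>D. Sup K - Inf K) < \<delta>" using mU by simp
        then have "(\<Sum>K\<in>D. norm (F (Sup K) - F (Inf K))) < e / 2"
          using AC\<delta> D DU by blast
        moreover have "(\<Sum>(x,K)\<in>q. norm (F (Sup K) - F (Inf K))) = (\<Sum>K\<in>D. norm (F (Sup K) - F (Inf K)))"
        proof -
          define g where "g = (\<lambda>K. if K = {} then 0 else norm (F (Sup K) - F (Inf K)))"
          have "(\<Sum>(x,K)\<in>q. norm (F (Sup K) - F (Inf K))) = (\<Sum>(x,K)\<in>q. g K)"
            using ne qp by (intro sum.cong refl) (auto simp: g_def)
          also have "\<dots> = sum g D"
            unfolding D_def
          proof (rule sum.over_tagged_division_lemma[OF tagged_partial_division_of_Union_self[OF q]])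
            fix u v :: real assume "box u v = {}"
            then show "g (cbox u v) = 0"
              by (cases "u = v") (auto simp: g_def)
          qed
          also have "\<dots> = (\<Sum>K\<in>D. norm (F (Sup K) - F (Inf K)))"
            using ne qp by (intro sum.cong refl) (auto simp: g_def D_def)
          finally show ?thesis .
        qed
        moreover have "norm (\<Sum>(x,K)\<in>q. measure lborel K *\<^sub>R h0 x - (F (Sup K) - F (Inf K)))
           \<le> (\<Sum>(x,K)\<in>q. norm (F (Sup K) - F (Inf K)))"
          by (rule sum_norm_le) (auto simp: q_def h0_def norm_minus_commute)
        ultimately show ?thesis by simp
      qed
      have "(\<Sum>(x,k)\<in>p. measure lborel k *\<^sub>R h0 x) - (F b - F a) =
         (\<Sum>(x,K)\<in>p. measure lborel K *\<^sub>R h0 x - (F (Sup K) - F (Inf K)))"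
        unfolding Fba by (simp add: sum_subtractf case_prod_unfold)
      also have "\<dots> = (\<Sum>(x,K)\<in>p-q. measure lborel K *\<^sub>R h0 x - (F (Sup K) - F (Inf K))) +
          (\<Sum>(x,K)\<in>q. measure lborel K *\<^sub>R h0 x - (F (Sup K) - F (Inf K)))"
        using sum.subset_diff[OF qp fin] by blast
      finally show "norm ((\<Sum>(x,k)\<in>p. measure lborel k *\<^sub>R h0 x) - (F b - F a)) < e"
        using norm_add_less[of _ "e / 2" _ "e / 2"] norm_triangle_lt[OF add_le_less_mono[OF S1 S2]] by simp
    qed
  qed
  then show ?thesis
    by (rule has_integral_spike[OF N, rotated]) (auto simp: h0_def)
qed

text \<open>
  The points \<open>t\<close> at which difference quotients of \<open>F\<close> over arbitrarily short intervals differ from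
  \<open>h t\<close> by more than \<open>1 / Suc n\<close> are covered, in the sense of Vitali, by intervals with endpoint \<open>t\<close>
  on which the increment of \<open>F\<close> is badly approximated by
  \<open>h t\<close> times the length. Henstock's lemma bounds the total length of disjoint intervals of this kind.
\<close>

lemma primitive_has_vector_derivative_AE:
  fixes F h :: "real \<Rightarrow> 'a::euclidean_space"
  assumes prim: "\<And>a b. a \<le> b \<Longrightarrow> (h has_integral F b - F a) {a..b}"
  shows "AE t in lebesgue. (F has_vector_derivative h t) (at t)"
proof -
  define E where "E A n = {t. t \<in> {-A<..<A} \<and> (\<forall>d>0. \<exists>s. s \<noteq> t \<and> \<bar>s - t\<bar> < d \<and>
       norm (F s - F t - (s - t) *\<^sub>R h t) > \<bar>s - t\<bar> / real (Suc n))}" for A n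
  \<comment> \<open>The bad points in \<open>(-A, A)\<close> at precision \<open>1 / Suc n\<close>; all of them together form a countable union.\<close>
  have "negligible (E A n)" for A n
    unfolding negligible_outer_le
  proof (intro allI impI)
    fix e :: real assume "e > 0"
    have hint: "h integrable_on cbox (-A) A"
      using prim[of "-A" A] by (cases "-A \<le> A") auto
    have en: "e / real (Suc n) > 0" using \<open>e > 0\<close> by simp
    obtain \<gamma> where \<gamma>: "gauge \<gamma>" and hen: "\<And>p. \<lbrakk>p tagged_partial_division_of (cbox (-A) A); \<gamma> fine p\<rbrakk> \<Longrightarrow>
             sum (\<lambda>(x,k). norm(measure lborel k *\<^sub>R h x - integral k h)) p < e / real (Suc n)"
      by (blast intro: Henstock_lemma[OF hint en])
    \<comment> \<open>A pair \<open>(t, s)\<close> stands for the interval between \<open>t\<close> and \<open>s\<close>, tagged at its endpoint \<open>t\<close>.\<close>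
    define K where "K = {(t, s). t \<in> E A n \<and> s \<noteq> t \<and> {min s t..max s t} \<subseteq> \<gamma> t \<inter> {-A..A} \<and>
       norm (F s - F t - (s - t) *\<^sub>R h t) > \<bar>s - t\<bar> / real (Suc n)}"
    define c :: "real \<times> real \<Rightarrow> real" where "c = (\<lambda>(t, s). (t + s) / 2)"
    define r :: "real \<times> real \<Rightarrow> real" where "r = (\<lambda>(t, s). \<bar>s - t\<bar> / 2)"
    have ball: "cball (c (t, s)) (r (t, s)) = {min s t..max s t}" for t s
      by (auto simp: c_def r_def cball_eq_atLeastAtMost min_def max_def field_simps)
    have rpos: "0 < r i" if "i \<in> K" for i using that by (auto simp: K_def r_def)
    have cover: "\<exists>i. i \<in> K \<and> t \<in> cball (c i) (r i) \<and> r i < d" if "t \<in> E A n" "0 < d" for t d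
    proof -
      have "open (\<gamma> t \<inter> {-A<..<A})" "t \<in> \<gamma> t \<inter> {-A<..<A}"
        using \<gamma> that by (auto simp: gauge_def E_def)
      then obtain d1 where d1: "d1 > 0" "ball t d1 \<subseteq> \<gamma> t \<inter> {-A<..<A}"
        by (meson open_contains_ball)
      have "min d d1 > 0" using d1 that by simp
      moreover have "\<forall>d>0. \<exists>s. s \<noteq> t \<and> \<bar>s - t\<bar> < d \<and>
          norm (F s - F t - (s - t) *\<^sub>R h t) > \<bar>s - t\<bar> / real (Suc n)"
        using that(1) unfolding E_def by blast
      ultimately obtain s where s: "s \<noteq> t" "\<bar>s - t\<bar> < min d d1"
          "norm (F s - F t - (s - t) *\<^sub>R h t) > \<bar>s - t\<bar> / real (Suc n)"
        by blast
      have "{min s t..max s t} \<subseteq> ball t d1" using s by (auto simp: dist_real_def)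
      moreover have "ball t d1 \<subseteq> {-A..A}" "ball t d1 \<subseteq> \<gamma> t" using d1 by auto
      ultimately have "(t, s) \<in> K" using s that(1) unfolding K_def by blast
      moreover have "t \<in> cball (c (t, s)) (r (t, s))" unfolding ball by auto
      moreover have "r (t, s) < d" using s that(2) by (simp add: r_def)
      ultimately show ?thesis by blast
    qed
    obtain C where C: "countable C" "C \<subseteq> K"
      and disj: "pairwise (\<lambda>i j. disjnt (cball (c i) (r i)) (cball (c j) (r j))) C"
      and neg: "negligible (E A n - (\<Union>i \<in> C. cball (c i) (r i)))"
      by (rule Vitali_covering_theorem_cballs[of K r "E A n" c, OF rpos cover])
    have fin: "measure lebesgue (\<Union>i\<in>J. cball (c i) (r i)) \<le> e" if J: "J \<subseteq> C" "finite J" for J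
    proof -
      define p where "p = (\<lambda>i. (fst i, cball (c i) (r i))) ` J"
      have inj: "inj_on (\<lambda>i. (fst i, cball (c i) (r i))) J"
      proof (rule inj_onI)
        fix i j assume ij: "i \<in> J" "j \<in> J" "(fst i, cball (c i) (r i)) = (fst j, cball (c j) (r j))"
        show "i = j"
        proof (rule ccontr)
          assume "i \<noteq> j"
          then have "disjnt (cball (c i) (r i)) (cball (c j) (r j))"
            using disj J ij unfolding pairwise_def by blast
          moreover have "c i \<in> cball (c i) (r i)" using rpos[of i] C J ij(1) by (auto simp: less_imp_le)
          ultimately show False using ij by (auto simp: disjnt_def)
        qed
      qed
      have p: "p tagged_partial_division_of cbox (-A) A"
        unfolding tagged_partial_division_of_def
      proof (intro conjI allI impI)
        show "finite p" using J by (simp add: p_def)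
        fix x L assume "(x, L) \<in> p"
        then obtain i where i: "i \<in> J" "x = fst i" "L = cball (c i) (r i)" by (auto simp: p_def)
        obtain t s where ts: "i = (t, s)" by (cases i)
        have "(t, s) \<in> K" using i ts J C by auto
        then have sub: "{min s t..max s t} \<subseteq> {-A..A}" by (auto simp: K_def)
        have L: "L = {min s t..max s t}" using i ts ball by simp
        show "x \<in> L" using i ts L by auto
        show "L \<subseteq> cbox (-A) A" using L sub by simp
        show "\<exists>a b. L = cbox a b" using L by (metis box_real(2))
      next
        fix x1 K1 x2 K2 assume "(x1, K1) \<in> p \<and> (x2, K2) \<in> p \<and> (x1, K1) \<noteq> (x2, K2)"
        then obtain i j where ij: "i \<in> J" "j \<in> J" "K1 = cball (c i) (r i)" "K2 = cball (c j) (r j)" "i \<noteq> j"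
          by (auto simp: p_def)
        then have "disjnt K1 K2" using disj J by (auto simp: pairwise_def)
        then show "interior K1 \<inter> interior K2 = {}"
          using interior_subset[of K1] interior_subset[of K2] unfolding disjnt_def by blast
      qed
      have fine: "\<gamma> fine p"
      proof (rule fineI)
        fix x L assume "(x, L) \<in> p"
        then obtain t s where i: "(t, s) \<in> J" "x = t" "L = cball (c (t, s)) (r (t, s))" by (auto simp: p_def)
        then have "(t, s) \<in> K" using J C by auto
        then show "L \<subseteq> \<gamma> x" using i ball[of t s] by (auto simp: K_def)
      qed
      have key: "2 * r i / real (Suc n) \<le>
          norm (measure lborel (cball (c i) (r i)) *\<^sub>R h (fst i) - integral (cball (c i) (r i)) h)"
        if "i \<in> J" for i
      proof -
        obtain t s where ts: "i = (t, s)" by (cases i)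
        have K: "(t, s) \<in> K" using that ts J C by auto
        have int: "integral {u..v} h = F v - F u" if "u \<le> v" for u v
          using prim[OF that] by (rule integral_unique)
        have "\<bar>s - t\<bar> / real (Suc n) < norm (F s - F t - (s - t) *\<^sub>R h t)"
          using K by (simp add: K_def)
        also have "\<dots> = norm (measure lborel {min s t..max s t} *\<^sub>R h t - integral {min s t..max s t} h)"
        proof (cases "t \<le> s")
          case True
          then show ?thesis by (simp add: min_absorb2 max_absorb1 int norm_minus_commute)
        next
          case False
          then have "s \<le> t" by simp
          then have c: "measure lborel {min s t..max s t} = t - s"
              "integral {min s t..max s t} h = F t - F s"
            by (simp_all add: min_absorb1 max_absorb2 int)
          have "(t - s) *\<^sub>R h t - (F t - F s) = F s - F t - (s - t) *\<^sub>R h t"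
            by (simp add: scaleR_diff_left)
          then show ?thesis by (simp only: c)
        qed
        finally show ?thesis unfolding ts ball by (simp add: r_def)
      qed
      have "(\<Sum>i\<in>J. 2 * r i / real (Suc n)) \<le>
          (\<Sum>i\<in>J. norm (measure lborel (cball (c i) (r i)) *\<^sub>R h (fst i) - integral (cball (c i) (r i)) h))"
        by (rule sum_mono) (rule key)
      also have "\<dots> = sum (\<lambda>(x,k). norm(measure lborel k *\<^sub>R h x - integral k h)) p"
        unfolding p_def by (subst sum.reindex[OF inj]) simp
      also have "\<dots> < e / real (Suc n)" by (rule hen[OF p fine])
      finally have "(\<Sum>i\<in>J. 2 * r i) < e"
        by (simp add: sum_divide_distrib[symmetric] divide_less_cancel)
      moreover have "measure lebesgue (\<Union>i\<in>J. cball (c i) (r i)) \<le> (\<Sum>i\<in>J. measure lebesgue (cball (c i) (r i)))"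
        using J by (intro measure_UNION_le) auto
      moreover have "measure lebesgue (cball (c i) (r i)) = 2 * r i" if "i \<in> J" for i
        using rpos[of i] that J C by (auto simp: cball_eq_atLeastAtMost)
      ultimately show ?thesis by simp
    qed
    let ?B = "\<Union>i \<in> C. cball (c i) (r i)"
    have B: "?B \<in> lmeasurable" "measure lebesgue ?B \<le> e"
      using fmeasurable_UN_bound[OF C(1) _ fin] measure_UN_bound[OF C(1) _ fin] by auto
    let ?T = "(E A n - ?B) \<union> ?B"
    have "?T \<in> lmeasurable" by (rule fmeasurable.Un[OF negligible_imp_measurable[OF neg] B(1)])
    moreover have "measure lebesgue ?T \<le> e"
      using measure_Un_le[of "E A n - ?B" lebesgue ?B] neg B
      by (simp add: negligible_imp_sets negligible_imp_measure0 fmeasurableD)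
    ultimately show "\<exists>T. E A n \<subseteq> T \<and> T \<in> lmeasurable \<and> measure lebesgue T \<le> e"
      by (intro exI[of _ ?T]) auto
  qed
  then have "negligible (\<Union>(m, n)\<in>(UNIV :: (nat \<times> nat) set). E (real m) n)"
    by (intro negligible_countable_Union) (auto intro: countable_subset)
  moreover have "(F has_vector_derivative h t) (at t)"
    if t: "t \<notin> (\<Union>(m, n)\<in>(UNIV :: (nat \<times> nat) set). E (real m) n)" for t
    unfolding has_vector_derivative_def has_derivative_at_alt
  proof (intro conjI allI impI)
    show "bounded_linear (\<lambda>x. x *\<^sub>R h t)" by (rule bounded_linear_scaleR_left)
    fix e :: real assume "e > 0"
    then obtain n where n: "1 / real (Suc n) < e" using nat_approx_posE by blast
    obtain m :: nat where "\<bar>t\<bar> < real m" using reals_Archimedean2 by blast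
    then have "t \<in> {- real m <..< real m}" by auto
    moreover have "t \<notin> E (real m) n" using t by auto
    ultimately obtain d where d0: "d > 0" "\<not> (\<exists>s. s \<noteq> t \<and> \<bar>s - t\<bar> < d \<and>
       norm (F s - F t - (s - t) *\<^sub>R h t) > \<bar>s - t\<bar> / real (Suc n))"
      unfolding E_def by blast
    then have d: "d > 0" "\<And>s. s \<noteq> t \<Longrightarrow> \<bar>s - t\<bar> < d \<Longrightarrow>
       norm (F s - F t - (s - t) *\<^sub>R h t) \<le> \<bar>s - t\<bar> / real (Suc n)"
      using not_less by blast+
    show "\<exists>d>0. \<forall>y. norm (y - t) < d \<longrightarrow> norm (F y - F t - (y - t) *\<^sub>R h t) \<le> e * norm (y - t)"
    proof (intro exI[of _ d] conjI allI impI d(1))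
      fix y assume y: "norm (y - t) < d"
      show "norm (F y - F t - (y - t) *\<^sub>R h t) \<le> e * norm (y - t)"
      proof (cases "y = t")
        case False
        then have "norm (F y - F t - (y - t) *\<^sub>R h t) \<le> \<bar>y - t\<bar> * (1 / real (Suc n))"
          using d(2)[of y] y by simp
        also have "\<dots> \<le> \<bar>y - t\<bar> * e" using n by (intro mult_left_mono) auto
        finally show ?thesis by (simp add: mult.commute)
      qed simp
    qed
  qed
  ultimately show ?thesis
    by (auto simp: negligible_iff_null_sets intro!: AE_I')
qed

section \<open>Square-integrable functions\<close>

lemma L2D:
  assumes "h \<in> L2"
  shows L2_measurable: "h \<in> borel_measurable lebesgue"
    and L2_integrable_square: "integrable lebesgue (\<lambda>t. (norm (h t))\<^sup>2)"
  using assms by (auto simp: L2_def)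

lemma L2_norm_nonneg: "L2_norm h \<ge> 0"
  by (simp add: L2_norm_def)

lemma L2_norm_square: "(L2_norm h)\<^sup>2 = (LINT t|lebesgue. (norm (h t))\<^sup>2)"
  by (simp add: L2_norm_def)

lemma L2_dominated:
  assumes g: "g \<in> borel_measurable lebesgue" and h: "h \<in> L2"
    and le: "\<And>t. norm (g t) \<le> C * norm (h t)"
  shows "g \<in> L2" and "0 \<le> C \<Longrightarrow> L2_norm g \<le> C * L2_norm h"
proof -
  have sq: "(norm (g t))\<^sup>2 \<le> C\<^sup>2 * (norm (h t))\<^sup>2" for t
    using power_mono[OF le[of t], of 2] by (simp add: power_mult_distrib)
  have int: "integrable lebesgue (\<lambda>t. (norm (g t))\<^sup>2)"
  proof (rule Bochner_Integration.integrable_bound[OF integrable_mult_right[OF L2_integrable_square[OF h], of "C\<^sup>2"]])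
    show "(\<lambda>t. (norm (g t))\<^sup>2) \<in> borel_measurable lebesgue" using g by measurable
    show "AE t in lebesgue. norm ((norm (g t))\<^sup>2) \<le> norm (C\<^sup>2 * (norm (h t))\<^sup>2)"
      using sq by (intro AE_I2) simp
  qed
  then show "g \<in> L2" using g by (simp add: L2_def)
  assume "0 \<le> C"
  have "(L2_norm g)\<^sup>2 \<le> (LINT t|lebesgue. C\<^sup>2 * (norm (h t))\<^sup>2)"
    unfolding L2_norm_square
  proof (rule integral_mono[OF int])
    show "integrable lebesgue (\<lambda>t. C\<^sup>2 * (norm (h t))\<^sup>2)"
      using L2_integrable_square[OF h] by (intro integrable_mult_right)
  qed (rule sq)
  also have "\<dots> = (C * L2_norm h)\<^sup>2" by (simp add: L2_norm_square power_mult_distrib)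
  finally show "L2_norm g \<le> C * L2_norm h"
    by (rule power2_le_imp_le) (simp add: \<open>0 \<le> C\<close> L2_norm_nonneg)
qed

lemma L2_Cauchy_Schwarz:
  assumes f: "f \<in> L2" and g: "g \<in> L2"
  shows L2_integrable_mult: "integrable lebesgue (\<lambda>t. norm (f t) * norm (g t))"
    and L2_integral_mult_le: "(LINT t|lebesgue. norm (f t) * norm (g t)) \<le> L2_norm f * L2_norm g"
proof -
  have [measurable]: "f \<in> borel_measurable lebesgue" "g \<in> borel_measurable lebesgue"
    using f g by (auto dest: L2_measurable)
  note sq = L2_integrable_square[OF f] L2_integrable_square[OF g]
  have amgm: "norm (f t) * norm (g t) \<le> (norm (f t))\<^sup>2 + (norm (g t))\<^sup>2" for t
    using sum_squares_bound[of "norm (f t)" "norm (g t)"] mult_nonneg_nonneg[OF norm_ge_zero norm_ge_zero, of "f t" "g t"] by linarith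
  show int: "integrable lebesgue (\<lambda>t. norm (f t) * norm (g t))"
  proof (rule Bochner_Integration.integrable_bound[OF Bochner_Integration.integrable_add[OF sq]])
    show "(\<lambda>t. norm (f t) * norm (g t)) \<in> borel_measurable lebesgue" by measurable
    show "AE t in lebesgue. norm (norm (f t) * norm (g t)) \<le> norm ((norm (f t))\<^sup>2 + (norm (g t))\<^sup>2)"
      using amgm by (intro AE_I2) simp
  qed
  have "ennreal ((LINT t|lebesgue. norm (f t) * norm (g t))\<^sup>2) =
      (\<integral>\<^sup>+t. ennreal (norm (f t)) * ennreal (norm (g t)) \<partial>lebesgue)\<^sup>2"
    using int by (simp add: nn_integral_eq_integral ennreal_mult[symmetric] ennreal_power)
  also have "\<dots> \<le> (\<integral>\<^sup>+t. ennreal (norm (f t)) ^ 2 \<partial>lebesgue) * (\<integral>\<^sup>+t. ennreal (norm (g t)) ^ 2 \<partial>lebesgue)"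
    by (rule Cauchy_Schwarz_nn_integral) auto
  also have "\<dots> = ennreal ((L2_norm f)\<^sup>2 * (L2_norm g)\<^sup>2)"
    using sq by (simp add: L2_norm_square nn_integral_eq_integral ennreal_mult[symmetric] ennreal_power)
  finally have "(LINT t|lebesgue. norm (f t) * norm (g t))\<^sup>2 \<le> (L2_norm f * L2_norm g)\<^sup>2"
    by (subst (asm) ennreal_le_iff) (auto simp: power_mult_distrib)
  then show "(LINT t|lebesgue. norm (f t) * norm (g t)) \<le> L2_norm f * L2_norm g"
    by (rule power2_le_imp_le) (simp add: L2_norm_nonneg)
qed

lemma L2_add:
  assumes f: "f \<in> L2" and g: "g \<in> L2"
  shows "(\<lambda>t. f t + g t) \<in> L2" and "L2_norm (\<lambda>t. f t + g t) \<le> L2_norm f + L2_norm g"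
proof -
  have [measurable]: "f \<in> borel_measurable lebesgue" "g \<in> borel_measurable lebesgue"
    using f g by (auto dest: L2_measurable)
  note sq = L2_integrable_square[OF f] L2_integrable_square[OF g] L2_integrable_mult[OF f g]
  let ?b = "\<lambda>t. (norm (f t))\<^sup>2 + 2 * (norm (f t) * norm (g t)) + (norm (g t))\<^sup>2"
  have le: "(norm (f t + g t))\<^sup>2 \<le> ?b t" for t
    using power_mono[OF norm_triangle_ineq[of "f t" "g t"], of 2] by (simp add: power2_sum)
  have b: "integrable lebesgue ?b" using sq by simp
  have int: "integrable lebesgue (\<lambda>t. (norm (f t + g t))\<^sup>2)"
    using le by (intro Bochner_Integration.integrable_bound[OF b]) (auto intro: order_trans)
  then show "(\<lambda>t. f t + g t) \<in> L2" by (simp add: L2_def)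
  have "(L2_norm (\<lambda>t. f t + g t))\<^sup>2 \<le> (LINT t|lebesgue. ?b t)"
    unfolding L2_norm_square using int b le by (intro integral_mono) auto
  also have "\<dots> = (L2_norm f)\<^sup>2 + 2 * (LINT t|lebesgue. norm (f t) * norm (g t)) + (L2_norm g)\<^sup>2"
    using sq by (simp add: L2_norm_square)
  also have "\<dots> \<le> (L2_norm f + L2_norm g)\<^sup>2"
    using L2_integral_mult_le[OF f g] by (simp add: power2_sum)
  finally show "L2_norm (\<lambda>t. f t + g t) \<le> L2_norm f + L2_norm g"
    by (rule power2_le_imp_le) (simp add: L2_norm_nonneg)
qed

lemma L2_scale:
  fixes h :: "real \<Rightarrow> complex"
  assumes h: "h \<in> L2"
  shows "(\<lambda>t. c * h t) \<in> L2" and "L2_norm (\<lambda>t. c * h t) = norm c * L2_norm h"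
proof -
  have [measurable]: "h \<in> borel_measurable lebesgue" using h by (rule L2_measurable)
  show "(\<lambda>t. c * h t) \<in> L2"
    using L2_dominated(1)[OF _ h, of "\<lambda>t. c * h t" "norm c"] by (simp add: norm_mult)
  show "L2_norm (\<lambda>t. c * h t) = norm c * L2_norm h"
    by (simp add: L2_norm_def norm_mult power_mult_distrib real_sqrt_mult)
qed

lemma L2_diff:
  fixes f g :: "real \<Rightarrow> complex"
  assumes "f \<in> L2" "g \<in> L2"
  shows "(\<lambda>t. f t - g t) \<in> L2"
  using L2_add(1)[OF assms(1) L2_scale(1)[OF assms(2), of "-1"]] by simp

lemma L2_bounded_mult:
  fixes g h :: "real \<Rightarrow> complex"
  assumes h: "h \<in> L2" and g: "g \<in> borel_measurable lebesgue" and B: "\<And>t. norm (g t) \<le> B"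
  shows "(\<lambda>t. g t * h t) \<in> L2" and "L2_norm (\<lambda>t. g t * h t) \<le> B * L2_norm h"
proof -
  have "0 \<le> B" using B[of 0] norm_ge_zero order_trans by blast
  moreover have "norm (g t * h t) \<le> B * norm (h t)" for t
    using B[of t] by (simp add: norm_mult mult_right_mono)
  moreover have "(\<lambda>t. g t * h t) \<in> borel_measurable lebesgue"
    using L2_measurable[OF h] g by measurable
  ultimately show "(\<lambda>t. g t * h t) \<in> L2" "L2_norm (\<lambda>t. g t * h t) \<le> B * L2_norm h"
    using L2_dominated[OF _ h] by blast+
qed

lemma lebesgue_measurable_reflect:
  fixes h :: "real \<Rightarrow> 'a::euclidean_space"
  shows "h \<in> borel_measurable lebesgue \<Longrightarrow> (\<lambda>t. h (- t)) \<in> borel_measurable lebesgue"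
  using borel_measurable_affine[of h "-1" 0] by simp

lemma L2_reflect:
  fixes h :: "real \<Rightarrow> 'a::euclidean_space"
  assumes h: "h \<in> L2"
  shows "(\<lambda>t. h (- t)) \<in> L2" and "L2_norm (\<lambda>t. h (- t)) = L2_norm h"
  using lebesgue_measurable_reflect[OF L2_measurable[OF h]]
    lebesgue_integrable_real_affine[OF L2_integrable_square[OF h], of "-1" 0]
    lebesgue_integral_real_affine[of "-1" "\<lambda>t. (norm (h t))\<^sup>2" 0]
  by (auto simp: L2_def L2_norm_def)

text \<open>
  The operator with potential \<open>v\<close> couples \<open>t\<close> and \<open>- t\<close>, so that almost-everywhere statements have to
  be moved along the reflection.
\<close>

lemma AE_lebesgue_reflect:
  assumes "AE t in lebesgue. P t"
  shows "AE t::real in lebesgue. P (- t)"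
proof -
  obtain N where N: "{t. \<not> P t} \<subseteq> N" "N \<in> null_sets lebesgue"
    using assms by (auto simp: eventually_ae_filter)
  have "negligible (uminus ` N)"
    using N by (intro negligible_differentiable_image_negligible)
      (auto simp: negligible_iff_null_sets differentiable_on_def)
  moreover have "{t. \<not> P (- t)} \<subseteq> uminus ` N" using N by force
  ultimately show ?thesis
    by (auto simp: negligible_iff_null_sets intro!: AE_I')
qed

lemma sigma_finite_lebesgue: "sigma_finite_measure lebesgue"
proof
  obtain A :: "'a set set" where A: "countable A" "A \<subseteq> sets lborel" "\<Union>A = space lborel" "\<forall>a\<in>A. emeasure lborel a \<noteq> \<infinity>"
    using sigma_finite_measure.sigma_finite_countable[OF sigma_finite_lborel] by blast
  then show "\<exists>A::'a set set. countable A \<and> A \<subseteq> sets lebesgue \<and> \<Union>A = space lebesgue \<and> (\<forall>a\<in>A. emeasure lebesgue a \<noteq> \<infinity>)"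
    by (intro exI[of _ A]) (auto simp: subset_eq)
qed

interpretation lebesgue: sigma_finite_measure lebesgue
  by (rule sigma_finite_lebesgue)

lemma has_bochner_integral_exp_left:
  fixes \<beta> t :: real
  assumes "\<beta> > 0"
  shows "has_bochner_integral lebesgue (\<lambda>s. indicator {..t} s * exp (- \<beta> * (t - s))) (1 / \<beta>)"
proof -
  have *: "((\<lambda>x::real. exp (-\<beta>*x)) has_integral 1/\<beta>) {0..}"
    using has_integral_exp_minus_to_infinity[OF assms, of 0] by simp
  then have "(\<lambda>x. exp (-\<beta>*x)) absolutely_integrable_on {0..}"
    by (intro nonnegative_absolutely_integrable_1) auto
  then have "integrable lebesgue (\<lambda>x. indicator {0..} x * exp (-\<beta>*x))"
      "(LINT x|lebesgue. indicator {0..} x * exp (-\<beta>*x)) = 1/\<beta>"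
    using * set_lebesgue_integral_eq_integral(2)[of "{0..}" "\<lambda>x. exp (-\<beta>*x)"]
    by (auto simp: set_integrable_def set_lebesgue_integral_def integral_unique)
  then have "has_bochner_integral lebesgue (\<lambda>x. indicator {0..} x * exp (-\<beta>*x)) (1/\<beta>)"
    by (simp add: has_bochner_integral_iff)
  then have "has_bochner_integral lebesgue (\<lambda>x. indicator {0..} (t + (-1) * x) * exp (-\<beta>*(t + (-1) * x))) (1/\<beta>)"
    by (subst (asm) has_bochner_integral_lebesgue_real_affine_iff[of "-1" _ _ t]) simp_all
  moreover have "indicator {0..} (t + (-1) * x) = (indicator {..t} x :: real)" for x
    by (auto simp: indicator_def)
  ultimately show ?thesis by simp
qed

section \<open>Closure properties of absolute continuity\<close>

text \<open>
  By Cauchy--Schwarz the increments of a primitive of \<open>h\<close> over a family of intervals sum to at most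
  the \<open>L2\<close> norm of \<open>h\<close> times the square root of the total length. Only the restriction of \<open>h\<close> to
  \<open>{a..b}\<close> enters, which admits factors that grow at infinity.
\<close>

lemma absolutely_continuous_on_primitive:
  fixes F h :: "real \<Rightarrow> 'a::euclidean_space"
  assumes h: "(\<lambda>t. indicator {a..b} t *\<^sub>R h t) \<in> L2"
    and prim: "\<And>u v. a \<le> u \<Longrightarrow> u \<le> v \<Longrightarrow> v \<le> b \<Longrightarrow> (h has_integral F v - F u) {u..v}"
  shows "absolutely_continuous_on {a..b} F"
  unfolding absolutely_continuous_on_def
proof (intro allI impI)
  fix \<epsilon> :: real assume "\<epsilon> > 0"
  let ?h = "\<lambda>t. indicator {a..b} t *\<^sub>R h t"
  define M where "M = L2_norm ?h + 1"
  have M: "M > 0" using L2_norm_nonneg[of ?h] by (simp add: M_def)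
  show "\<exists>\<delta>>0. \<forall>D. D division_of \<Union>D \<and> \<Union>D \<subseteq> {a..b} \<and> (\<Sum>K\<in>D. Sup K - Inf K) < \<delta> \<longrightarrow>
      (\<Sum>K\<in>D. norm (F (Sup K) - F (Inf K))) < \<epsilon>"
  proof (intro exI[of _ "(\<epsilon> / M)\<^sup>2"] conjI allI impI)
    show "0 < (\<epsilon> / M)\<^sup>2" using \<open>\<epsilon> > 0\<close> M by simp
    fix D assume D': "D division_of \<Union>D \<and> \<Union>D \<subseteq> {a..b} \<and> (\<Sum>K\<in>D. Sup K - Inf K) < (\<epsilon> / M)\<^sup>2"
    then have D: "D division_of \<Union>D" and sub: "\<Union>D \<subseteq> {a..b}" and small: "(\<Sum>K\<in>D. Sup K - Inf K) < (\<epsilon> / M)\<^sup>2"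
      by auto
    have K: "K \<noteq> {}" "K = {Inf K..Sup K}" "Inf K \<le> Sup K" "a \<le> Inf K" "Sup K \<le> b" if KD: "K \<in> D" for K
    proof -
      obtain u v where uv: "K = cbox u v" using division_ofD(4)[OF D KD] by auto
      have ne: "K \<noteq> {}" using division_ofD(3)[OF D KD] .
      have "K \<subseteq> {a..b}" using KD sub by auto
      with uv ne show "K \<noteq> {}" "K = {Inf K..Sup K}" "Inf K \<le> Sup K" "a \<le> Inf K" "Sup K \<le> b" by auto
    qed
    let ?U = "\<Union>D"
    have U: "?U \<in> lmeasurable" by (rule lmeasurable_division[OF D])
    have mU: "measure lebesgue ?U = (\<Sum>K\<in>D. Sup K - Inf K)"
    proof -
      have "(\<Sum>K\<in>D. measure lebesgue K) = (\<Sum>K\<in>D. Sup K - Inf K)"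
      proof (rule sum.cong[OF refl])
        fix L assume "L \<in> D"
        then obtain u v where "L = {u..v}" "u \<le> v" using K[of L] by metis
        then show "measure lebesgue L = Sup L - Inf L" by simp
      qed
      then show ?thesis using content_division[OF D] by simp
    qed
    have sq: "(norm (indicator ?U t :: real))\<^sup>2 = indicator ?U t" for t
      by (simp add: indicator_def)
    have iL2: "(indicator ?U :: real \<Rightarrow> real) \<in> L2"
      using U unfolding L2_def mem_Collect_eq sq by (auto simp: fmeasurable_def intro!: integrable_real_indicator)
    have niL2: "L2_norm (indicator ?U :: real \<Rightarrow> real) = sqrt (measure lebesgue ?U)"
      unfolding L2_norm_def sq by simp
    have int: "integrable lebesgue (\<lambda>t. indicator ?U t * norm (?h t))"
      using L2_integrable_mult[OF iL2 h] by (simp add: abs_mult)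
    have intK: "set_integrable lebesgue K (\<lambda>t. norm (?h t))" if "K \<in> D" for K
    proof -
      have Km: "K \<in> sets lebesgue" using division_ofD(4)[OF D that] by auto
      have "integrable lebesgue (\<lambda>t. indicator K t *\<^sub>R (indicator ?U t * norm (?h t)))"
        using int Km by (rule integrable_mult_indicator[rotated])
      moreover have "indicator K t *\<^sub>R (indicator ?U t * norm (?h t)) = indicator K t *\<^sub>R norm (?h t)" for t
        using that by (auto simp: indicator_def)
      ultimately show ?thesis by (simp only: set_integrable_def)
    qed
    have le: "norm (F (Sup K) - F (Inf K)) \<le> integral K (\<lambda>t. norm (?h t))" if KD: "K \<in> D" for K
    proof -
      have "(h has_integral F (Sup K) - F (Inf K)) K"
        using prim[of "Inf K" "Sup K"] K[OF KD] by metis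
      then have *: "(?h has_integral F (Sup K) - F (Inf K)) K"
        by (rule has_integral_eq[rotated]) (use KD sub in auto)
      have "norm (integral K ?h) \<le> integral K (\<lambda>t. norm (?h t))"
        using * set_lebesgue_integral_eq_integral(1)[OF intK[OF KD]]
        by (intro integral_norm_bound_integral) auto
      then show ?thesis using * by (simp add: integral_unique)
    qed
    have "(\<Sum>K\<in>D. norm (F (Sup K) - F (Inf K))) \<le> (\<Sum>K\<in>D. integral K (\<lambda>t. norm (?h t)))"
      by (rule sum_mono) (rule le)
    also have "\<dots> = integral ?U (\<lambda>t. norm (?h t))"
    proof (rule integral_combine_division_topdown[symmetric, OF _ D])
      show "(\<lambda>t. norm (?h t)) integrable_on ?U"
        using int by (intro set_lebesgue_integral_eq_integral(1)) (simp add: set_integrable_def)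
    qed
    also have "\<dots> = (LINT t|lebesgue. indicator ?U t * norm (?h t))"
      using int set_lebesgue_integral_eq_integral(2)[of ?U "\<lambda>t. norm (?h t)"]
      by (simp add: set_integrable_def set_lebesgue_integral_def)
    also have "\<dots> \<le> sqrt (measure lebesgue ?U) * L2_norm ?h"
      using L2_integral_mult_le[OF iL2 h] niL2 by simp
    also have "\<dots> \<le> sqrt (measure lebesgue ?U) * M"
      by (intro mult_left_mono) (auto simp: M_def)
    also have "\<dots> < \<epsilon> / M * M"
      using small M \<open>\<epsilon> > 0\<close> unfolding mU by (intro mult_strict_right_mono real_less_lsqrt) (auto simp: sum_nonneg K)
    finally show "(\<Sum>K\<in>D. norm (F (Sup K) - F (Inf K))) < \<epsilon>" using M by simp
  qed
qed

lemma absolutely_continuous_on_imp_continuous_on: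
  fixes F :: "real \<Rightarrow> 'a::real_normed_vector"
  assumes AC: "absolutely_continuous_on {a..b} F"
  shows "continuous_on {a..b} F"
  unfolding continuous_on_iff
proof (intro ballI allI impI)
  fix x e :: real assume x: "x \<in> {a..b}" and "e > 0"
  obtain \<delta> where \<delta>: "\<delta> > 0"
      and AC': "\<forall>D. D division_of \<Union>D \<and> \<Union>D \<subseteq> {a..b} \<and> (\<Sum>K\<in>D. Sup K - Inf K) < \<delta> \<longrightarrow>
        (\<Sum>K\<in>D. norm (F (Sup K) - F (Inf K))) < e"
    using AC[unfolded absolutely_continuous_on_def, rule_format, OF \<open>e > 0\<close>]
    by (elim exE conjE)
  show "\<exists>d>0. \<forall>x'\<in>{a..b}. dist x' x < d \<longrightarrow> dist (F x') (F x) < e"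
  proof (intro exI[of _ \<delta>] conjI \<delta> ballI impI)
    fix y assume y: "y \<in> {a..b}" "dist y x < \<delta>"
    have "{{min x y..max x y}} division_of \<Union>{{min x y..max x y}}"
      using division_of_self[of "min x y" "max x y"] by simp
    moreover have "\<Union>{{min x y..max x y}} \<subseteq> {a..b}" using x y by auto
    moreover have "(\<Sum>K\<in>{{min x y..max x y}}. Sup K - Inf K) < \<delta>"
      using y by (auto simp: dist_real_def)
    ultimately have "(\<Sum>K\<in>{{min x y..max x y}}. norm (F (Sup K) - F (Inf K))) < e"
      using AC'[rule_format, OF conjI[OF _ conjI]] by blast
    then show "dist (F y) (F x) < e"
      by (cases "x \<le> y") (auto simp: dist_norm norm_minus_commute min_def max_def)
  qed
qed

lemma absolutely_continuous_on_mult: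
  fixes F G :: "real \<Rightarrow> 'a::real_normed_algebra"
  assumes F: "absolutely_continuous_on {a..b} F" and G: "absolutely_continuous_on {a..b} G"
  shows "absolutely_continuous_on {a..b} (\<lambda>t. F t * G t)"
  unfolding absolutely_continuous_on_def
proof (intro allI impI)
  fix \<epsilon> :: real assume "\<epsilon> > 0"
  have "bounded (F ` {a..b})" "bounded (G ` {a..b})"
    using absolutely_continuous_on_imp_continuous_on[OF F] absolutely_continuous_on_imp_continuous_on[OF G]
    by (auto intro!: compact_imp_bounded compact_continuous_image)
  then obtain BF BG where BF: "BF > 0" "\<And>t. t \<in> {a..b} \<Longrightarrow> norm (F t) \<le> BF"
    and BG: "BG > 0" "\<And>t. t \<in> {a..b} \<Longrightarrow> norm (G t) \<le> BG"
    unfolding bounded_pos by (metis imageI)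
  define B where "B = BF + BG"
  have B: "B > 0" using BF BG by (simp add: B_def)
  then have e: "\<epsilon> / (2 * B) > 0" using \<open>\<epsilon> > 0\<close> by simp
  obtain \<delta>1 where 1: "\<delta>1 > 0"
      "\<forall>D. D division_of \<Union>D \<and> \<Union>D \<subseteq> {a..b} \<and> (\<Sum>K\<in>D. Sup K - Inf K) < \<delta>1 \<longrightarrow>
        (\<Sum>K\<in>D. norm (F (Sup K) - F (Inf K))) < \<epsilon> / (2 * B)"
    using F[unfolded absolutely_continuous_on_def, rule_format, OF e] by (elim exE conjE)
  obtain \<delta>2 where 2: "\<delta>2 > 0"
      "\<forall>D. D division_of \<Union>D \<and> \<Union>D \<subseteq> {a..b} \<and> (\<Sum>K\<in>D. Sup K - Inf K) < \<delta>2 \<longrightarrow>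
        (\<Sum>K\<in>D. norm (G (Sup K) - G (Inf K))) < \<epsilon> / (2 * B)"
    using G[unfolded absolutely_continuous_on_def, rule_format, OF e] by (elim exE conjE)
  show "\<exists>\<delta>>0. \<forall>D. D division_of \<Union>D \<and> \<Union>D \<subseteq> {a..b} \<and> (\<Sum>K\<in>D. Sup K - Inf K) < \<delta> \<longrightarrow>
      (\<Sum>K\<in>D. norm (F (Sup K) * G (Sup K) - F (Inf K) * G (Inf K))) < \<epsilon>"
  proof (intro exI[of _ "min \<delta>1 \<delta>2"] conjI allI impI)
    show "min \<delta>1 \<delta>2 > 0" using 1 2 by simp
    fix D assume D: "D division_of \<Union>D \<and> \<Union>D \<subseteq> {a..b} \<and> (\<Sum>K\<in>D. Sup K - Inf K) < min \<delta>1 \<delta>2"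
    then have D1: "D division_of \<Union>D \<and> \<Union>D \<subseteq> {a..b} \<and> (\<Sum>K\<in>D. Sup K - Inf K) < \<delta>1"
      and D2: "D division_of \<Union>D \<and> \<Union>D \<subseteq> {a..b} \<and> (\<Sum>K\<in>D. Sup K - Inf K) < \<delta>2"
      by auto
    let ?f = "\<lambda>K. norm (F (Sup K) - F (Inf K))" and ?g = "\<lambda>K. norm (G (Sup K) - G (Inf K))"
    have le: "norm (F (Sup K) * G (Sup K) - F (Inf K) * G (Inf K)) \<le> B * ?f K + B * ?g K" if KD: "K \<in> D" for K
    proof -
      obtain u v where uv: "K = cbox u v" using division_ofD(4)[OF conjunct1[OF D] KD] by auto
      have ne: "K \<noteq> {}" using division_ofD(3)[OF conjunct1[OF D] KD] .
      have "K \<subseteq> {a..b}" using KD D by auto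
      then have m: "Sup K \<in> {a..b}" "Inf K \<in> {a..b}" using uv ne by auto
      have "F (Sup K) * G (Sup K) - F (Inf K) * G (Inf K) =
          (F (Sup K) - F (Inf K)) * G (Sup K) + F (Inf K) * (G (Sup K) - G (Inf K))"
        by (simp add: algebra_simps)
      also have "norm \<dots> \<le> ?f K * norm (G (Sup K)) + norm (F (Inf K)) * ?g K"
        by (intro norm_triangle_mono norm_mult_ineq)
      also have "\<dots> \<le> ?f K * B + B * ?g K"
        using BF(1) BG(1) BF(2)[OF m(2)] BG(2)[OF m(1)]
        by (intro add_mono mult_left_mono mult_right_mono) (auto simp: B_def)
      finally show ?thesis by (simp add: mult.commute)
    qed
    have "(\<Sum>K\<in>D. norm (F (Sup K) * G (Sup K) - F (Inf K) * G (Inf K))) \<le> (\<Sum>K\<in>D. B * ?f K + B * ?g K)"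
      by (rule sum_mono) (rule le)
    also have "\<dots> = B * (\<Sum>K\<in>D. ?f K) + B * (\<Sum>K\<in>D. ?g K)"
      by (simp add: sum.distrib sum_distrib_left)
    also have "\<dots> < B * (\<epsilon> / (2 * B)) + B * (\<epsilon> / (2 * B))"
      using 1(2)[rule_format, OF D1] 2(2)[rule_format, OF D2] B
      by (intro add_strict_mono mult_strict_left_mono)
    also have "\<dots> = \<epsilon>" using B by simp
    finally show "(\<Sum>K\<in>D. norm (F (Sup K) * G (Sup K) - F (Inf K) * G (Inf K))) < \<epsilon>" .
  qed
qed

section \<open>Inverting a first-order operator with constant coefficients\<close>

text \<open>
  The fundamental solution of \<open>d/dt + c\<close> supported on the positive half-line; it decays at infinity
  if \<open>Re c > 0\<close>.
\<close>

definition decay :: "complex \<Rightarrow> real \<Rightarrow> complex" where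
  "decay c r = (if 0 \<le> r then exp (- c * of_real r) else 0)"

text \<open>
  For \<open>Re c > 0\<close> this is the bounded inverse of \<open>d/dt + c\<close> on \<open>L2\<close>.
\<close>

definition decay_conv :: "complex \<Rightarrow> (real \<Rightarrow> complex) \<Rightarrow> real \<Rightarrow> complex" where
  "decay_conv c h t = (LINT s|lebesgue. decay c (t - s) * h s)"

lemma decay_measurable [measurable]: "decay c \<in> borel_measurable borel"
  unfolding decay_def by measurable

lemma norm_decay: "norm (decay c (t - s)) = indicator {..t} s * exp (- Re c * (t - s))"
  by (simp add: decay_def indicator_def)

lemma norm_decay_le: "0 \<le> Re c \<Longrightarrow> norm (decay c r) \<le> 1"
  by (simp add: decay_def)

lemma decay_L2:
  assumes c: "Re c > 0"
  shows "(\<lambda>s. decay c (t - s)) \<in> L2" and "L2_norm (\<lambda>s. decay c (t - s)) = 1 / sqrt (2 * Re c)"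
proof -
  have sq: "(norm (decay c (t - s)))\<^sup>2 = indicator {..t} s * exp (- (2 * Re c) * (t - s))" for s
    by (simp add: norm_decay power_mult_distrib indicator_def exp_double[symmetric] algebra_simps)
  have "2 * Re c > 0" using c by simp
  note int = has_bochner_integral_exp_left[OF this, of t]
  have "(\<lambda>s. decay c (t - s)) \<in> borel_measurable lborel" by measurable
  then have "(\<lambda>s. decay c (t - s)) \<in> borel_measurable lebesgue" by (rule measurable_completion)
  then show "(\<lambda>s. decay c (t - s)) \<in> L2"
    using int unfolding L2_def mem_Collect_eq sq by (simp add: has_bochner_integral_iff)
  show "L2_norm (\<lambda>s. decay c (t - s)) = 1 / sqrt (2 * Re c)"
    using int unfolding L2_norm_def sq by (simp add: has_bochner_integral_iff real_sqrt_divide)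
qed

lemma decay_conv_integrable:
  assumes c: "Re c > 0" and h: "h \<in> L2"
  shows "integrable lebesgue (\<lambda>s. decay c (t - s) * h s)"
proof (rule integrable_norm_cancel)
  show "integrable lebesgue (\<lambda>s. norm (decay c (t - s) * h s))"
    using L2_integrable_mult[OF decay_L2(1)[OF c] h] by (simp add: norm_mult)
  show "(\<lambda>s. decay c (t - s) * h s) \<in> borel_measurable lebesgue"
    using L2_measurable[OF decay_L2(1)[OF c]] L2_measurable[OF h] by measurable
qed

lemma norm_decay_conv_le:
  assumes c: "Re c > 0" and h: "h \<in> L2"
  shows "norm (decay_conv c h t) \<le> L2_norm h / sqrt (2 * Re c)"
proof -
  have "norm (decay_conv c h t) \<le> (LINT s|lebesgue. norm (decay c (t - s) * h s))"
    unfolding decay_conv_def by (rule integral_norm_bound)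
  also have "\<dots> \<le> L2_norm (\<lambda>s. decay c (t - s)) * L2_norm h"
    using L2_integral_mult_le[OF decay_L2(1)[OF c] h] by (simp add: norm_mult)
  finally show ?thesis by (simp add: decay_L2(2)[OF c])
qed

lemma decay_conv_add:
  assumes "Re c > 0" "f \<in> L2" "g \<in> L2"
  shows "decay_conv c (\<lambda>s. f s + g s) t = decay_conv c f t + decay_conv c g t"
  using decay_conv_integrable[OF assms(1,2), of t] decay_conv_integrable[OF assms(1,3), of t]
  by (simp add: decay_conv_def distrib_left)

lemma decay_conv_diff:
  assumes "Re c > 0" "f \<in> L2" "g \<in> L2"
  shows "decay_conv c (\<lambda>s. f s - g s) t = decay_conv c f t - decay_conv c g t"
  using decay_conv_integrable[OF assms(1,2), of t] decay_conv_integrable[OF assms(1,3), of t]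
  by (simp add: decay_conv_def right_diff_distrib)

lemma decay_conv_scale: "decay_conv c (\<lambda>s. k * h s) t = k * decay_conv c h t"
  by (simp add: decay_conv_def mult.left_commute)

lemma indicator_mult_L2:
  fixes h g :: "real \<Rightarrow> complex"
  assumes h: "h \<in> L2" and g: "continuous_on UNIV g"
  shows "(\<lambda>t. indicator {a..b} t *\<^sub>R (g t * h t)) \<in> L2"
proof -
  have "bounded (g ` {a..b})"
    using g by (intro compact_imp_bounded compact_continuous_image) (auto intro: continuous_on_subset)
  then obtain B where B: "B > 0" "\<forall>t\<in>{a..b}. norm (g t) \<le> B"
    unfolding bounded_pos by blast
  have "(\<lambda>t. of_real (indicator {a..b} t) * g t) \<in> borel_measurable lborel"
    using borel_measurable_continuous_onI[OF g] by measurable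
  then have m: "(\<lambda>t. of_real (indicator {a..b} t) * g t) \<in> borel_measurable lebesgue"
    by (rule measurable_completion)
  have "norm (of_real (indicator {a..b} t) * g t) \<le> B" for t
    using B by (auto simp: indicator_def)
  from L2_bounded_mult(1)[OF h m this] show ?thesis
    by (simp add: scaleR_conv_of_real mult.assoc)
qed

lemma exp_has_vector_derivative:
  fixes c :: complex
  shows "((\<lambda>t. exp (c * of_real t)) has_vector_derivative c * exp (c * of_real t)) (at t within S)"
proof -
  have "((\<lambda>z. exp (c * z)) has_field_derivative c * exp (c * of_real t)) (at (of_real t))"
    by (auto intro!: derivative_eq_intros)
  from has_vector_derivative_real_field[OF this] show ?thesis
    by (simp add: has_vector_derivative_at_within o_def)
qed

lemma indicator_interval_L2: "(\<lambda>t. complex_of_real (indicator {a..b::real} t)) \<in> L2"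
proof -
  have sq: "(norm (complex_of_real (indicator {a..b::real} t)))\<^sup>2 = indicator {a..b} t" for t
    by (simp add: indicator_def)
  have "(\<lambda>t. complex_of_real (indicator {a..b::real} t)) \<in> borel_measurable lborel" by measurable
  then show ?thesis
    unfolding L2_def mem_Collect_eq sq
    by (auto simp: measurable_completion emeasure_lborel_Icc_eq intro!: integrable_real_indicator)
qed

lemma absolutely_continuous_on_exp:
  "absolutely_continuous_on {a..b} (\<lambda>t. exp (c * complex_of_real t))"
proof (rule absolutely_continuous_on_primitive)
  have "(\<lambda>t. indicator {a..b} t *\<^sub>R (c * exp (c * complex_of_real t) * complex_of_real (indicator {a..b} t))) \<in> L2"
    by (rule indicator_mult_L2[OF indicator_interval_L2]) (intro continuous_intros)
  moreover have "indicator {a..b} t *\<^sub>R (c * exp (c * complex_of_real t) * complex_of_real (indicator {a..b} t))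
      = indicator {a..b} t *\<^sub>R (c * exp (c * complex_of_real t))" for t
    by (auto simp: indicator_def)
  ultimately show "(\<lambda>t. indicator {a..b} t *\<^sub>R (c * exp (c * complex_of_real t))) \<in> L2" by simp
next
  fix u v :: real assume "u \<le> v"
  then show "((\<lambda>t. c * exp (c * complex_of_real t)) has_integral
      exp (c * complex_of_real v) - exp (c * complex_of_real u)) {u..v}"
    by (intro fundamental_theorem_of_calculus exp_has_vector_derivative)
qed

text \<open>
  Up to the smooth factor \<open>exp (- c t)\<close> the convolution is a primitive of \<open>exp (c s) * h s\<close>.
\<close>

lemma decay_conv_absolutely_continuous_and_derivative:
  assumes c: "Re c > 0" and h: "h \<in> L2"
  shows absolutely_continuous_on_decay_conv: "absolutely_continuous_on {a..b} (decay_conv c h)"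
    and decay_conv_has_vector_derivative:
      "AE t in lebesgue. (decay_conv c h has_vector_derivative h t - c * decay_conv c h t) (at t)"
proof -
  let ?g = "\<lambda>s. exp (c * complex_of_real s) * h s"
  define E where "E t = (LINT s|lebesgue. indicator {..t} s *\<^sub>R ?g s)" for t
  have eq: "indicator {..t} s *\<^sub>R ?g s = exp (c * of_real t) * (decay c (t - s) * h s)" for s t
    by (auto simp: decay_def indicator_def algebra_simps exp_add[symmetric])
  have int: "integrable lebesgue (\<lambda>s. indicator {..t} s *\<^sub>R ?g s)" for t
    unfolding eq using decay_conv_integrable[OF c h] by (intro integrable_mult_right)
  have RE: "decay_conv c h t = exp (- c * of_real t) * E t" for t
    unfolding E_def eq by (simp add: decay_conv_def exp_minus)
  have prim: "(?g has_integral E v - E u) {u..v}" if "u \<le> v" for u v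
  proof -
    have "indicator {u<..v} s *\<^sub>R ?g s = indicator {..v} s *\<^sub>R ?g s - indicator {..u} s *\<^sub>R ?g s" for s
      using that by (auto simp: indicator_def)
    then have *: "set_integrable lebesgue {u<..v} ?g" "set_lebesgue_integral lebesgue {u<..v} ?g = E v - E u"
      using int[of u] int[of v] by (simp_all add: set_integrable_def set_lebesgue_integral_def E_def)
    have "(?g has_integral E v - E u) {u<..v}"
      using has_integral_set_lebesgue[OF *(1)] *(2) by simp
    moreover have "negligible {x \<in> {u..v} - {u<..v}. ?g x \<noteq> 0}" "negligible {x \<in> {u<..v} - {u..v}. ?g x \<noteq> 0}"
      by (rule negligible_subset[of "{u}"]; auto)+
    ultimately show ?thesis
      by (simp add: has_integral_spike_set_eq[of "{u..v}" "{u<..v}"])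
  qed
  have cont: "continuous_on UNIV (\<lambda>s. exp (c * complex_of_real s))"
    by (intro continuous_intros)
  have AC: "absolutely_continuous_on {a..b} E" for a b
    by (rule absolutely_continuous_on_primitive[OF indicator_mult_L2[OF h cont]]) (rule prim)
  have dE: "AE t in lebesgue. (E has_vector_derivative ?g t) (at t)"
    by (rule primitive_has_vector_derivative_AE[OF prim])
  have R: "decay_conv c h = (\<lambda>t. exp (- c * of_real t) * E t)" using RE by auto
  show "absolutely_continuous_on {a..b} (decay_conv c h)"
    unfolding R by (rule absolutely_continuous_on_mult[OF absolutely_continuous_on_exp AC])
  show "AE t in lebesgue. (decay_conv c h has_vector_derivative h t - c * decay_conv c h t) (at t)"
    using dE
  proof eventually_elim
    case (elim t)
    have eq: "exp (- c * of_real t) * ?g t + (- c * exp (- c * of_real t)) * E t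
        = h t - c * (exp (- c * of_real t) * E t)"
      by (simp add: exp_minus)
    show ?case
      unfolding R eq[symmetric] by (rule has_vector_derivative_mult[OF exp_has_vector_derivative elim])
  qed
qed

lemma continuous_on_of_locally_absolutely_continuous:
  fixes F :: "real \<Rightarrow> 'a::real_normed_vector"
  assumes "\<And>a b. absolutely_continuous_on {a..b} F"
  shows "continuous_on UNIV F"
proof -
  have "isCont F t" for t
    using continuous_on_interior[OF absolutely_continuous_on_imp_continuous_on[OF assms, of "t - 1" "t + 1"], of t]
    by simp
  then show ?thesis by (simp add: continuous_at_imp_continuous_on)
qed

lemma continuous_on_decay_conv: "Re c > 0 \<Longrightarrow> h \<in> L2 \<Longrightarrow> continuous_on UNIV (decay_conv c h)"
  by (rule continuous_on_of_locally_absolutely_continuous) (rule absolutely_continuous_on_decay_conv)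

lemma continuous_imp_lebesgue_measurable:
  fixes F :: "real \<Rightarrow> 'a::topological_space"
  assumes "continuous_on UNIV F"
  shows "F \<in> borel_measurable lebesgue"
  using borel_measurable_continuous_onI[OF assms] by (intro measurable_completion) simp

text \<open>
  A bounded solution of \<open>F' + c F = h\<close> is unique: the fundamental theorem of calculus is applied to
  \<open>exp (c s) * F s\<close> on \<open>{a..t}\<close>, and the boundary term at \<open>a\<close> vanishes as \<open>a\<close> tends to minus
  infinity. The integrability assumption is about the kernel times \<open>h\<close>, so that the result also
  applies to functions \<open>h\<close> that are merely integrable.
\<close>

lemma decay_conv_unique:
  assumes c: "Re c > 0"
    and AC: "\<And>a b. absolutely_continuous_on {a..b} F"
    and deriv: "AE t in lebesgue. (F has_vector_derivative h t - c * F t) (at t)"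
    and bdd: "\<And>t. norm (F t) \<le> B"
    and int: "integrable lebesgue (\<lambda>s. decay c (t - s) * h s)"
  shows "F t = decay_conv c h t"
proof -
  let ?e = "\<lambda>s. exp (- c * complex_of_real t) * exp (c * complex_of_real s)"
  let ?g = "\<lambda>s. ?e s * h s"
  have AC': "absolutely_continuous_on {a..b} (\<lambda>s. ?e s * F s)" for a b
  proof -
    have "absolutely_continuous_on {a..b} (\<lambda>s. exp (- c * complex_of_real t))"
      using absolutely_continuous_on_exp[of a b 0]
      by (auto simp: absolutely_continuous_on_def)
    then show ?thesis
      using AC absolutely_continuous_on_exp by (intro absolutely_continuous_on_mult)
  qed
  have dF: "AE s in lebesgue. ((\<lambda>s. ?e s * F s) has_vector_derivative ?g s) (at s)"
    using deriv
  proof eventually_elim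
    case (elim s)
    have "(?e has_vector_derivative c * ?e s) (at s)"
      using has_vector_derivative_mult_right[OF exp_has_vector_derivative[of c s UNIV], of "exp (- c * complex_of_real t)"]
      by (simp add: algebra_simps)
    from has_vector_derivative_mult[OF this elim] show ?case
      by (simp add: algebra_simps)
  qed
  have eq: "indicator {..t} s *\<^sub>R ?g s = decay c (t - s) * h s" for s
    by (auto simp: decay_def indicator_def algebra_simps exp_add[symmetric])
  have sint: "set_integrable lebesgue {..t} ?g"
    using int unfolding set_integrable_def eq .
  have R: "set_lebesgue_integral lebesgue {..t} ?g = decay_conv c h t"
    unfolding set_lebesgue_integral_def eq decay_conv_def ..
  have lim1: "((\<lambda>a. set_lebesgue_integral lebesgue {a..t} ?g) \<longlongrightarrow> decay_conv c h t) at_bot"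
    using tendsto_set_lebesgue_integral_at_bot[OF _ sint] unfolding R by auto
  have fin: "set_lebesgue_integral lebesgue {a..t} ?g = F t - ?e a * F a" if "a \<le> t" for a
  proof -
    have "set_integrable lebesgue {a..t} ?g"
      by (rule set_integrable_subset[OF sint]) auto
    then have "set_lebesgue_integral lebesgue {a..t} ?g = integral {a..t} ?g"
      by (rule set_lebesgue_integral_eq_integral(2))
    also have "\<dots> = ?e t * F t - ?e a * F a"
      by (rule integral_unique[OF has_integral_of_absolutely_continuous[OF that AC' dF]])
    also have "?e t = 1" by (simp add: exp_add[symmetric])
    finally show ?thesis by simp
  qed
  have "((\<lambda>a. exp (Re c * (a - t)) * B) \<longlongrightarrow> 0 * B) at_bot"
  proof (intro tendsto_mult tendsto_const)
    have "filterlim (\<lambda>a. Re c * (a - t)) at_bot at_bot"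
      using c by real_asymp
    then show "((\<lambda>a. exp (Re c * (a - t))) \<longlongrightarrow> 0) at_bot"
      by (rule filterlim_compose[OF exp_at_bot])
  qed
  then have lim0: "((\<lambda>a. exp (Re c * (a - t)) * B) \<longlongrightarrow> 0) at_bot"
    by simp
  have "((\<lambda>a. ?e a * F a) \<longlongrightarrow> 0) at_bot"
  proof (rule Lim_null_comparison[OF _ lim0])
    show "\<forall>\<^sub>F a in at_bot. norm (?e a * F a) \<le> exp (Re c * (a - t)) * B"
      using bdd by (intro always_eventually allI)
        (auto simp: norm_mult exp_add[symmetric] algebra_simps)
  qed
  then have "((\<lambda>a. F t - ?e a * F a) \<longlongrightarrow> F t - 0) at_bot"
    by (intro tendsto_diff tendsto_const)
  moreover have "\<forall>\<^sub>F a in at_bot. set_lebesgue_integral lebesgue {a..t} ?g = F t - ?e a * F a"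
    using eventually_le_at_bot[of t] by eventually_elim (rule fin)
  ultimately have "((\<lambda>a. set_lebesgue_integral lebesgue {a..t} ?g) \<longlongrightarrow> F t) at_bot"
    by (simp add: tendsto_cong)
  from tendsto_unique[OF _ this lim1] show ?thesis by simp
qed

text \<open>
  Young's inequality for the kernel \<open>k\<close>, whose integral in either variable is \<open>1 / Re c\<close>: write
  \<open>k * norm h\<close> as \<open>sqrt k * (sqrt k * norm h)\<close>, apply Cauchy--Schwarz, and exchange the integrals.
\<close>

lemma decay_conv_L2:
  assumes c: "Re c > 0" and h: "h \<in> L2"
  shows "decay_conv c h \<in> L2" and "L2_norm (decay_conv c h) \<le> L2_norm h / Re c"
proof -
  have [measurable]: "h \<in> borel_measurable lebesgue" using h by (rule L2_measurable)
  have cont: "continuous_on UNIV (decay_conv c h)" by (rule continuous_on_decay_conv[OF c h])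
  have [measurable]: "decay_conv c h \<in> borel_measurable lebesgue"
    by (rule continuous_imp_lebesgue_measurable[OF cont])
  define k where "k t s = norm (decay c (t - s))" for t s
  have km [measurable]: "(\<lambda>s. k t s) \<in> borel_measurable lebesgue" "(\<lambda>t. k t s) \<in> borel_measurable lebesgue" for s t
    unfolding k_def by (intro measurable_completion; measurable)+
  have k1: "(\<integral>\<^sup>+s. ennreal (k t s) \<partial>lebesgue) = ennreal (1 / Re c)" for t
  proof -
    have "has_bochner_integral lebesgue (\<lambda>s. k t s) (1 / Re c)"
      using has_bochner_integral_exp_left[OF c, of t] unfolding k_def norm_decay .
    then show ?thesis by (simp add: has_bochner_integral_iff nn_integral_eq_integral k_def)
  qed
  have k2: "(\<integral>\<^sup>+t. ennreal (k t s) \<partial>lebesgue) = ennreal (1 / Re c)" for s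
  proof -
    have "(\<integral>\<^sup>+t. ennreal (k t s) \<partial>lebesgue) = (\<integral>\<^sup>+t. ennreal (k (- t) s) \<partial>lebesgue)"
      using nn_integral_real_affine_lebesgue[of "\<lambda>t. ennreal (k t s)" "-1" 0] by simp
    also have "\<dots> = (\<integral>\<^sup>+t. ennreal (k (- s) t) \<partial>lebesgue)"
      by (intro nn_integral_cong) (simp add: k_def minus_diff_commute)
    finally show ?thesis using k1 by simp
  qed
  have ptw: "ennreal ((norm (decay_conv c h t))\<^sup>2) \<le>
      ennreal (1 / Re c) * (\<integral>\<^sup>+s. ennreal (k t s) * ennreal ((norm (h s))\<^sup>2) \<partial>lebesgue)" for t
  proof -
    have "ennreal (norm (decay_conv c h t)) \<le> (\<integral>\<^sup>+s. ennreal (norm (decay c (t - s) * h s)) \<partial>lebesgue)"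
      unfolding decay_conv_def
      by (rule integral_norm_bound_ennreal[OF decay_conv_integrable[OF c h]])
    also have "\<dots> = (\<integral>\<^sup>+s. ennreal (sqrt (k t s)) * ennreal (sqrt (k t s) * norm (h s)) \<partial>lebesgue)"
      by (intro nn_integral_cong) (simp add: k_def norm_mult ennreal_mult[symmetric] mult.assoc[symmetric])
    finally have "ennreal (norm (decay_conv c h t)) ^ 2 \<le> (\<integral>\<^sup>+s. ennreal (sqrt (k t s)) * ennreal (sqrt (k t s) * norm (h s)) \<partial>lebesgue) ^ 2"
      by (rule power_mono) simp
    also have "\<dots> \<le> (\<integral>\<^sup>+s. ennreal (sqrt (k t s)) ^ 2 \<partial>lebesgue) * (\<integral>\<^sup>+s. ennreal (sqrt (k t s) * norm (h s)) ^ 2 \<partial>lebesgue)"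
      by (rule Cauchy_Schwarz_nn_integral) measurable
    also have "(\<integral>\<^sup>+s. ennreal (sqrt (k t s)) ^ 2 \<partial>lebesgue) = ennreal (1 / Re c)"
      using k1[of t] by (simp add: ennreal_power k_def)
    also have "(\<integral>\<^sup>+s. ennreal (sqrt (k t s) * norm (h s)) ^ 2 \<partial>lebesgue) = (\<integral>\<^sup>+s. ennreal (k t s) * ennreal ((norm (h s))\<^sup>2) \<partial>lebesgue)"
      by (intro nn_integral_cong) (simp add: ennreal_power power_mult_distrib k_def ennreal_mult)
    finally show ?thesis by (simp add: ennreal_power)
  qed
  have pm: "(\<lambda>(t, s). ennreal (k t s) * ennreal ((norm (h s))\<^sup>2)) \<in> borel_measurable (lebesgue \<Otimes>\<^sub>M lebesgue)"
  proof -
    have [measurable]: "(\<lambda>x. x) \<in> borel_measurable (lebesgue :: real measure)"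
      by (intro measurable_completion) simp
    have [measurable]: "fst \<in> borel_measurable (lebesgue \<Otimes>\<^sub>M lebesgue :: (real \<times> real) measure)"
      "snd \<in> borel_measurable (lebesgue \<Otimes>\<^sub>M lebesgue :: (real \<times> real) measure)"
      using measurable_compose[OF measurable_fst, of "\<lambda>x. x" lebesgue borel lebesgue]
        measurable_compose[OF measurable_snd, of "\<lambda>x. x" lebesgue borel lebesgue] by simp_all
    show ?thesis unfolding k_def case_prod_beta by measurable
  qed
  interpret pair_sigma_finite "lebesgue :: real measure" "lebesgue :: real measure" ..
  have "(\<integral>\<^sup>+t. ennreal ((norm (decay_conv c h t))\<^sup>2) \<partial>lebesgue) \<le>
      (\<integral>\<^sup>+t. ennreal (1 / Re c) * (\<integral>\<^sup>+s. ennreal (k t s) * ennreal ((norm (h s))\<^sup>2) \<partial>lebesgue) \<partial>lebesgue)"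
    by (intro nn_integral_mono ptw)
  also have "\<dots> = ennreal (1 / Re c) * (\<integral>\<^sup>+t. (\<integral>\<^sup>+s. ennreal (k t s) * ennreal ((norm (h s))\<^sup>2) \<partial>lebesgue) \<partial>lebesgue)"
    using lebesgue.borel_measurable_nn_integral[OF pm] by (intro nn_integral_cmult) simp
  also have "(\<integral>\<^sup>+t. (\<integral>\<^sup>+s. ennreal (k t s) * ennreal ((norm (h s))\<^sup>2) \<partial>lebesgue) \<partial>lebesgue)
      = (\<integral>\<^sup>+s. (\<integral>\<^sup>+t. ennreal (k t s) * ennreal ((norm (h s))\<^sup>2) \<partial>lebesgue) \<partial>lebesgue)"
    using Fubini[OF pm] by simp
  also have "\<dots> = (\<integral>\<^sup>+s. ennreal (1 / Re c) * ennreal ((norm (h s))\<^sup>2) \<partial>lebesgue)"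
    by (intro nn_integral_cong) (simp add: nn_integral_multc k2)
  also have "\<dots> = ennreal (1 / Re c) * ennreal ((L2_norm h)\<^sup>2)"
    using L2_integrable_square[OF h] by (simp add: nn_integral_cmult nn_integral_eq_integral L2_norm_square)
  finally have le: "(\<integral>\<^sup>+t. ennreal ((norm (decay_conv c h t))\<^sup>2) \<partial>lebesgue) \<le> ennreal ((L2_norm h / Re c)\<^sup>2)"
    using c by (simp add: ennreal_mult[symmetric] power_divide power2_eq_square)
  then have "integrable lebesgue (\<lambda>t. (norm (decay_conv c h t))\<^sup>2)"
    by (intro integrableI_bounded) (auto simp: le_less_trans)
  then show 1: "decay_conv c h \<in> L2" by (simp add: L2_def)
  have "(L2_norm (decay_conv c h))\<^sup>2 \<le> (L2_norm h / Re c)\<^sup>2"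
    using le L2_integrable_square[OF 1]
    by (simp add: nn_integral_eq_integral L2_norm_square[symmetric])
  then show "L2_norm (decay_conv c h) \<le> L2_norm h / Re c"
    by (rule power2_le_imp_le) (use c in \<open>simp add: L2_norm_nonneg\<close>)
qed

section \<open>Fourier transforms of square-integrable functions\<close>

lemma id_lebesgue_measurable: "(\<lambda>x. x) \<in> borel_measurable (lebesgue :: real measure)"
  by (intro measurable_completion) simp

lemma snd_lebesgue_measurable [measurable]:
  "snd \<in> borel_measurable (N \<Otimes>\<^sub>M (lebesgue :: real measure))"
  by (rule measurable_compose[OF measurable_snd id_lebesgue_measurable])

lemma fst_lebesgue_measurable [measurable]:
  "fst \<in> borel_measurable ((lebesgue :: real measure) \<Otimes>\<^sub>M N)"
  by (rule measurable_compose[OF measurable_fst id_lebesgue_measurable])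

lemma borel_measurable_cis [measurable]: "cis \<in> borel_measurable borel"
  by (rule borel_measurable_continuous_onI) (intro continuous_intros)

lemma gaussian_fourier:
  fixes \<sigma> y :: real
  assumes "\<sigma> > 0"
  shows "has_bochner_integral lborel (\<lambda>a. complex_of_real (exp (- (a / \<sigma>)\<^sup>2 / 2)) * cis (a * y))
    (complex_of_real (\<sigma> * sqrt (2 * pi) * exp (- (\<sigma> * y)\<^sup>2 / 2)))"
proof -
  let ?f = "\<lambda>x. complex_of_real (std_normal_density x) * cis (x * (\<sigma> * y))"
  have "integrable lborel (\<lambda>x. norm (?f x))"
    using integrable_normal_density[of 1 0] by (simp add: norm_mult)
  then have int: "integrable lborel ?f"
    by (rule integrable_norm_cancel) measurable
  have "char std_normal_distribution (\<sigma> * y) = (LINT x|lborel. ?f x)"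
    unfolding char_def
    by (subst integral_density) (auto simp: scaleR_conv_of_real cis_conv_exp mult_ac)
  then have "has_bochner_integral lborel ?f (complex_of_real (exp (- (\<sigma> * y)\<^sup>2 / 2)))"
    using int by (simp add: has_bochner_integral_iff char_std_normal_distribution)
  from has_bochner_integral_mult_right[OF this, of "complex_of_real (sqrt (2 * pi))"]
  have "has_bochner_integral lborel (\<lambda>x. complex_of_real (exp (- x\<^sup>2 / 2)) * cis (x * (\<sigma> * y)))
      (complex_of_real (sqrt (2 * pi)) * complex_of_real (exp (- (\<sigma> * y)\<^sup>2 / 2)))"
    by (simp add: std_normal_density_def)
  then show ?thesis
    using assms lborel_has_bochner_integral_real_affine_iff[of \<sigma> "(\<lambda>a. complex_of_real (exp (- (a / \<sigma>)\<^sup>2 / 2)) * cis (a * y))"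
      "complex_of_real (\<sigma> * sqrt (2 * pi) * exp (- (\<sigma> * y)\<^sup>2 / 2))" 0]
    by (simp add: mult_ac scaleR_conv_of_real divide_simps)
qed

lemma nn_integral_gaussian:
  fixes \<sigma> t :: real
  assumes "\<sigma> > 0"
  shows "(\<integral>\<^sup>+s. ennreal (\<sigma> * sqrt (2 * pi) * exp (- (\<sigma> * (t - s))\<^sup>2 / 2)) \<partial>lborel) = ennreal (2 * pi)"
proof -
  have "\<sigma> * sqrt (2 * pi) * exp (- (\<sigma> * (t - s))\<^sup>2 / 2) = 2 * pi * normal_density t (1 / \<sigma>) s" for s
  proof -
    have "sqrt (2 * pi * (1 / \<sigma>)\<^sup>2) = sqrt (2 * pi) / \<sigma>"
      using assms by (simp add: real_sqrt_divide power_divide)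
    moreover have "- (s - t)\<^sup>2 / (2 * (1 / \<sigma>)\<^sup>2) = - (\<sigma> * (t - s))\<^sup>2 / 2"
      using assms by (simp add: power_mult_distrib power_divide power2_commute[of s t])
    ultimately have "2 * pi * normal_density t (1 / \<sigma>) s = 2 * pi / (sqrt (2 * pi) / \<sigma>) * exp (- (\<sigma> * (t - s))\<^sup>2 / 2)"
      by (simp add: normal_density_def)
    also have "2 * pi / (sqrt (2 * pi) / \<sigma>) = \<sigma> * (2 * pi / sqrt (2 * pi))"
      by simp
    also have "2 * pi / sqrt (2 * pi) = sqrt (2 * pi)"
      by (rule real_div_sqrt) simp
    finally show ?thesis by simp
  qed
  moreover have "(\<integral>\<^sup>+s. ennreal (normal_density t (1 / \<sigma>) s) \<partial>lborel) = 1"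
    using integrable_normal_density[of "1 / \<sigma>" t] integral_normal_density[of "1 / \<sigma>" t] assms
    by (simp add: nn_integral_eq_integral)
  ultimately show ?thesis
    by (simp add: ennreal_mult nn_integral_cmult)
qed

text \<open>
  The half of Plancherel's theorem that bounds the transform. The transform is integrated against
  the Gaussian \<open>\<rho>\<close> of width \<open>\<sigma>\<close>; exchanging integrals turns this into a quadratic form in \<open>h\<close> whose
  kernel \<open>K (s - s')\<close> is the nonnegative transform of \<open>\<rho>\<close> and has integral \<open>2 * pi\<close> in each
  variable. Bounding \<open>norm (h s) * norm (h s')\<close> by half the sum of the squares controls the form
  uniformly in \<open>\<sigma>\<close>, and Fatou's lemma removes the Gaussian.
\<close>

lemma plancherel_inequality:
  fixes h :: "real \<Rightarrow> complex"
  assumes h: "h \<in> L2" and int: "integrable lebesgue h"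
  shows "(\<integral>\<^sup>+a. ennreal ((norm (LINT s|lebesgue. cis (a * s) * h s))\<^sup>2) \<partial>lborel) \<le> ennreal (2 * pi * (L2_norm h)\<^sup>2)"
proof -
  have [measurable]: "h \<in> borel_measurable lebesgue" using h by (rule L2_measurable)
  define F where "F a = (LINT s|lebesgue. cis (a * s) * h s)" for a
  have meas [measurable]: "F \<in> borel_measurable lborel"
    unfolding F_def by measurable
  define B where "B = (LINT s|lebesgue. norm (h s))"
  have FB: "norm (F a) \<le> B" for a
    using integral_norm_bound[of lebesgue "\<lambda>s. cis (a * s) * h s"] by (simp add: F_def B_def norm_mult)
  interpret P: pair_sigma_finite lborel "lebesgue :: real measure" ..
  interpret Q: pair_sigma_finite "lebesgue :: real measure" "lebesgue :: real measure" ..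
  have key: "(\<integral>\<^sup>+a. ennreal (exp (- (a / \<sigma>)\<^sup>2 / 2) * (norm (F a))\<^sup>2) \<partial>lborel) \<le> ennreal (2 * pi * (L2_norm h)\<^sup>2)"
    if \<sigma>: "\<sigma> > 0" for \<sigma>
  proof -
    define \<rho> where "\<rho> a = exp (- (a / \<sigma>)\<^sup>2 / 2)" for a :: real
    define K where "K x = \<sigma> * sqrt (2 * pi) * exp (- (\<sigma> * x)\<^sup>2 / 2)" for x
    have [measurable]: "\<rho> \<in> borel_measurable borel" "K \<in> borel_measurable borel"
      unfolding \<rho>_def K_def by measurable
    have \<rho>0: "\<rho> a > 0" "norm (complex_of_real (\<rho> a)) = \<rho> a" for a by (simp_all add: \<rho>_def)
    have K0: "K x \<ge> 0" for x using \<sigma> by (simp add: K_def)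
    have gf: "has_bochner_integral lborel (\<lambda>a. complex_of_real (\<rho> a) * cis (a * y)) (complex_of_real (K y))" for y
      using gaussian_fourier[OF \<sigma>] unfolding \<rho>_def K_def .
    have \<rho>int: "integrable lborel \<rho>"
      using gf[of 0] by (simp add: has_bochner_integral_iff complex_of_real_integrable_eq)
    \<comment> \<open>This justifies both exchanges of complex-valued integrals below.\<close>
    have prod: "integrable (lborel \<Otimes>\<^sub>M lebesgue) (\<lambda>(a, s). complex_of_real (\<rho> a) * (w a * (cis (a * z s) * g s)))"
      if w: "w \<in> borel_measurable lborel" "\<And>a. norm (w a) \<le> W"
        and z: "z \<in> borel_measurable lebesgue" and g: "integrable lebesgue g"
      for w :: "real \<Rightarrow> complex" and W and z :: "real \<Rightarrow> real" and g :: "real \<Rightarrow> complex"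
    proof (rule P.Fubini_integrable)
      have [measurable]: "g \<in> borel_measurable lebesgue" "w \<in> borel_measurable lborel" "z \<in> borel_measurable lebesgue"
        using g w z by auto
      show "(\<lambda>(a, s). complex_of_real (\<rho> a) * (w a * (cis (a * z s) * g s))) \<in> borel_measurable (lborel \<Otimes>\<^sub>M lebesgue)"
        by measurable
      have wm [measurable]: "w \<in> borel_measurable borel" using w(1) by simp
      have n: "norm (complex_of_real (\<rho> a) * (w a * (cis (a * z s) * g s))) = \<rho> a * norm (w a) * norm (g s)" for a s
        using \<rho>0[of a] by (simp add: norm_mult mult.assoc)
      have "integrable lborel (\<lambda>a. \<rho> a * norm (w a) * (LINT s|lebesgue. norm (g s)))"
      proof (rule integrable_mult_left, rule Bochner_Integration.integrable_bound)
        show "integrable lborel (\<lambda>a. \<rho> a * W)" using \<rho>int by simp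
        show "AE a in lborel. norm (\<rho> a * norm (w a)) \<le> norm (\<rho> a * W)"
        proof (rule AE_I2)
          fix a
          have "0 \<le> W" using w(2)[of a] norm_ge_zero order_trans by blast
          then show "norm (\<rho> a * norm (w a)) \<le> norm (\<rho> a * W)"
            using \<rho>0(1)[of a] w(2)[of a] by (simp add: abs_mult)
        qed
        show "(\<lambda>a. \<rho> a * norm (w a)) \<in> borel_measurable lborel" by measurable
      qed
      then show "integrable lborel (\<lambda>a. LINT s|lebesgue. norm (case (a, s) of (a, s) \<Rightarrow> complex_of_real (\<rho> a) * (w a * (cis (a * z s) * g s))))"
        by (simp add: n)
      show "AE a in lborel. integrable lebesgue (\<lambda>s. case (a, s) of (a, s) \<Rightarrow> complex_of_real (\<rho> a) * (w a * (cis (a * z s) * g s)))"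
      proof (rule AE_I2)
        fix a
        have "integrable lebesgue (\<lambda>s. cis (a * z s) * g s)"
          by (rule Bochner_Integration.integrable_bound[OF g]) (auto simp: norm_mult)
        then show "integrable lebesgue (\<lambda>s. case (a, s) of (a, s) \<Rightarrow> complex_of_real (\<rho> a) * (w a * (cis (a * z s) * g s)))"
          by simp
      qed
    qed
    have cint: "integrable lebesgue (\<lambda>s. cnj (h s))" using int by simp
    have cF: "cnj (F a) = (LINT s|lebesgue. cis (a * (- s)) * cnj (h s))" for a
      unfolding F_def by (subst Bochner_Integration.integral_cnj[symmetric]) (simp add: cis_cnj)
    define M where "M s = (LINT s'|lebesgue. complex_of_real (K (s - s')) * cnj (h s'))" for s
    have M: "(LINT a|lborel. complex_of_real (\<rho> a) * (cnj (F a) * cis (a * s))) = M s" for s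
    proof -
      have "(LINT a|lborel. complex_of_real (\<rho> a) * (cnj (F a) * cis (a * s))) =
          (LINT a|lborel. LINT s'|lebesgue. complex_of_real (\<rho> a) * (cis (a * s) * (cis (a * (- s')) * cnj (h s'))))"
      proof (rule Bochner_Integration.integral_cong[OF refl])
        fix a
        show "complex_of_real (\<rho> a) * (cnj (F a) * cis (a * s)) =
            (LINT s'|lebesgue. complex_of_real (\<rho> a) * (cis (a * s) * (cis (a * (- s')) * cnj (h s'))))"
          by (subst mult.commute[of "cnj (F a)"]) (simp add: cF)
      qed
      also have "\<dots> = (LINT s'|lebesgue. LINT a|lborel. complex_of_real (\<rho> a) * (cis (a * s) * (cis (a * (- s')) * cnj (h s'))))"
      proof (rule P.Fubini_integral[symmetric], rule prod[of "\<lambda>a. cis (a * s)" 1 "\<lambda>s'. - s'" "\<lambda>s'. cnj (h s')"])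
        show "(\<lambda>s'. - s') \<in> borel_measurable (lebesgue :: real measure)"
          by (rule borel_measurable_uminus[OF id_lebesgue_measurable])
      qed (simp_all add: int)
      also have "\<dots> = (LINT s'|lebesgue. (LINT a|lborel. complex_of_real (\<rho> a) * cis (a * (s - s'))) * cnj (h s'))"
      proof (rule Bochner_Integration.integral_cong[OF refl])
        fix s'
        have "complex_of_real (\<rho> a) * (cis (a * s) * (cis (a * (- s')) * cnj (h s'))) =
            complex_of_real (\<rho> a) * cis (a * (s - s')) * cnj (h s')" for a
          by (simp only: mult.assoc[symmetric] mult.assoc[of "complex_of_real (\<rho> a)" "cis (a * s)"] cis_mult)
            (simp add: right_diff_distrib)
        then show "(LINT a|lborel. complex_of_real (\<rho> a) * (cis (a * s) * (cis (a * (- s')) * cnj (h s')))) =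
            (LINT a|lborel. complex_of_real (\<rho> a) * cis (a * (s - s'))) * cnj (h s')"
          by (simp only: integral_mult_left_zero)
      qed
      also have "\<dots> = M s"
        unfolding M_def using gf by (simp add: has_bochner_integral_iff)
      finally show ?thesis .
    qed
    have "complex_of_real (LINT a|lborel. \<rho> a * (norm (F a))\<^sup>2) = (LINT a|lborel. complex_of_real (\<rho> a * (norm (F a))\<^sup>2))"
      by (rule Bochner_Integration.integral_complex_of_real[symmetric])
    also have "\<dots> = (LINT a|lborel. LINT s|lebesgue. complex_of_real (\<rho> a) * (cnj (F a) * (cis (a * s) * h s)))"
    proof (rule Bochner_Integration.integral_cong[OF refl])
      fix a
      have "complex_of_real (\<rho> a * (norm (F a))\<^sup>2) = complex_of_real (\<rho> a) * (cnj (F a) * F a)"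
        by (simp only: of_real_mult complex_norm_square mult.commute)
      then show "complex_of_real (\<rho> a * (norm (F a))\<^sup>2) = (LINT s|lebesgue. complex_of_real (\<rho> a) * (cnj (F a) * (cis (a * s) * h s)))"
        by (simp add: F_def)
    qed
    also have "\<dots> = (LINT s|lebesgue. LINT a|lborel. complex_of_real (\<rho> a) * (cnj (F a) * (cis (a * s) * h s)))"
    proof (rule P.Fubini_integral[symmetric], rule prod[of "\<lambda>a. cnj (F a)" B "\<lambda>s. s" h])
      show "(\<lambda>a. cnj (F a)) \<in> borel_measurable lborel"
        by (intro measurable_compose[OF meas] borel_measurable_continuous_onI continuous_intros)
    qed (simp_all add: int FB id_lebesgue_measurable)
    also have "\<dots> = (LINT s|lebesgue. M s * h s)"
      by (simp add: mult.assoc[symmetric] M[symmetric])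
    finally have eq: "complex_of_real (LINT a|lborel. \<rho> a * (norm (F a))\<^sup>2) = (LINT s|lebesgue. M s * h s)" .
    have [measurable]: "(\<lambda>s'. K (s - s')) \<in> borel_measurable lebesgue" "(\<lambda>s'. K (s' - s)) \<in> borel_measurable lebesgue" for s
      by (intro measurable_completion; measurable)+
    have K1: "(\<integral>\<^sup>+s'. ennreal (K (s - s')) \<partial>lebesgue) = ennreal (2 * pi)"
         and K2: "(\<integral>\<^sup>+s'. ennreal (K (s' - s)) \<partial>lebesgue) = ennreal (2 * pi)" for s
      using nn_integral_gaussian[OF \<sigma>, of s]
      by (simp_all add: nn_integral_completion K_def power_mult_distrib power2_commute[of s])
    have Mle: "ennreal (norm (M s)) \<le> (\<integral>\<^sup>+s'. ennreal (K (s - s')) * ennreal (norm (h s')) \<partial>lebesgue)" for s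
    proof (cases "integrable lebesgue (\<lambda>s'. complex_of_real (K (s - s')) * cnj (h s'))")
      case True
      from integral_norm_bound_ennreal[OF this] show ?thesis
        using K0 by (simp add: M_def norm_mult ennreal_mult)
    next
      case False
      then show ?thesis by (simp add: M_def not_integrable_integral_eq)
    qed
    have "ennreal (norm (LINT s|lebesgue. M s * h s)) \<le> (\<integral>\<^sup>+s. ennreal (norm (M s * h s)) \<partial>lebesgue)"
    proof (cases "integrable lebesgue (\<lambda>s. M s * h s)")
      case True
      then show ?thesis by (rule integral_norm_bound_ennreal)
    next
      case False
      then show ?thesis by (simp add: not_integrable_integral_eq)
    qed
    also have "\<dots> \<le> (\<integral>\<^sup>+s. (\<integral>\<^sup>+s'. ennreal (K (s - s')) * ennreal (norm (h s')) \<partial>lebesgue) * ennreal (norm (h s)) \<partial>lebesgue)"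
      by (intro nn_integral_mono) (simp add: norm_mult ennreal_mult mult_right_mono Mle)
    also have "\<dots> = (\<integral>\<^sup>+s. (\<integral>\<^sup>+s'. ennreal (K (s - s') * norm (h s') * norm (h s)) \<partial>lebesgue) \<partial>lebesgue)"
      by (intro nn_integral_cong) (simp add: nn_integral_multc[symmetric] ennreal_mult K0)
    also have "\<dots> \<le> (\<integral>\<^sup>+s. (\<integral>\<^sup>+s'. ennreal (K (s - s')) * ennreal ((norm (h s'))\<^sup>2 / 2) +
        ennreal (K (s - s')) * ennreal ((norm (h s))\<^sup>2 / 2) \<partial>lebesgue) \<partial>lebesgue)"
    proof (intro nn_integral_mono)
      fix s s'
      have "norm (h s') * norm (h s) \<le> (norm (h s'))\<^sup>2 / 2 + (norm (h s))\<^sup>2 / 2"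
        using sum_squares_bound[of "norm (h s')" "norm (h s)"] by simp
      from mult_left_mono[OF this K0[of "s - s'"]]
      show "ennreal (K (s - s') * norm (h s') * norm (h s)) \<le> ennreal (K (s - s')) * ennreal ((norm (h s'))\<^sup>2 / 2) +
        ennreal (K (s - s')) * ennreal ((norm (h s))\<^sup>2 / 2)"
        by (simp add: ennreal_mult[symmetric] ennreal_plus[symmetric] K0 distrib_left mult.assoc ennreal_leI del: ennreal_plus)
    qed
    also have "\<dots> = (\<integral>\<^sup>+s. (\<integral>\<^sup>+s'. ennreal (K (s - s')) * ennreal ((norm (h s'))\<^sup>2 / 2) \<partial>lebesgue) \<partial>lebesgue) +
        (\<integral>\<^sup>+s. (\<integral>\<^sup>+s'. ennreal (K (s - s')) * ennreal ((norm (h s))\<^sup>2 / 2) \<partial>lebesgue) \<partial>lebesgue)"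
    proof -
      have m: "(\<lambda>(s, s'). ennreal (K (s - s')) * ennreal ((norm (h s'))\<^sup>2 / 2)) \<in> borel_measurable (lebesgue \<Otimes>\<^sub>M lebesgue)"
          "(\<lambda>(s, s'). ennreal (K (s - s')) * ennreal ((norm (h s))\<^sup>2 / 2)) \<in> borel_measurable (lebesgue \<Otimes>\<^sub>M lebesgue)"
        by measurable
      show ?thesis
        by (subst nn_integral_add[symmetric])
          (use m[THEN lebesgue.borel_measurable_nn_integral] in \<open>auto intro!: nn_integral_cong nn_integral_add\<close>)
    qed
    also have "(\<integral>\<^sup>+s. (\<integral>\<^sup>+s'. ennreal (K (s - s')) * ennreal ((norm (h s'))\<^sup>2 / 2) \<partial>lebesgue) \<partial>lebesgue)
        = (\<integral>\<^sup>+s'. (\<integral>\<^sup>+s. ennreal (K (s - s')) * ennreal ((norm (h s'))\<^sup>2 / 2) \<partial>lebesgue) \<partial>lebesgue)"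
    proof -
      have "(\<lambda>(s, s'). ennreal (K (s - s')) * ennreal ((norm (h s'))\<^sup>2 / 2)) \<in> borel_measurable (lebesgue \<Otimes>\<^sub>M lebesgue)"
        by measurable
      from Q.Fubini[OF this] show ?thesis by simp
    qed
    also have "\<dots> = (\<integral>\<^sup>+s'. ennreal (2 * pi) * ennreal ((norm (h s'))\<^sup>2 / 2) \<partial>lebesgue)"
      by (intro nn_integral_cong) (simp add: nn_integral_multc K2)
    also have "(\<integral>\<^sup>+s. (\<integral>\<^sup>+s'. ennreal (K (s - s')) * ennreal ((norm (h s))\<^sup>2 / 2) \<partial>lebesgue) \<partial>lebesgue)
        = (\<integral>\<^sup>+s'. ennreal (2 * pi) * ennreal ((norm (h s'))\<^sup>2 / 2) \<partial>lebesgue)"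
      by (intro nn_integral_cong) (simp add: nn_integral_multc K1)
    also have "(\<integral>\<^sup>+s'. ennreal (2 * pi) * ennreal ((norm (h s'))\<^sup>2 / 2) \<partial>lebesgue) = ennreal (pi * (L2_norm h)\<^sup>2)"
    proof -
      have "(\<integral>\<^sup>+s'. ennreal (2 * pi) * ennreal ((norm (h s'))\<^sup>2 / 2) \<partial>lebesgue) = (\<integral>\<^sup>+s'. ennreal (pi * (norm (h s'))\<^sup>2) \<partial>lebesgue)"
        by (intro nn_integral_cong) (simp add: ennreal_mult[symmetric])
      also have "\<dots> = ennreal (LINT s|lebesgue. pi * (norm (h s))\<^sup>2)"
        using L2_integrable_square[OF h] by (intro nn_integral_eq_integral) auto
      finally show ?thesis by (simp add: L2_norm_square)
    qed
    also have "ennreal (pi * (L2_norm h)\<^sup>2) + ennreal (pi * (L2_norm h)\<^sup>2) = ennreal (2 * pi * (L2_norm h)\<^sup>2)"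
      by (simp add: ennreal_plus[symmetric] del: ennreal_plus)
    finally have le: "norm (LINT s|lebesgue. M s * h s) \<le> 2 * pi * (L2_norm h)\<^sup>2"
      by (subst (asm) ennreal_le_iff) auto
    have intF: "integrable lborel (\<lambda>a. \<rho> a * (norm (F a))\<^sup>2)"
    proof (rule Bochner_Integration.integrable_bound)
      show "integrable lborel (\<lambda>a. \<rho> a * B\<^sup>2)" using \<rho>int by simp
      show "AE a in lborel. norm (\<rho> a * (norm (F a))\<^sup>2) \<le> norm (\<rho> a * B\<^sup>2)"
        using \<rho>0 FB by (intro AE_I2) (simp add: abs_mult power_mono less_imp_le)
      show "(\<lambda>a. \<rho> a * (norm (F a))\<^sup>2) \<in> borel_measurable lborel" by measurable
    qed
    have "(\<integral>\<^sup>+a. ennreal (\<rho> a * (norm (F a))\<^sup>2) \<partial>lborel) = ennreal (LINT a|lborel. \<rho> a * (norm (F a))\<^sup>2)"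
      using intF \<rho>0 by (intro nn_integral_eq_integral) (auto simp: less_imp_le)
    also have "\<dots> \<le> ennreal (2 * pi * (L2_norm h)\<^sup>2)"
    proof (rule ennreal_leI)
      have "(LINT a|lborel. \<rho> a * (norm (F a))\<^sup>2) \<le> norm (LINT s|lebesgue. M s * h s)"
        unfolding eq[symmetric] by simp
      then show "(LINT a|lborel. \<rho> a * (norm (F a))\<^sup>2) \<le> 2 * pi * (L2_norm h)\<^sup>2"
        using le by simp
    qed
    finally show ?thesis unfolding \<rho>_def .
  qed
  have lim: "(\<lambda>n. ennreal (exp (- (a / real (Suc n))\<^sup>2 / 2) * (norm (F a))\<^sup>2)) \<longlonglongrightarrow> ennreal ((norm (F a))\<^sup>2)" for a
  proof (rule tendsto_ennrealI)
    have "(\<lambda>n. exp (- (a / real (Suc n))\<^sup>2 / 2)) \<longlonglongrightarrow> exp (- 0\<^sup>2 / 2)"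
      by (intro tendsto_intros LIMSEQ_Suc lim_const_over_n) simp
    from tendsto_mult[OF this tendsto_const[of "(norm (F a))\<^sup>2"]]
    show "(\<lambda>n. exp (- (a / real (Suc n))\<^sup>2 / 2) * (norm (F a))\<^sup>2) \<longlonglongrightarrow> (norm (F a))\<^sup>2" by simp
  qed
  have "(\<integral>\<^sup>+a. ennreal ((norm (F a))\<^sup>2) \<partial>lborel) =
      (\<integral>\<^sup>+a. liminf (\<lambda>n. ennreal (exp (- (a / real (Suc n))\<^sup>2 / 2) * (norm (F a))\<^sup>2)) \<partial>lborel)"
    using lim_imp_Liminf[OF _ lim] by simp
  also have "\<dots> \<le> liminf (\<lambda>n. \<integral>\<^sup>+a. ennreal (exp (- (a / real (Suc n))\<^sup>2 / 2) * (norm (F a))\<^sup>2) \<partial>lborel)"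
    by (rule nn_integral_liminf) measurable
  also have "\<dots> \<le> ennreal (2 * pi * (L2_norm h)\<^sup>2)"
  proof (rule order_trans[OF Liminf_le_Limsup Limsup_bounded])
    show "\<forall>\<^sub>F n in sequentially. (\<integral>\<^sup>+a. ennreal (exp (- (a / real (Suc n))\<^sup>2 / 2) * (norm (F a))\<^sup>2) \<partial>lborel)
        \<le> ennreal (2 * pi * (L2_norm h)\<^sup>2)"
      by (intro always_eventually allI key) simp
  qed simp
  finally show ?thesis by (simp add: F_def)
qed

section \<open>The spectral profile of a potential\<close>

lemma measurable_decay [measurable (raw)]:
  assumes "f \<in> borel_measurable M" "g \<in> borel_measurable M"
  shows "(\<lambda>x. decay (f x) (g x)) \<in> borel_measurable M"
  using assms unfolding decay_def by measurable

text \<open>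
  The frequency \<open>2 * a\<close> is the one that matters at a spectral parameter with real part \<open>a\<close>: the
  reflection sends a wave of frequency \<open>a\<close> to one of frequency \<open>- a\<close>, and the potential has to supply
  the difference. The real part \<open>2\<close> is an arbitrary smoothing scale.
\<close>

lemma decay_modulated: "decay (Complex 2 (- (2 * a))) r = decay 2 r * cis (2 * a * r)"
proof -
  have "- Complex 2 (- (2 * a)) * of_real r = - 2 * of_real r + \<i> * of_real (2 * a * r)"
    by (simp add: complex_eq_iff)
  then show ?thesis
    by (cases "0 \<le> r") (simp_all only: decay_def if_True if_False exp_add cis_conv_exp mult_zero_left)
qed

lemma norm_decay_modulated: "norm (decay (Complex 2 (- (2 * a))) r) = norm (decay 2 r)"
  by (simp add: decay_modulated norm_mult)

text \<open>
  The square of this is, in frequency space, a Lorentzian average of the squared modulus of the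
  transform of \<open>v\<close> around the frequency \<open>2 * a\<close>. A constant multiple of the profile bounds the
  imaginary parts of the spectrum from above.
\<close>

definition spectral_profile :: "(real \<Rightarrow> complex) \<Rightarrow> real \<Rightarrow> real" where
  "spectral_profile v a = L2_norm (decay_conv (Complex 2 (- (2 * a))) v)"

lemma spectral_profile_nonneg: "0 \<le> spectral_profile v a"
  by (simp add: spectral_profile_def L2_norm_nonneg)

text \<open>
  Dominated convergence, twice: modulation leaves the modulus of the kernel unchanged, so the
  convolution of \<open>norm (v t)\<close> with the unmodulated kernel dominates for every \<open>a\<close>.
\<close>

lemma continuous_on_spectral_profile:
  assumes v: "v \<in> L2"
  shows "continuous_on UNIV (spectral_profile v)"
proof -
  let ?G = "\<lambda>a. decay_conv (Complex 2 (- (2 * a))) v"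
  define w where "w t = complex_of_real (norm (v t))" for t
  have [measurable]: "v \<in> borel_measurable lebesgue" using v by (rule L2_measurable)
  have "w \<in> borel_measurable lebesgue" unfolding w_def by measurable
  then have w: "w \<in> L2" using L2_dominated(1)[OF _ v, of w 1] by (simp add: w_def)
  have kint: "integrable lebesgue (\<lambda>s. decay 2 (t - s) * v s)" for t
    by (rule decay_conv_integrable[OF _ v]) simp
  have ptw: "(\<lambda>n. ?G (a n) t) \<longlonglongrightarrow> ?G l t" if a: "a \<longlonglongrightarrow> l" for a l t
    unfolding decay_conv_def
  proof (rule integral_dominated_convergence[where w = "\<lambda>s. norm (decay 2 (t - s) * v s)"])
    show "integrable lebesgue (\<lambda>s. norm (decay 2 (t - s) * v s))" using kint by simp
    show "(\<lambda>s. decay (Complex 2 (- (2 * l))) (t - s) * v s) \<in> borel_measurable lebesgue"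
      "(\<lambda>s. decay (Complex 2 (- (2 * a n))) (t - s) * v s) \<in> borel_measurable lebesgue" for n
      using decay_conv_integrable[OF _ v, of "Complex 2 (- (2 * l))" t]
        decay_conv_integrable[OF _ v, of "Complex 2 (- (2 * a n))" t] by auto
    show "AE s in lebesgue. (\<lambda>n. decay (Complex 2 (- (2 * a n))) (t - s) * v s) \<longlonglongrightarrow> decay (Complex 2 (- (2 * l))) (t - s) * v s"
    proof (rule AE_I2)
      fix s
      have "(\<lambda>n. cis (2 * a n * (t - s))) \<longlonglongrightarrow> cis (2 * l * (t - s))"
        by (intro tendsto_intros a)
      then show "(\<lambda>n. decay (Complex 2 (- (2 * a n))) (t - s) * v s) \<longlonglongrightarrow> decay (Complex 2 (- (2 * l))) (t - s) * v s"
        unfolding decay_modulated by (intro tendsto_mult tendsto_const)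
    qed
    show "AE s in lebesgue. norm (decay (Complex 2 (- (2 * a n))) (t - s) * v s) \<le> norm (decay 2 (t - s) * v s)" for n
      by (simp add: norm_mult norm_decay_modulated)
  qed
  have bd: "norm (?G a t) \<le> norm (decay_conv 2 w t)" for a t
  proof -
    have "norm (?G a t) \<le> (LINT s|lebesgue. norm (decay (Complex 2 (- (2 * a))) (t - s) * v s))"
      unfolding decay_conv_def by (rule integral_norm_bound)
    also have "\<dots> = (LINT s|lebesgue. norm (decay 2 (t - s)) * norm (v s))"
      by (simp add: norm_mult norm_decay_modulated)
    also have "\<dots> \<le> norm (complex_of_real (LINT s|lebesgue. norm (decay 2 (t - s)) * norm (v s)))"
      by simp
    also have "complex_of_real (LINT s|lebesgue. norm (decay 2 (t - s)) * norm (v s)) = decay_conv 2 w t"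
    proof -
      have d: "decay 2 r = complex_of_real (norm (decay 2 r))" for r
        by (simp add: decay_def exp_of_real[symmetric])
      have "decay 2 (t - s) * w s = complex_of_real (norm (decay 2 (t - s)) * norm (v s))" for s
        by (subst d) (simp add: w_def)
      then show ?thesis
        unfolding decay_conv_def by (simp only: Bochner_Integration.integral_complex_of_real)
    qed
    finally show ?thesis .
  qed
  have W: "decay_conv 2 w \<in> L2" by (rule decay_conv_L2(1)[OF _ w]) simp
  have G: "?G a \<in> L2" for a by (rule decay_conv_L2(1)[OF _ v]) simp
  have "(\<lambda>n. spectral_profile v (a n)) \<longlonglongrightarrow> spectral_profile v l" if a: "a \<longlonglongrightarrow> l" for a l
    unfolding spectral_profile_def L2_norm_def
  proof (intro tendsto_real_sqrt integral_dominated_convergence[where w = "\<lambda>t. (norm (decay_conv 2 w t))\<^sup>2"])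
    show "integrable lebesgue (\<lambda>t. (norm (decay_conv 2 w t))\<^sup>2)" by (rule L2_integrable_square[OF W])
    show "(\<lambda>t. (norm (?G l t))\<^sup>2) \<in> borel_measurable lebesgue" "(\<lambda>t. (norm (?G (a n) t))\<^sup>2) \<in> borel_measurable lebesgue" for n
      using L2_integrable_square[OF G] by blast+
    show "AE t in lebesgue. (\<lambda>n. (norm (?G (a n) t))\<^sup>2) \<longlonglongrightarrow> (norm (?G l t))\<^sup>2"
      by (intro AE_I2 tendsto_power tendsto_norm ptw a)
    show "AE t in lebesgue. norm ((norm (?G (a n) t))\<^sup>2) \<le> (norm (decay_conv 2 w t))\<^sup>2" for n
      using bd by (intro AE_I2) (simp add: power_mono)
  qed
  then show ?thesis by (simp add: continuous_on_sequentially o_def)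
qed

text \<open>
  For fixed \<open>t\<close>, and up to a phase, \<open>a \<mapsto> decay_conv (2 - 2ia) v t\<close> is the Fourier transform, at the
  frequency \<open>2 * a\<close>, of the cut-off potential \<open>s \<mapsto> decay 2 (t - s) * v s\<close>. Integrating the Plancherel
  inequality over \<open>t\<close> gives a multiple of the square of the \<open>L2\<close> norm of \<open>v\<close>.
\<close>

lemma spectral_profile_L2:
  assumes v: "v \<in> L2"
  shows "spectral_profile v \<in> L2"
proof -
  let ?G = "\<lambda>a. decay_conv (Complex 2 (- (2 * a))) v"
  have [measurable]: "v \<in> borel_measurable lebesgue" using v by (rule L2_measurable)
  have cont: "continuous_on UNIV (spectral_profile v)" by (rule continuous_on_spectral_profile[OF v])
  have m: "spectral_profile v \<in> borel_measurable lborel"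
    using borel_measurable_continuous_onI[OF cont] by simp
  have G: "?G a \<in> L2" for a by (rule decay_conv_L2(1)[OF _ v]) simp
  have slice: "(\<integral>\<^sup>+a. ennreal ((norm (?G a t))\<^sup>2) \<partial>lborel) \<le> ennreal pi * (\<integral>\<^sup>+s. ennreal ((norm (decay 2 (t - s) * v s))\<^sup>2) \<partial>lebesgue)" for t
  proof -
    define h where "h s = decay 2 (t - s) * v s" for s
    have hint: "integrable lebesgue h" unfolding h_def by (rule decay_conv_integrable[OF _ v]) simp
    have h: "h \<in> L2"
    proof (rule L2_dominated(1)[OF _ v])
      show "h \<in> borel_measurable lebesgue" using hint by simp
      show "norm (h s) \<le> 1 * norm (v s)" for s
        using norm_decay_le[of 2 "t - s"] by (simp add: h_def norm_mult mult_left_le_one_le)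
    qed
    have eq: "norm (?G a t) = norm (LINT s|lebesgue. cis ((- 2 * a) * s) * h s)" for a
    proof -
      have "decay (Complex 2 (- (2 * a))) (t - s) * v s = cis (2 * a * t) * (cis ((- 2 * a) * s) * h s)" for s
      proof -
        have "cis (2 * a * (t - s)) = cis (2 * a * t) * cis ((- 2 * a) * s)"
          by (simp add: cis_mult right_diff_distrib)
        then show ?thesis unfolding decay_modulated h_def by (simp only: mult_ac)
      qed
      then have "?G a t = cis (2 * a * t) * (LINT s|lebesgue. cis ((- 2 * a) * s) * h s)"
        unfolding decay_conv_def by (simp only: integral_mult_right_zero)
      then show ?thesis by (simp add: norm_mult)
    qed
    let ?F = "\<lambda>a. ennreal ((norm (LINT s|lebesgue. cis (a * s) * h s))\<^sup>2)"
    have [measurable]: "h \<in> borel_measurable lebesgue" using hint by simp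
    have Fm: "?F \<in> borel_measurable lborel" by measurable
    \<comment> \<open>The factor \<open>2\<close> comes from the substitution of \<open>- 2 * a\<close> for the frequency.\<close>
    have "ennreal 2 * (\<integral>\<^sup>+a. ennreal ((norm (?G a t))\<^sup>2) \<partial>lborel) = (\<integral>\<^sup>+a. ?F a \<partial>lborel)"
      unfolding eq using nn_integral_real_affine[of ?F "- 2" 0] Fm by simp
    also have "\<dots> \<le> ennreal (2 * pi * (L2_norm h)\<^sup>2)" by (rule plancherel_inequality[OF h hint])
    also have "\<dots> = ennreal 2 * (ennreal pi * (\<integral>\<^sup>+s. ennreal ((norm (h s))\<^sup>2) \<partial>lebesgue))"
    proof -
      have "ennreal (c * d * X) = ennreal c * (ennreal d * ennreal X)" if "0 \<le> c" "0 \<le> d" "0 \<le> X" for c d X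
        using that by (simp add: ennreal_mult mult.assoc)
      moreover have "(\<integral>\<^sup>+s. ennreal ((norm (h s))\<^sup>2) \<partial>lebesgue) = ennreal ((L2_norm h)\<^sup>2)"
        using L2_integrable_square[OF h] by (simp add: nn_integral_eq_integral L2_norm_square)
      ultimately show ?thesis by simp
    qed
    finally show ?thesis
      unfolding h_def by (subst (asm) ennreal_mult_le_mult_iff) auto
  qed
  have jm: "(\<lambda>(a, t). ennreal ((norm (?G a t))\<^sup>2)) \<in> borel_measurable (lborel \<Otimes>\<^sub>M lborel)"
  proof -
    have [measurable]: "(\<lambda>a. Complex 2 (- (2 * a))) \<in> borel_measurable borel"
      unfolding Complex_eq by measurable
    have "(\<lambda>(p, s). decay (Complex 2 (- (2 * fst p))) (snd p - s) * v s) \<in> borel_measurable ((lborel \<Otimes>\<^sub>M lborel) \<Otimes>\<^sub>M lebesgue)"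
      by measurable
    from lebesgue.borel_measurable_lebesgue_integral[OF this]
    have [measurable]: "(\<lambda>p. ?G (fst p) (snd p)) \<in> borel_measurable (lborel \<Otimes>\<^sub>M lborel)"
      by (simp add: decay_conv_def)
    show ?thesis unfolding case_prod_beta by measurable
  qed
  have jm2: "(\<lambda>(t, s). ennreal ((norm (decay 2 (t - s) * v s))\<^sup>2)) \<in> borel_measurable (lborel \<Otimes>\<^sub>M lebesgue)"
    by measurable
  interpret Q: pair_sigma_finite lborel "lebesgue :: real measure" ..
  have half: "(\<integral>\<^sup>+t. ennreal ((norm (decay 2 (t - s)))\<^sup>2) \<partial>lborel) = ennreal (1 / 4)" for s
  proof -
    let ?k = "\<lambda>t. ennreal ((norm (decay 2 (t - s)))\<^sup>2)"
    have "?k \<in> borel_measurable borel" by measurable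
    then have "(\<integral>\<^sup>+t. ?k t \<partial>lborel) = (\<integral>\<^sup>+t. ?k (- t) \<partial>lborel)"
      using nn_integral_real_affine[of ?k "-1" 0] by simp
    also have "\<dots> = (\<integral>\<^sup>+t. ennreal ((norm (decay 2 (- s - t)))\<^sup>2) \<partial>lebesgue)"
      by (simp add: nn_integral_completion minus_diff_commute)
    also have "\<dots> = ennreal ((L2_norm (\<lambda>t. decay 2 (- s - t)))\<^sup>2)"
      using L2_integrable_square[OF decay_L2(1)[of 2 "- s"]]
      by (simp add: nn_integral_eq_integral L2_norm_square)
    finally show ?thesis by (simp add: decay_L2(2) power_divide)
  qed
  have "(\<integral>\<^sup>+a. ennreal ((spectral_profile v a)\<^sup>2) \<partial>lborel) = (\<integral>\<^sup>+a. \<integral>\<^sup>+t. ennreal ((norm (?G a t))\<^sup>2) \<partial>lborel \<partial>lborel)"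
  proof (rule nn_integral_cong)
    fix a
    have "ennreal ((spectral_profile v a)\<^sup>2) = (\<integral>\<^sup>+t. ennreal ((norm (?G a t))\<^sup>2) \<partial>lebesgue)"
      using L2_integrable_square[OF G] by (simp add: spectral_profile_def L2_norm_square nn_integral_eq_integral)
    then show "ennreal ((spectral_profile v a)\<^sup>2) = (\<integral>\<^sup>+t. ennreal ((norm (?G a t))\<^sup>2) \<partial>lborel)"
      by (simp only: nn_integral_completion)
  qed
  also have "\<dots> = (\<integral>\<^sup>+t. \<integral>\<^sup>+a. ennreal ((norm (?G a t))\<^sup>2) \<partial>lborel \<partial>lborel)"
    using lborel_pair.Fubini[OF jm] by simp
  also have "\<dots> \<le> (\<integral>\<^sup>+t. ennreal pi * (\<integral>\<^sup>+s. ennreal ((norm (decay 2 (t - s) * v s))\<^sup>2) \<partial>lebesgue) \<partial>lborel)"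
    by (intro nn_integral_mono slice)
  also have "\<dots> = ennreal pi * (\<integral>\<^sup>+t. (\<integral>\<^sup>+s. ennreal ((norm (decay 2 (t - s) * v s))\<^sup>2) \<partial>lebesgue) \<partial>lborel)"
    using lebesgue.borel_measurable_nn_integral[OF jm2] by (intro nn_integral_cmult) simp
  also have "(\<integral>\<^sup>+t. (\<integral>\<^sup>+s. ennreal ((norm (decay 2 (t - s) * v s))\<^sup>2) \<partial>lebesgue) \<partial>lborel) =
      (\<integral>\<^sup>+s. (\<integral>\<^sup>+t. ennreal ((norm (decay 2 (t - s) * v s))\<^sup>2) \<partial>lborel) \<partial>lebesgue)"
    using Q.Fubini[OF jm2] by simp
  also have "\<dots> = (\<integral>\<^sup>+s. ennreal (1 / 4) * ennreal ((norm (v s))\<^sup>2) \<partial>lebesgue)"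
  proof (rule nn_integral_cong)
    fix s
    have "(\<integral>\<^sup>+t. ennreal ((norm (decay 2 (t - s) * v s))\<^sup>2) \<partial>lborel)
        = (\<integral>\<^sup>+t. ennreal ((norm (decay 2 (t - s)))\<^sup>2) * ennreal ((norm (v s))\<^sup>2) \<partial>lborel)"
      by (simp add: norm_mult power_mult_distrib ennreal_mult)
    also have "\<dots> = ennreal (1 / 4) * ennreal ((norm (v s))\<^sup>2)"
      by (subst nn_integral_multc) (measurable, simp only: half)
    finally show "(\<integral>\<^sup>+t. ennreal ((norm (decay 2 (t - s) * v s))\<^sup>2) \<partial>lborel) = ennreal (1 / 4) * ennreal ((norm (v s))\<^sup>2)" .
  qed
  also have "\<dots> = ennreal (1 / 4) * ennreal ((L2_norm v)\<^sup>2)"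
    using L2_integrable_square[OF v] by (simp add: nn_integral_cmult nn_integral_eq_integral L2_norm_square)
  finally have "(\<integral>\<^sup>+a. ennreal ((spectral_profile v a)\<^sup>2) \<partial>lebesgue) \<le> ennreal pi * (ennreal (1 / 4) * ennreal ((L2_norm v)\<^sup>2))"
    by (simp add: nn_integral_completion)
  also have "\<dots> < \<infinity>" by (simp add: ennreal_mult_less_top)
  finally have "integrable lebesgue (\<lambda>a. (norm (spectral_profile v a))\<^sup>2)"
    using m by (intro integrableI_bounded) (auto intro!: measurable_completion)
  then show ?thesis using m by (simp add: L2_def measurable_completion)
qed

section \<open>The reflection operator and its square\<close>

lemma absolutely_continuous_on_cnj:
  "absolutely_continuous_on S F \<Longrightarrow> absolutely_continuous_on S (\<lambda>t. cnj (F t))"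
  unfolding absolutely_continuous_on_def by (simp only: complex_cnj_diff[symmetric] complex_mod_cnj)

text \<open>
  The reflected function is a primitive of the square-integrable function \<open>- h (- t)\<close>.
\<close>

lemma absolutely_continuous_on_reflect:
  fixes F h :: "real \<Rightarrow> complex"
  assumes AC: "\<And>a b. absolutely_continuous_on {a..b} F"
    and h: "h \<in> L2" and deriv: "AE t in lebesgue. (F has_vector_derivative h t) (at t)"
  shows "absolutely_continuous_on {a..b} (\<lambda>t. F (- t))"
    and "AE t in lebesgue. ((\<lambda>t. F (- t)) has_vector_derivative - h (- t)) (at t)"
proof -
  have neg: "(\<lambda>t. - h (- t)) \<in> L2"
    using L2_scale(1)[OF L2_reflect(1)[OF h], of "-1"] by simp
  have one: "continuous_on UNIV (\<lambda>t::real. 1 :: complex)" by simp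
  show "absolutely_continuous_on {a..b} (\<lambda>t. F (- t))"
  proof (rule absolutely_continuous_on_primitive)
    show "(\<lambda>t. indicator {a..b} t *\<^sub>R (- h (- t))) \<in> L2"
      using indicator_mult_L2[OF neg one, of a b] by (simp only: mult_1)
    fix u v :: real assume "u \<le> v"
    then have "(h has_integral F (- u) - F (- v)) {- v..- u}"
      by (intro has_integral_of_absolutely_continuous AC deriv) simp
    then have "((\<lambda>t. h (- t)) has_integral F (- u) - F (- v)) {u..v}"
      using has_integral_reflect_real[of h "F (- u) - F (- v)" "- u" "- v"] by simp
    from has_integral_neg[OF this]
    show "((\<lambda>t. - h (- t)) has_integral F (- v) - F (- u)) {u..v}" by simp
  qed
  show "AE t in lebesgue. ((\<lambda>t. F (- t)) has_vector_derivative - h (- t)) (at t)"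
    using AE_lebesgue_reflect[OF deriv]
  proof eventually_elim
    case (elim t)
    have "(uminus has_vector_derivative - 1) (at t)"
      by (auto intro!: derivative_eq_intros simp: has_real_derivative_iff_has_vector_derivative[symmetric])
    from vector_diff_chain_at[OF this elim] show ?case by (simp add: o_def)
  qed
qed

lemma lebesgue_measurable_cong_AE:
  fixes f g :: "real \<Rightarrow> complex"
  assumes g: "g \<in> borel_measurable lebesgue" and eq: "AE t in lebesgue. f t = g t"
  shows "f \<in> borel_measurable lebesgue"
proof (rule measurableI)
  fix A :: "complex set" assume "A \<in> sets borel"
  define N where "N = {t. \<not> f t = g t}"
  have N: "negligible N" unfolding N_def by (rule negligible_of_AE[OF eq])
  have "f -` A \<inter> space lebesgue = (g -` A \<inter> space lebesgue - N) \<union> (f -` A \<inter> N)"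
    by (auto simp: N_def)
  moreover have "f -` A \<inter> N \<in> sets lebesgue"
    by (rule negligible_imp_sets[OF negligible_subset[OF N]]) auto
  moreover have "g -` A \<inter> space lebesgue \<in> sets lebesgue"
    using g \<open>A \<in> sets borel\<close> by (rule measurable_sets)
  ultimately show "f -` A \<inter> space lebesgue \<in> sets lebesgue"
    using negligible_imp_sets[OF N] by (metis sets.Un sets.Diff)
qed auto

lemma L2_cong_AE:
  fixes f g :: "real \<Rightarrow> complex"
  assumes g: "g \<in> L2" and eq: "AE t in lebesgue. f t = g t"
  shows "f \<in> L2" and "L2_norm f = L2_norm g"
proof -
  have f: "f \<in> borel_measurable lebesgue"
    by (rule lebesgue_measurable_cong_AE[OF L2_measurable[OF g] eq])
  have eq2: "AE t in lebesgue. (norm (f t))\<^sup>2 = (norm (g t))\<^sup>2"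
    using eq by eventually_elim simp
  have m: "(\<lambda>t. (norm (f t))\<^sup>2) \<in> borel_measurable lebesgue" "(\<lambda>t. (norm (g t))\<^sup>2) \<in> borel_measurable lebesgue"
    using f L2_measurable[OF g] by measurable
  show "f \<in> L2"
    using f integrable_cong_AE[OF m eq2] L2_integrable_square[OF g] by (simp add: L2_def)
  show "L2_norm f = L2_norm g"
    unfolding L2_norm_def using integral_cong_AE[OF m eq2] by simp
qed

text \<open>
  The point of this estimate is that its constant does not depend on the imaginary part of \<open>\<kappa>\<close>.
  With \<open>G\<close> denoting the convolution, the function \<open>G * cnj G\<close> satisfies
  \<open>F' + 2 Re \<kappa> F = G cnj v + v cnj G\<close>, an equation from which \<open>Im \<kappa>\<close> has disappeared, and
  Cauchy--Schwarz bounds the integral of the modulus of the right-hand side.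
\<close>

lemma norm_decay_conv_square_le:
  assumes \<kappa>: "Re \<kappa> > 0" and v: "v \<in> L2"
  shows "(norm (decay_conv \<kappa> v t))\<^sup>2 \<le> 2 * L2_norm (decay_conv \<kappa> v) * L2_norm v"
proof -
  let ?G = "decay_conv \<kappa> v"
  let ?h = "\<lambda>t. ?G t * cnj (v t) + v t * cnj (?G t)"
  let ?c = "complex_of_real (2 * Re \<kappa>)"
  have G: "?G \<in> L2" by (rule decay_conv_L2(1)[OF \<kappa> v])
  have [measurable]: "?G \<in> borel_measurable lebesgue" "v \<in> borel_measurable lebesgue"
    using G v by (auto dest: L2_measurable)
  note prod = L2_integrable_mult[OF G v]
  have h_le: "norm (?h t) \<le> 2 * (norm (?G t) * norm (v t))" for t
    using norm_triangle_ineq[of "?G t * cnj (v t)" "v t * cnj (?G t)"]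
    by (simp add: norm_mult mult.commute[of "norm (v t)"])
  have [measurable]: "(\<lambda>s. decay ?c (t - s)) \<in> borel_measurable lebesgue" for t
    by (intro measurable_completion) measurable
  have cnjm [measurable]: "(\<lambda>t. cnj (?G t)) \<in> borel_measurable lebesgue" "(\<lambda>t. cnj (v t)) \<in> borel_measurable lebesgue"
    by (rule measurable_compose[of _ lebesgue borel], simp,
        intro borel_measurable_continuous_onI continuous_intros)+
  have le: "norm (decay ?c (t - s) * ?h s) \<le> 2 * (norm (?G s) * norm (v s))" for s
  proof -
    have "norm (decay ?c (t - s)) * norm (?h s) \<le> 1 * norm (?h s)"
      using \<kappa> by (intro mult_right_mono norm_decay_le) auto
    then show ?thesis using h_le[of s] by (simp add: norm_mult)
  qed
  have int: "integrable lebesgue (\<lambda>s. decay ?c (t - s) * ?h s)"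
  proof (rule Bochner_Integration.integrable_bound)
    show "integrable lebesgue (\<lambda>s. 2 * (norm (?G s) * norm (v s)))" using prod by simp
    show "(\<lambda>s. decay ?c (t - s) * ?h s) \<in> borel_measurable lebesgue" by measurable
    show "AE s in lebesgue. norm (decay ?c (t - s) * ?h s) \<le> norm (2 * (norm (?G s) * norm (v s)))"
      using le by (intro AE_I2) (simp add: abs_mult)
  qed
  have eq: "?G t * cnj (?G t) = decay_conv ?c ?h t"
  proof (rule decay_conv_unique[OF _ _ _ _ int, where B = "(L2_norm v / sqrt (2 * Re \<kappa>))\<^sup>2"])
    show "Re ?c > 0" using \<kappa> by simp
    show "absolutely_continuous_on {a..b} (\<lambda>t. ?G t * cnj (?G t))" for a b
      by (intro absolutely_continuous_on_mult absolutely_continuous_on_cnj absolutely_continuous_on_decay_conv \<kappa> v)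
    show "AE t in lebesgue. ((\<lambda>t. ?G t * cnj (?G t)) has_vector_derivative ?h t - ?c * (?G t * cnj (?G t))) (at t)"
      using decay_conv_has_vector_derivative[OF \<kappa> v]
    proof eventually_elim
      case (elim t)
      have eq: "?h t - ?c * (?G t * cnj (?G t)) =
          ?G t * cnj (v t - \<kappa> * ?G t) + (v t - \<kappa> * ?G t) * cnj (?G t)"
        unfolding complex_add_cnj[symmetric, of \<kappa>] by (simp add: algebra_simps)
      show ?case unfolding eq
        by (rule has_vector_derivative_mult[OF elim has_vector_derivative_cnj[OF elim]])
    qed
    fix t
    have "norm (?G t) * norm (?G t) \<le> (L2_norm v / sqrt (2 * Re \<kappa>)) * (L2_norm v / sqrt (2 * Re \<kappa>))"
      using norm_decay_conv_le[OF \<kappa> v] \<kappa> L2_norm_nonneg[of v] by (intro mult_mono) auto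
    then show "norm (?G t * cnj (?G t)) \<le> (L2_norm v / sqrt (2 * Re \<kappa>))\<^sup>2"
      by (simp add: norm_mult power2_eq_square)
  qed
  have "(norm (?G t))\<^sup>2 = norm (?G t * cnj (?G t))"
    by (simp add: norm_mult power2_eq_square)
  also have "\<dots> = norm (decay_conv ?c ?h t)"
    by (simp only: eq)
  also have "\<dots> \<le> (LINT s|lebesgue. norm (decay ?c (t - s) * ?h s))"
    unfolding decay_conv_def by (rule integral_norm_bound)
  also have "\<dots> \<le> (LINT s|lebesgue. 2 * (norm (?G s) * norm (v s)))"
  proof (rule integral_mono)
    show "integrable lebesgue (\<lambda>s. norm (decay ?c (t - s) * ?h s))" using int by (rule integrable_norm)
    show "integrable lebesgue (\<lambda>s. 2 * (norm (?G s) * norm (v s)))" using prod by simp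
  qed (rule le)
  also have "\<dots> \<le> 2 * (L2_norm ?G * L2_norm v)"
    using L2_integral_mult_le[OF G v] by simp
  finally show ?thesis by simp
qed

text \<open>
  The equation \<open>opL v x - \<mu> x = y\<close> reads \<open>x' + c x = \<i> (v x(-\<cdot>) + y)\<close> with \<open>c = - \<i> * \<mu>\<close>. For
  \<open>Im \<mu> > 0\<close> it is therefore the fixed point equation for \<open>refl_op v c\<close> plus the convolution of
  \<open>\<i> y\<close>.
\<close>

definition refl_op :: "(real \<Rightarrow> complex) \<Rightarrow> complex \<Rightarrow> (real \<Rightarrow> complex) \<Rightarrow> real \<Rightarrow> complex" where
  "refl_op v c u = decay_conv c (\<lambda>s. \<i> * (v s * u (- s)))"

lemma continuous_reflect: "continuous_on UNIV u \<Longrightarrow> continuous_on UNIV (\<lambda>s::real. u (- s))"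
  by (rule continuous_on_compose2[of UNIV u]) (auto intro!: continuous_intros)

lemma refl_source_L2:
  fixes u v :: "real \<Rightarrow> complex"
  assumes v: "v \<in> L2" and u: "continuous_on UNIV u" "\<And>t. norm (u t) \<le> U"
  shows "(\<lambda>s. \<i> * (v s * u (- s))) \<in> L2" and "L2_norm (\<lambda>s. \<i> * (v s * u (- s))) \<le> L2_norm v * U"
proof -
  have m: "(\<lambda>s. u (- s)) \<in> borel_measurable lebesgue"
    by (rule continuous_imp_lebesgue_measurable[OF continuous_reflect[OF u(1)]])
  note * = L2_bounded_mult[OF v m, of U, OF u(2)]
  have eq: "(\<lambda>s. \<i> * (v s * u (- s))) = (\<lambda>s. \<i> * (u (- s) * v s))" by (simp add: mult.commute)
  show "(\<lambda>s. \<i> * (v s * u (- s))) \<in> L2" unfolding eq by (rule L2_scale(1)[OF *(1)])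
  show "L2_norm (\<lambda>s. \<i> * (v s * u (- s))) \<le> L2_norm v * U"
    unfolding eq L2_scale(2)[OF *(1)] using *(2) by (simp add: mult.commute)
qed

lemma norm_refl_op_le:
  assumes c: "Re c > 0" and v: "v \<in> L2" and u: "continuous_on UNIV u" "\<And>t. norm (u t) \<le> U"
  shows "norm (refl_op v c u t) \<le> L2_norm v * U / sqrt (2 * Re c)"
proof -
  have "norm (refl_op v c u t) \<le> L2_norm (\<lambda>s. \<i> * (v s * u (- s))) / sqrt (2 * Re c)"
    unfolding refl_op_def by (rule norm_decay_conv_le[OF c refl_source_L2(1)[OF v u]])
  also have "\<dots> \<le> L2_norm v * U / sqrt (2 * Re c)"
    using c refl_source_L2(2)[OF v u] by (intro divide_right_mono) auto
  finally show ?thesis .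
qed

lemma continuous_refl_op:
  assumes c: "Re c > 0" and v: "v \<in> L2" and u: "continuous_on UNIV u" "\<And>t. norm (u t) \<le> U"
  shows "continuous_on UNIV (refl_op v c u)"
  unfolding refl_op_def by (rule continuous_on_decay_conv[OF c refl_source_L2(1)[OF v u]])

lemma refl_op_add:
  assumes c: "Re c > 0" and v: "v \<in> L2"
    and u: "continuous_on UNIV u" "\<And>t. norm (u t) \<le> U"
    and w: "continuous_on UNIV w" "\<And>t. norm (w t) \<le> W"
  shows "refl_op v c (\<lambda>t. u t + w t) t = refl_op v c u t + refl_op v c w t"
  using decay_conv_add[OF c refl_source_L2(1)[OF v u] refl_source_L2(1)[OF v w], of t]
  by (simp add: refl_op_def distrib_left)

lemma refl_op_diff:
  assumes c: "Re c > 0" and v: "v \<in> L2"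
    and u: "continuous_on UNIV u" "\<And>t. norm (u t) \<le> U"
    and w: "continuous_on UNIV w" "\<And>t. norm (w t) \<le> W"
  shows "refl_op v c (\<lambda>t. u t - w t) t = refl_op v c u t - refl_op v c w t"
  using decay_conv_diff[OF c refl_source_L2(1)[OF v u] refl_source_L2(1)[OF v w], of t]
  by (simp add: refl_op_def right_diff_distrib)

text \<open>
  Integration by parts in the square of \<open>refl_op v c\<close>. The potential under the outer convolution is
  written as \<open>v = G' + \<kappa> G\<close> and the derivative is moved to \<open>p\<close>, the reflection of \<open>refl_op v c u\<close>.
  Since \<open>p' = c p - \<i> v(-\<cdot>) u\<close>, the product \<open>G p\<close> is a bounded solution of
  \<open>F' + c F = v p + (2 c - \<kappa>) G p - \<i> G v(-\<cdot>) u\<close>, so it is the convolution of this right-hand side.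
  The reflection turns \<open>- c\<close> into \<open>+ c\<close>; this is why \<open>2 c - \<kappa>\<close> appears, and why choosing
  \<open>Im \<kappa> = 2 Im c\<close> removes every factor that grows with \<open>Re \<mu>\<close>.
\<close>

lemma refl_op_refl_op:
  fixes u v :: "real \<Rightarrow> complex" and c \<kappa> :: complex
  assumes c: "Re c > 0" and \<kappa>: "Re \<kappa> > 0" and v: "v \<in> L2"
    and u: "continuous_on UNIV u" "\<And>t. norm (u t) \<le> U"
  defines "G \<equiv> decay_conv \<kappa> v" and "p \<equiv> \<lambda>s. refl_op v c u (- s)"
  shows "refl_op v c (refl_op v c u) t = \<i> * (G t * p t
      - (2 * c - \<kappa>) * decay_conv c (\<lambda>s. G s * p s) t
      + decay_conv c (\<lambda>s. G s * (\<i> * (v (- s) * u s))) t)"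
proof -
  let ?g = "\<lambda>s. \<i> * (v s * u (- s))"
  let ?q = "\<lambda>s. \<i> * (v (- s) * u s)"
  define P where "P = L2_norm v * U / sqrt (2 * Re c)"
  have g: "?g \<in> L2" by (rule refl_source_L2(1)[OF v u])
  have q: "?q \<in> L2" using L2_reflect(1)[OF g] by simp
  have T: "refl_op v c u = decay_conv c ?g" by (simp add: refl_op_def)
  have G: "G \<in> L2" unfolding G_def by (rule decay_conv_L2(1)[OF \<kappa> v])
  have Gm: "G \<in> borel_measurable lebesgue" using G by (rule L2_measurable)
  have GB: "norm (G s) \<le> L2_norm v / sqrt (2 * Re \<kappa>)" for s
    unfolding G_def by (rule norm_decay_conv_le[OF \<kappa> v])
  have dT: "(\<lambda>s. ?g s - c * decay_conv c ?g s) \<in> L2"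
    by (rule L2_diff[OF g L2_scale(1)[OF decay_conv_L2(1)[OF c g]]])
  note refl = absolutely_continuous_on_reflect[OF absolutely_continuous_on_decay_conv[OF c g] dT
      decay_conv_has_vector_derivative[OF c g], folded T]
  have pAC: "absolutely_continuous_on {a..b} p" for a b
    unfolding p_def by (rule refl(1))
  have pd: "AE s in lebesgue. (p has_vector_derivative c * p s - ?q s) (at s)"
    using refl(2) unfolding p_def T by simp
  have pB: "norm (p s) \<le> P" for s
    unfolding p_def P_def by (rule norm_refl_op_le[OF c v u])
  have pcont: "continuous_on UNIV p" by (rule continuous_on_of_locally_absolutely_continuous[OF pAC])
  have pm: "p \<in> borel_measurable lebesgue" by (rule continuous_imp_lebesgue_measurable[OF pcont])
  have vp: "(\<lambda>s. v s * p s) \<in> L2" using L2_bounded_mult(1)[OF v pm pB] by (simp add: mult.commute)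
  have Gp: "(\<lambda>s. G s * p s) \<in> L2" using L2_bounded_mult(1)[OF G pm pB] by (simp add: mult.commute)
  have Gq: "(\<lambda>s. G s * ?q s) \<in> L2" by (rule L2_bounded_mult(1)[OF q Gm GB])
  have kGp: "(\<lambda>s. (2 * c - \<kappa>) * (G s * p s)) \<in> L2" by (rule L2_scale(1)[OF Gp])
  define h where "h s = v s * p s + (2 * c - \<kappa>) * (G s * p s) - G s * ?q s" for s
  have h: "h \<in> L2" unfolding h_def by (intro L2_diff L2_add(1) vp kGp Gq)
  have "G t * p t = decay_conv c h t"
  proof (rule decay_conv_unique[OF c, where B = "L2_norm v / sqrt (2 * Re \<kappa>) * P"])
    show "absolutely_continuous_on {a..b} (\<lambda>s. G s * p s)" for a b
      unfolding G_def by (intro absolutely_continuous_on_mult absolutely_continuous_on_decay_conv \<kappa> v pAC)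
    show "AE s in lebesgue. ((\<lambda>s. G s * p s) has_vector_derivative h s - c * (G s * p s)) (at s)"
      using pd decay_conv_has_vector_derivative[OF \<kappa> v, folded G_def]
    proof eventually_elim
      case (elim s)
      have eq: "h s - c * (G s * p s) = G s * (c * p s - ?q s) + (v s - \<kappa> * G s) * p s"
        by (simp add: h_def algebra_simps)
      show ?case unfolding eq by (rule has_vector_derivative_mult[OF elim(2) elim(1)])
    qed
    show "norm (G s * p s) \<le> L2_norm v / sqrt (2 * Re \<kappa>) * P" for s
      unfolding norm_mult using GB pB L2_norm_nonneg[of v] \<kappa> by (intro mult_mono) auto
    show "integrable lebesgue (\<lambda>s. decay c (t - s) * h s)" by (rule decay_conv_integrable[OF c h])
  qed
  also have "\<dots> = decay_conv c (\<lambda>s. v s * p s) t + (2 * c - \<kappa>) * decay_conv c (\<lambda>s. G s * p s) t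
      - decay_conv c (\<lambda>s. G s * ?q s) t"
    unfolding h_def decay_conv_diff[OF c L2_add(1)[OF vp kGp] Gq] decay_conv_add[OF c vp kGp] decay_conv_scale ..
  finally have "decay_conv c (\<lambda>s. v s * p s) t = G t * p t - (2 * c - \<kappa>) * decay_conv c (\<lambda>s. G s * p s) t
      + decay_conv c (\<lambda>s. G s * ?q s) t"
    by (simp add: algebra_simps)
  moreover have "refl_op v c (refl_op v c u) t = \<i> * decay_conv c (\<lambda>s. v s * p s) t"
    unfolding refl_op_def[of v c "refl_op v c u"] decay_conv_scale p_def ..
  ultimately show ?thesis by simp
qed

text \<open>
  Each term of \<open>refl_op_refl_op\<close> is bounded by \<open>L2\<close> estimates for the convolution, with
  \<open>g = sqrt (2 * \<gamma> * N)\<close> the uniform bound on \<open>G\<close> and \<open>P\<close> the one on \<open>refl_op v c u\<close>.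
\<close>

lemma norm_refl_op_refl_op_le:
  fixes u v :: "real \<Rightarrow> complex" and a b :: real
  assumes b: "b > 0" and v: "v \<in> L2"
    and u: "continuous_on UNIV u" "\<And>t. norm (u t) \<le> U"
  defines "c \<equiv> Complex b (- a)" and "N \<equiv> L2_norm v" and "\<gamma> \<equiv> spectral_profile v a"
  shows "norm (refl_op v c (refl_op v c u) t) \<le>
    U * (N * (2 * sqrt (2 * \<gamma> * N) / sqrt (2 * b) + \<bar>b - 1\<bar> * \<gamma> / b))"
proof -
  define \<kappa> where "\<kappa> = Complex 2 (- (2 * a))"
  define G where "G = decay_conv \<kappa> v"
  define p where "p s = refl_op v c u (- s)" for s
  define P where "P = N * U / sqrt (2 * b)"
  define g where "g = sqrt (2 * \<gamma> * N)"
  let ?q = "\<lambda>s. \<i> * (v (- s) * u s)"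
  have c: "Re c > 0" and Rc: "Re c = b" and \<kappa>: "Re \<kappa> > 0" and k: "2 * c - \<kappa> = complex_of_real (2 * (b - 1))"
    using b by (simp_all add: c_def \<kappa>_def complex_eq_iff)
  have U: "0 \<le> U" using u(2)[of 0] norm_ge_zero order_trans by blast
  have N0: "0 \<le> N" and \<gamma>0: "0 \<le> \<gamma>" by (simp_all add: N_def L2_norm_nonneg \<gamma>_def spectral_profile_nonneg)
  have G: "G \<in> L2" unfolding G_def by (rule decay_conv_L2(1)[OF \<kappa> v])
  have G\<gamma>: "L2_norm G = \<gamma>" by (simp add: G_def \<gamma>_def spectral_profile_def \<kappa>_def)
  have Gg: "norm (G s) \<le> g" for s
  proof -
    have "(norm (G s))\<^sup>2 \<le> 2 * \<gamma> * N"
      using norm_decay_conv_square_le[OF \<kappa> v, of s] by (simp add: G_def[symmetric] G\<gamma> N_def)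
    then show ?thesis unfolding g_def by (rule real_le_rsqrt)
  qed
  have g0: "0 \<le> g" using \<gamma>0 N0 by (simp add: g_def)
  have pP: "norm (p s) \<le> P" for s
    unfolding p_def P_def N_def using norm_refl_op_le[OF c v u] by (simp add: Rc)
  have P0: "0 \<le> P" using N0 U b by (simp add: P_def)
  have pcont: "continuous_on UNIV p"
    unfolding p_def by (rule continuous_reflect[OF continuous_refl_op[OF c v u]])
  have Gp: "(\<lambda>s. G s * p s) \<in> L2" "L2_norm (\<lambda>s. G s * p s) \<le> P * \<gamma>"
    using L2_bounded_mult[OF G continuous_imp_lebesgue_measurable[OF pcont] pP] by (simp_all add: mult.commute G\<gamma>)
  have q: "?q \<in> L2" "L2_norm ?q \<le> N * U"
    using L2_reflect[OF refl_source_L2(1)[OF v u]] refl_source_L2(2)[OF v u] by (simp_all add: N_def)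
  have Gq: "(\<lambda>s. G s * ?q s) \<in> L2" "L2_norm (\<lambda>s. G s * ?q s) \<le> g * (N * U)"
    using L2_bounded_mult[OF q(1) L2_measurable[OF G] Gg] mult_left_mono[OF q(2) g0] by (auto intro: order_trans)
  have 1: "norm (G t * p t) \<le> g * P"
    unfolding norm_mult using Gg pP g0 by (intro mult_mono) auto
  have "norm (decay_conv c (\<lambda>s. G s * p s) t) \<le> P * \<gamma> / sqrt (2 * b)"
    using norm_decay_conv_le[OF c Gp(1), of t] divide_right_mono[OF Gp(2), of "sqrt (2 * b)"] b by (simp add: Rc)
  note Gp_le = this
  have 2: "norm ((2 * c - \<kappa>) * decay_conv c (\<lambda>s. G s * p s) t) \<le> 2 * \<bar>b - 1\<bar> * (P * \<gamma> / sqrt (2 * b))"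
  proof -
    have "norm (2 * c - \<kappa>) = 2 * \<bar>b - 1\<bar>" unfolding k norm_of_real abs_mult by simp
    then show ?thesis
      unfolding norm_mult using Gp_le by (metis abs_ge_zero mult_left_mono mult_nonneg_nonneg zero_le_numeral)
  qed
  have 3: "norm (decay_conv c (\<lambda>s. G s * ?q s) t) \<le> g * (N * U) / sqrt (2 * b)"
    using norm_decay_conv_le[OF c Gq(1), of t] divide_right_mono[OF Gq(2), of "sqrt (2 * b)"] b by (simp add: Rc)
  have "norm (refl_op v c (refl_op v c u) t) = norm (G t * p t
      - (2 * c - \<kappa>) * decay_conv c (\<lambda>s. G s * p s) t + decay_conv c (\<lambda>s. G s * ?q s) t)"
    unfolding refl_op_refl_op[OF c \<kappa> v u] G_def[symmetric] p_def[symmetric] norm_mult by simp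
  also have "\<dots> \<le> g * P + 2 * \<bar>b - 1\<bar> * (P * \<gamma> / sqrt (2 * b)) + g * (N * U) / sqrt (2 * b)"
    using norm_triangle_ineq[of "G t * p t - (2 * c - \<kappa>) * decay_conv c (\<lambda>s. G s * p s) t" "decay_conv c (\<lambda>s. G s * ?q s) t"]
      norm_triangle_ineq4[of "G t * p t" "(2 * c - \<kappa>) * decay_conv c (\<lambda>s. G s * p s) t"] 1 2 3
    by linarith
  also have "2 * \<bar>b - 1\<bar> * (P * \<gamma> / sqrt (2 * b)) = U * (N * (\<bar>b - 1\<bar> * \<gamma> / b))"
  proof -
    have "P / sqrt (2 * b) = N * U / (2 * b)" using b by (simp add: P_def)
    then have "P * \<gamma> / sqrt (2 * b) = N * U / (2 * b) * \<gamma>" by (metis times_divide_eq_left)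
    then show ?thesis by simp
  qed
  finally show ?thesis
    unfolding g_def[symmetric] by (simp add: P_def algebra_simps add_divide_distrib)
qed

text \<open>
  The coefficient of \<open>\<gamma>\<close> is chosen so that each of the two summands is at most \<open>1 / 3\<close>: the first one
  needs \<open>36 * N ^ 3\<close>, the second one \<open>3 * N * (1 + N\<^sup>2)\<close>, because \<open>\<bar>b - 1\<bar> \<le> 1 + N\<^sup>2\<close>.
\<close>

lemma contraction_constant:
  fixes N \<gamma> b :: real
  assumes N: "0 \<le> N" and \<gamma>: "0 \<le> \<gamma>" and b: "(39 * N ^ 3 + 3 * N) * \<gamma> < b" and bN: "b \<le> N\<^sup>2"
  shows "N * (2 * sqrt (2 * \<gamma> * N) / sqrt (2 * b) + \<bar>b - 1\<bar> * \<gamma> / b) \<le> 2 / 3"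
proof -
  have "0 \<le> (39 * N ^ 3 + 3 * N) * \<gamma>" using N \<gamma> by simp
  then have b0: "b > 0" using b by linarith
  have exp: "(39 * N ^ 3 + 3 * N) * \<gamma> = 39 * (N ^ 3 * \<gamma>) + 3 * (N * \<gamma>)" by (simp add: algebra_simps)
  have nn: "0 \<le> N ^ 3 * \<gamma>" "0 \<le> N * \<gamma>" using N \<gamma> by simp_all
  have s: "2 * sqrt (2 * \<gamma> * N) / sqrt (2 * b) = 2 * sqrt (\<gamma> * N / b)"
    by (simp add: real_sqrt_divide real_sqrt_mult)
  have "(N * (2 * sqrt (\<gamma> * N / b)))\<^sup>2 = N\<^sup>2 * (4 * (\<gamma> * N / b))"
    using N \<gamma> b0 by (simp add: power_mult_distrib)
  also have "\<dots> = 4 * (N ^ 3 * \<gamma>) / b"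
    by (simp add: power2_eq_square power3_eq_cube)
  also have "\<dots> \<le> (1 / 3)\<^sup>2"
    using b nn \<gamma> b0 unfolding exp by (simp add: divide_simps power2_eq_square)
  finally have 1: "N * (2 * sqrt (\<gamma> * N / b)) \<le> 1 / 3"
    by (rule power2_le_imp_le) simp
  have "\<bar>b - 1\<bar> \<le> 1 + N\<^sup>2" using b0 bN by (simp add: abs_le_iff)
  then have "N * (\<bar>b - 1\<bar> * \<gamma>) \<le> N * ((1 + N\<^sup>2) * \<gamma>)"
    using N \<gamma> by (intro mult_left_mono mult_right_mono)
  also have "\<dots> = N * \<gamma> + N ^ 3 * \<gamma>" by (simp add: algebra_simps power2_eq_square power3_eq_cube)
  also have "\<dots> \<le> 1 / 3 * b" using b nn \<gamma> unfolding exp by simp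
  finally have 2: "N * (\<bar>b - 1\<bar> * \<gamma> / b) \<le> 1 / 3"
    using b0 by (simp add: divide_le_eq)
  show ?thesis unfolding s distrib_left using 1 2 by simp
qed

text \<open>
  For \<open>b\<close> above the square of \<open>L2_norm v\<close> a single application of \<open>refl_op\<close> already contracts, without
  any use of oscillation; below it the integration by parts is used.
\<close>

lemma refl_op_contraction:
  fixes u v :: "real \<Rightarrow> complex" and a b :: real
  assumes v: "v \<in> L2" and u: "continuous_on UNIV u" "\<And>t. norm (u t) \<le> U"
    and b: "b > (39 * L2_norm v ^ 3 + 3 * L2_norm v) * spectral_profile v a"
  defines "c \<equiv> Complex b (- a)"
  shows "norm (refl_op v c (refl_op v c u) t) \<le> 2 / 3 * U"
proof -
  let ?N = "L2_norm v" and ?\<gamma> = "spectral_profile v a"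
  have N: "0 \<le> ?N" and \<gamma>: "0 \<le> ?\<gamma>" by (simp_all add: L2_norm_nonneg spectral_profile_nonneg)
  then have "0 \<le> (39 * ?N ^ 3 + 3 * ?N) * ?\<gamma>" by simp
  then have b0: "b > 0" using b by linarith
  have c: "Re c > 0" and Rc: "Re c = b" using b0 by (simp_all add: c_def)
  have U: "0 \<le> U" using u(2)[of 0] norm_ge_zero order_trans by blast
  show ?thesis
  proof (cases "b \<le> ?N\<^sup>2")
    case True
    have "norm (refl_op v c (refl_op v c u) t) \<le> U * (?N * (2 * sqrt (2 * ?\<gamma> * ?N) / sqrt (2 * b) + \<bar>b - 1\<bar> * ?\<gamma> / b))"
      unfolding c_def by (rule norm_refl_op_refl_op_le[OF b0 v u])
    also have "\<dots> \<le> U * (2 / 3)"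
      using U by (intro mult_left_mono contraction_constant[OF N \<gamma> b True])
    finally show ?thesis by simp
  next
    case False
    have "norm (refl_op v c u s) \<le> ?N * U / sqrt (2 * b)" for s
      using norm_refl_op_le[OF c v u] by (simp add: Rc)
    from norm_refl_op_le[OF c v continuous_refl_op[OF c v u] this]
    have "norm (refl_op v c (refl_op v c u) t) \<le> ?N * (?N * U / sqrt (2 * b)) / sqrt (2 * b)" by (simp add: Rc)
    also have "\<dots> = ?N\<^sup>2 / (2 * b) * U" using b0 by (simp add: power2_eq_square)
    also have "\<dots> \<le> 2 / 3 * U" using False b0 U by (intro mult_right_mono) (auto simp: divide_le_eq)
    finally show ?thesis .
  qed
qed

section \<open>Resolvent set and spectrum\<close>

lemma W12D:
  assumes "x \<in> W12"
  shows W12_L2: "x \<in> L2"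
    and W12_absolutely_continuous: "absolutely_continuous_on {a..b} x"
    and W12_derivative: "\<exists>x'. x' \<in> L2 \<and> (AE t in lebesgue. (x has_vector_derivative x' t) (at t))"
  using assms unfolding W12_def by blast+

lemma W12I:
  assumes "x \<in> L2" "\<And>a b. absolutely_continuous_on {a..b} x" "x' \<in> L2"
    "AE t in lebesgue. (x has_vector_derivative x' t) (at t)"
  shows "x \<in> W12"
  using assms unfolding W12_def by blast

lemma W12_continuous: "x \<in> W12 \<Longrightarrow> continuous_on UNIV x"
  by (rule continuous_on_of_locally_absolutely_continuous) (rule W12_absolutely_continuous)

text \<open>
  The derivative of \<open>x * cnj x\<close> is a sum of products of two square-integrable functions, hence
  integrable over the whole line.
\<close>

lemma W12_bounded:
  assumes "x \<in> W12"
  shows "\<exists>B. \<forall>t. norm (x t) \<le> B"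
proof -
  obtain x' where x': "x' \<in> L2" and d: "AE t in lebesgue. (x has_vector_derivative x' t) (at t)"
    using W12_derivative[OF assms] by blast
  have x: "x \<in> L2" by (rule W12_L2[OF assms])
  have AC: "absolutely_continuous_on {a..b} x" for a b by (rule W12_absolutely_continuous[OF assms])
  let ?F = "\<lambda>t. x t * cnj (x t)"
  let ?g = "\<lambda>t. x t * cnj (x' t) + x' t * cnj (x t)"
  define M where "M = 2 * (LINT t|lebesgue. norm (x t) * norm (x' t))"
  note prod = L2_integrable_mult[OF x x']
  have ACF: "absolutely_continuous_on {a..b} ?F" for a b
    by (intro absolutely_continuous_on_mult absolutely_continuous_on_cnj AC)
  have dF: "AE t in lebesgue. (?F has_vector_derivative ?g t) (at t)"
    using d
  proof eventually_elim
    case (elim t)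
    show ?case by (rule has_vector_derivative_mult[OF elim has_vector_derivative_cnj[OF elim]])
  qed
  have g_le: "norm (?g t) \<le> 2 * (norm (x t) * norm (x' t))" for t
    using norm_triangle_ineq[of "x t * cnj (x' t)" "x' t * cnj (x t)"] by (simp add: norm_mult mult.commute)
  have step: "norm (?F v - ?F u) \<le> M" if "u \<le> v" for u v
  proof -
    have hi: "(?g has_integral ?F v - ?F u) {u..v}"
      by (rule has_integral_of_absolutely_continuous[OF that ACF dF])
    have sint: "set_integrable lebesgue {u..v} (\<lambda>t. 2 * (norm (x t) * norm (x' t)))"
      unfolding set_integrable_def using prod by (intro integrable_mult_indicator) auto
    have "norm (integral {u..v} ?g) \<le> integral {u..v} (\<lambda>t. 2 * (norm (x t) * norm (x' t)))"
      using hi set_lebesgue_integral_eq_integral(1)[OF sint] g_le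
      by (intro integral_norm_bound_integral) auto
    also have "\<dots> = (LINT t:{u..v}|lebesgue. 2 * (norm (x t) * norm (x' t)))"
      by (rule set_lebesgue_integral_eq_integral(2)[OF sint, symmetric])
    also have "\<dots> \<le> (LINT t|lebesgue. 2 * (norm (x t) * norm (x' t)))"
      unfolding set_lebesgue_integral_def
    proof (rule integral_mono)
      show "integrable lebesgue (\<lambda>t. indicator {u..v} t *\<^sub>R (2 * (norm (x t) * norm (x' t))))"
        using sint by (simp add: set_integrable_def)
      show "integrable lebesgue (\<lambda>t. 2 * (norm (x t) * norm (x' t)))" using prod by simp
    qed (simp add: indicator_def)
    finally show ?thesis using integral_unique[OF hi] by (simp add: M_def)
  qed
  have "norm (x t) \<le> 1 + (norm (x 0))\<^sup>2 + M" for t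
  proof -
    have "norm (?F t - ?F 0) \<le> M"
      using step[of 0 t] step[of t 0] by (cases "0 \<le> t") (auto simp: norm_minus_commute)
    then have "norm (?F t) \<le> norm (?F 0) + M"
      using norm_triangle_sub[of "?F t" "?F 0"] by linarith
    then have "(norm (x t))\<^sup>2 \<le> (norm (x 0))\<^sup>2 + M" by (simp add: norm_mult power2_eq_square)
    moreover have "norm (x t) \<le> 1 + (norm (x t))\<^sup>2"
      using sum_squares_bound[of "norm (x t)" 1] norm_ge_zero[of "x t"] by (simp del: norm_ge_zero)
    ultimately show ?thesis by linarith
  qed
  then show ?thesis by blast
qed

lemma opL_shift_AE:
  assumes "AE t in lebesgue. (x has_vector_derivative x' t) (at t)"
  shows "AE t in lebesgue. opL v x t - \<mu> * x t = - \<i> * x' t - v t * x (- t) - \<mu> * x t"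
  using assms by eventually_elim (simp add: opL_def opV_def vector_derivative_at)

text \<open>
  Since \<open>L2_norm\<close> is \<open>0\<close> on functions whose square is not integrable, the norm estimate for the inverse
  has content only because the image of \<open>W12\<close> lies in \<open>L2\<close>.
\<close>

lemma opL_shift_L2:
  assumes v: "v \<in> L2" and x: "x \<in> W12"
  shows "(\<lambda>t. opL v x t - \<mu> * x t) \<in> L2"
proof -
  obtain x' where x': "x' \<in> L2" and d: "AE t in lebesgue. (x has_vector_derivative x' t) (at t)"
    using W12_derivative[OF x] by blast
  have x2: "x \<in> L2" by (rule W12_L2[OF x])
  obtain B where B: "\<And>t. norm (x t) \<le> B" using W12_bounded[OF x] by blast
  have "(\<lambda>t. x (- t) * v t) \<in> L2"
    by (rule L2_bounded_mult(1)[OF v continuous_imp_lebesgue_measurable[OF continuous_reflect[OF W12_continuous[OF x]]] B])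
  then have "(\<lambda>t. v t * x (- t)) \<in> L2" by (simp add: mult.commute)
  then have "(\<lambda>t. - \<i> * x' t - v t * x (- t) - \<mu> * x t) \<in> L2"
    by (intro L2_diff L2_scale(1) x' x2)
  then show ?thesis by (rule L2_cong_AE(1)[OF _ opL_shift_AE[OF d]])
qed

lemma opL_solution_fixed_point:
  assumes v: "v \<in> L2" and x: "x \<in> W12" and y: "y \<in> L2" and \<mu>: "Im \<mu> > 0"
    and eq: "AE t in lebesgue. opL v x t - \<mu> * x t = y t"
  defines "c \<equiv> Complex (Im \<mu>) (- Re \<mu>)"
  shows "x t = refl_op v c x t + decay_conv c (\<lambda>s. \<i> * y s) t"
proof -
  obtain x' where x': "x' \<in> L2" and d: "AE t in lebesgue. (x has_vector_derivative x' t) (at t)"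
    using W12_derivative[OF x] by blast
  have AC: "absolutely_continuous_on {a..b} x" for a b by (rule W12_absolutely_continuous[OF x])
  obtain B where B: "\<And>t. norm (x t) \<le> B" using W12_bounded[OF x] by blast
  have c: "Re c > 0" and c\<mu>: "c = - \<i> * \<mu>" using \<mu> by (simp_all add: c_def complex_eq_iff)
  have src: "(\<lambda>s. \<i> * (v s * x (- s))) \<in> L2" by (rule refl_source_L2(1)[OF v W12_continuous[OF x] B])
  have iy: "(\<lambda>s. \<i> * y s) \<in> L2" by (rule L2_scale(1)[OF y])
  let ?h = "\<lambda>s. \<i> * (v s * x (- s)) + \<i> * y s"
  have h: "?h \<in> L2" by (rule L2_add(1)[OF src iy])
  have "x t = decay_conv c ?h t"
  proof (rule decay_conv_unique[OF c AC _ B decay_conv_integrable[OF c h]])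
    show "AE t in lebesgue. (x has_vector_derivative ?h t - c * x t) (at t)"
      using d opL_shift_AE[OF d, of v \<mu>] eq
    proof eventually_elim
      case (elim t)
      have "y t = - \<i> * x' t - v t * x (- t) - \<mu> * x t" using elim(2,3) by simp
      then have "?h t - c * x t = x' t" by (simp only: c\<mu>) (simp add: algebra_simps)
      with elim(1) show ?case by simp
    qed
  qed
  then show ?thesis by (simp add: decay_conv_add[OF c src iy] refl_op_def)
qed

lemma fixed_point_opL_solution:
  assumes v: "v \<in> L2" and y: "y \<in> L2" and \<mu>: "Im \<mu> > 0"
    and x: "continuous_on UNIV x" "\<And>t. norm (x t) \<le> B"
  defines "c \<equiv> Complex (Im \<mu>) (- Re \<mu>)"
  assumes fp: "\<And>t. x t = refl_op v c x t + decay_conv c (\<lambda>s. \<i> * y s) t"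
  shows "x \<in> W12" and "AE t in lebesgue. opL v x t - \<mu> * x t = y t"
    and "L2_norm x \<le> (L2_norm v * B + L2_norm y) / Im \<mu>"
proof -
  have c: "Re c > 0" and Rc: "Re c = Im \<mu>" and c\<mu>: "c = - \<i> * \<mu>" using \<mu> by (simp_all add: c_def complex_eq_iff)
  note src = refl_source_L2[OF v x]
  have iy: "(\<lambda>s. \<i> * y s) \<in> L2" "L2_norm (\<lambda>s. \<i> * y s) = L2_norm y" using L2_scale[OF y, of \<i>] by simp_all
  let ?h = "\<lambda>s. \<i> * (v s * x (- s)) + \<i> * y s"
  have h: "?h \<in> L2" by (rule L2_add(1)[OF src(1) iy(1)])
  have xh: "x = decay_conv c ?h"
  proof (rule ext)
    fix t
    have "x t = refl_op v c x t + decay_conv c (\<lambda>s. \<i> * y s) t" by (rule fp)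
    also have "\<dots> = decay_conv c ?h t" by (simp add: decay_conv_add[OF c src(1) iy(1)] refl_op_def)
    finally show "x t = decay_conv c ?h t" .
  qed
  have x2: "x \<in> L2" by (subst xh) (rule decay_conv_L2(1)[OF c h])
  have AC: "absolutely_continuous_on {a..b} x" for a b
    by (subst xh) (rule absolutely_continuous_on_decay_conv[OF c h])
  have d: "AE t in lebesgue. (x has_vector_derivative ?h t - c * x t) (at t)"
    using decay_conv_has_vector_derivative[OF c h] unfolding xh[symmetric] .
  have x'2: "(\<lambda>t. ?h t - c * x t) \<in> L2" by (rule L2_diff[OF h L2_scale(1)[OF x2]])
  show "x \<in> W12" by (rule W12I[OF x2 AC x'2 d])
  show "AE t in lebesgue. opL v x t - \<mu> * x t = y t"
    using opL_shift_AE[OF d, of v \<mu>] by eventually_elim (simp add: c\<mu> algebra_simps)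
  have "L2_norm x \<le> L2_norm ?h / Re c"
    by (subst xh) (rule decay_conv_L2(2)[OF c h])
  also have "\<dots> \<le> (L2_norm v * B + L2_norm y) / Re c"
    using L2_add(2)[OF src(1) iy(1)] src(2) c iy(2) by (intro divide_right_mono) auto
  finally show "L2_norm x \<le> (L2_norm v * B + L2_norm y) / Im \<mu>" by (simp add: Rc)
qed

text \<open>
  Iterating the fixed point equation once gives \<open>x = T (T x) + T w + w\<close>, and the supremum of the
  norm of \<open>x\<close> can be absorbed on the left.
\<close>

lemma refl_op_fixed_point_le:
  assumes v: "v \<in> L2" and c: "Re c > 0"
    and contr: "\<And>u U t. continuous_on UNIV u \<Longrightarrow> (\<And>t. norm (u t) \<le> U) \<Longrightarrow>
        norm (refl_op v c (refl_op v c u) t) \<le> 2 / 3 * U"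
    and x: "continuous_on UNIV x" "\<And>t. norm (x t) \<le> B"
    and w: "continuous_on UNIV w" "\<And>t. norm (w t) \<le> W"
    and fp: "\<And>t. x t = refl_op v c x t + w t"
  shows "norm (x t) \<le> 3 * ((L2_norm v / sqrt (2 * Re c) + 1) * W)"
proof -
  let ?T = "refl_op v c"
  define S where "S = (SUP t. norm (x t))"
  have bdd: "bdd_above (range (\<lambda>t. norm (x t)))" using x(2) by (intro bdd_aboveI2)
  have S: "norm (x t) \<le> S" for t unfolding S_def by (rule cSUP_upper[OF UNIV_I bdd])
  have "norm (x t) \<le> 2 / 3 * S + (L2_norm v / sqrt (2 * Re c) + 1) * W" for t
  proof -
    have "?T x t = ?T (\<lambda>t. ?T x t + w t) t" using fp by metis
    also have "\<dots> = ?T (?T x) t + ?T w t"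
      by (rule refl_op_add[OF c v continuous_refl_op[OF c v x] norm_refl_op_le[OF c v x] w])
    finally have "x t = ?T (?T x) t + ?T w t + w t" using fp[of t] by simp
    then have "norm (x t) \<le> norm (?T (?T x) t) + norm (?T w t) + norm (w t)"
      by (metis norm_triangle_ineq norm_triangle_le add_right_mono)
    also have "\<dots> \<le> 2 / 3 * S + L2_norm v * W / sqrt (2 * Re c) + W"
      using contr[OF x(1) S] norm_refl_op_le[OF c v w] w(2) by (intro add_mono)
    finally show ?thesis by (simp add: algebra_simps)
  qed
  then have "S \<le> 2 / 3 * S + (L2_norm v / sqrt (2 * Re c) + 1) * W"
    unfolding S_def by (intro cSUP_least) auto
  then show ?thesis using S[of t] by linarith
qed

text \<open>
  The unique fixed point of the square of \<open>u \<mapsto> T u + w\<close> is also fixed by the map itself, because the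
  map sends it to another fixed point of the square.
\<close>

lemma refl_op_fixed_point_exists:
  assumes v: "v \<in> L2" and c: "Re c > 0"
    and contr: "\<And>u U t. continuous_on UNIV u \<Longrightarrow> (\<And>t. norm (u t) \<le> U) \<Longrightarrow>
        norm (refl_op v c (refl_op v c u) t) \<le> 2 / 3 * U"
    and w: "continuous_on UNIV w" "\<And>t. norm (w t) \<le> W"
  shows "\<exists>x B. continuous_on UNIV x \<and> (\<forall>t. norm (x t) \<le> B) \<and> (\<forall>t. x t = refl_op v c x t + w t)"
proof -
  let ?T = "refl_op v c"
  define \<Phi> :: "(real \<Rightarrow>\<^sub>C complex) \<Rightarrow> (real \<Rightarrow>\<^sub>C complex)" where
    "\<Phi> u = Bcontfun (\<lambda>t. ?T (apply_bcontfun u) t + w t)" for u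
  have cont: "continuous_on UNIV (apply_bcontfun u)" for u :: "real \<Rightarrow>\<^sub>C complex"
    using apply_bcontfun[of u] by (simp add: bcontfun_def)
  have bnd: "norm (apply_bcontfun u t) \<le> norm u" for u :: "real \<Rightarrow>\<^sub>C complex" and t
    by (rule norm_bounded)
  have \<Phi>: "apply_bcontfun (\<Phi> u) = (\<lambda>t. ?T (apply_bcontfun u) t + w t)" for u
    unfolding \<Phi>_def
  proof (rule Bcontfun_inverse)
    have "norm (?T (apply_bcontfun u) t + w t) \<le> L2_norm v * norm u / sqrt (2 * Re c) + W" for t
      using norm_triangle_mono[OF norm_refl_op_le[OF c v cont bnd] w(2)] .
    then have "bounded (range (\<lambda>t. ?T (apply_bcontfun u) t + w t))"
      by (intro boundedI) auto
    then show "(\<lambda>t. ?T (apply_bcontfun u) t + w t) \<in> bcontfun"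
      using continuous_on_add[OF continuous_refl_op[OF c v cont bnd] w(1)] by (simp add: bcontfun_def)
  qed
  have diff: "apply_bcontfun (\<Phi> u1) t - apply_bcontfun (\<Phi> u2) t = ?T (\<lambda>s. apply_bcontfun u1 s - apply_bcontfun u2 s) t" for u1 u2 t
    using refl_op_diff[OF c v cont bnd cont bnd, of u1 u2 t] by (simp add: \<Phi>)
  have lip: "dist (\<Phi> (\<Phi> u1)) (\<Phi> (\<Phi> u2)) \<le> 2 / 3 * dist u1 u2" for u1 u2
  proof (rule dist_bound)
    fix t
    have "norm (apply_bcontfun u1 s - apply_bcontfun u2 s) \<le> dist u1 u2" for s
      using dist_bounded[of u1 s u2] by (simp add: dist_norm)
    moreover have "continuous_on UNIV (\<lambda>s. apply_bcontfun u1 s - apply_bcontfun u2 s)"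
      by (intro continuous_on_diff cont)
    ultimately have "norm (?T (?T (\<lambda>s. apply_bcontfun u1 s - apply_bcontfun u2 s)) t) \<le> 2 / 3 * dist u1 u2"
      by (intro contr)
    then show "dist (apply_bcontfun (\<Phi> (\<Phi> u1)) t) (apply_bcontfun (\<Phi> (\<Phi> u2)) t) \<le> 2 / 3 * dist u1 u2"
      by (simp add: dist_norm diff)
  qed
  have "\<exists>!u. \<Phi> (\<Phi> u) = u"
    using lip banach_fix_type[of "2 / 3" "\<lambda>u. \<Phi> (\<Phi> u)"] by simp
  then obtain u where u: "\<Phi> (\<Phi> u) = u" and uniq: "\<And>z. \<Phi> (\<Phi> z) = z \<Longrightarrow> z = u" by blast
  have "\<Phi> u = u" by (rule uniq) (simp add: u)
  then have "apply_bcontfun u t = ?T (apply_bcontfun u) t + w t" for t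
    using \<Phi>[of u] by metis
  then show ?thesis using cont[of u] bnd[of u] by blast
qed

text \<open>
  Solving \<open>opL v x - \<mu> * x = y\<close> in \<open>W12\<close> amounts to solving the fixed point equation among bounded
  continuous functions. Existence there gives surjectivity; the a priori bound gives injectivity,
  with right-hand side \<open>0\<close>, and the boundedness of the inverse.
\<close>

lemma upper_half_plane_resolvent:
  assumes v: "v \<in> L2"
    and \<mu>: "Im \<mu> > (39 * L2_norm v ^ 3 + 3 * L2_norm v) * spectral_profile v (Re \<mu>)"
  shows "\<mu> \<in> L2_resolvent_set W12 (opL v)"
proof -
  have "0 \<le> (39 * L2_norm v ^ 3 + 3 * L2_norm v) * spectral_profile v (Re \<mu>)"
    by (simp add: L2_norm_nonneg spectral_profile_nonneg)
  then have \<mu>0: "Im \<mu> > 0" using \<mu> by linarith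
  define c where "c = Complex (Im \<mu>) (- Re \<mu>)"
  have c: "Re c > 0" and Rc: "Re c = Im \<mu>" using \<mu>0 by (simp_all add: c_def)
  have contr: "norm (refl_op v c (refl_op v c u) t) \<le> 2 / 3 * U"
    if "continuous_on UNIV u" "\<And>t. norm (u t) \<le> U" for u U t
    unfolding c_def by (rule refl_op_contraction[OF v that \<mu>])
  let ?w = "\<lambda>y. decay_conv c (\<lambda>s. \<i> * y s)"
  have w: "continuous_on UNIV (?w y)" "norm (?w y t) \<le> L2_norm y / sqrt (2 * Re c)" if "y \<in> L2" for y t
    using continuous_on_decay_conv[OF c L2_scale(1)[OF that]] norm_decay_conv_le[OF c L2_scale(1)[OF that, of \<i>], of t]
      L2_scale(2)[OF that, of \<i>] by simp_all
  define K where "K = 3 * ((L2_norm v / sqrt (2 * Re c) + 1) * (1 / sqrt (2 * Re c)))"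
  have bound: "norm (x t) \<le> K * L2_norm y"
    if x: "continuous_on UNIV x" "\<And>t. norm (x t) \<le> B" and y: "y \<in> L2"
      and fp: "\<And>t. x t = refl_op v c x t + ?w y t" for x B y t
  proof -
    have "norm (x t) \<le> 3 * ((L2_norm v / sqrt (2 * Re c) + 1) * (L2_norm y / sqrt (2 * Re c)))"
      by (rule refl_op_fixed_point_le[OF v c _ x w[OF y] fp]) (rule contr)
    also have "\<dots> = K * L2_norm y" by (simp add: K_def)
    finally show ?thesis .
  qed
  show ?thesis
    unfolding L2_resolvent_set_def
  proof (intro CollectI conjI ballI)
    fix y :: "real \<Rightarrow> complex" assume y: "y \<in> L2"
    have "\<exists>x B. continuous_on UNIV x \<and> (\<forall>t. norm (x t) \<le> B) \<and> (\<forall>t. x t = refl_op v c x t + ?w y t)"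
      by (rule refl_op_fixed_point_exists[OF v c _ w[OF y]]) (rule contr)
    then obtain x B where x: "continuous_on UNIV x" "\<And>t. norm (x t) \<le> B" and fp: "\<And>t. x t = refl_op v c x t + ?w y t"
      by blast
    note sol = fixed_point_opL_solution[OF v y \<mu>0 x fp[unfolded c_def]]
    have uniq: "z t = x t" if z: "z \<in> W12" and eq: "AE t in lebesgue. opL v z t - \<mu> * z t = y t" for z t
    proof -
      obtain B' where B': "\<And>t. norm (z t) \<le> B'" using W12_bounded[OF z] by blast
      note zc = W12_continuous[OF z]
      have zfp: "z t = refl_op v c z t + ?w y t" for t
        unfolding c_def by (rule opL_solution_fixed_point[OF v z y \<mu>0 eq])
      let ?d = "\<lambda>t. z t - x t"
      have "norm (?d t) \<le> K * L2_norm (\<lambda>t. 0 :: complex)"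
      proof (rule bound[where B = "B' + B"])
        show "continuous_on UNIV ?d" by (intro continuous_on_diff zc x(1))
        show "norm (?d t) \<le> B' + B" for t
          using norm_triangle_ineq4[of "z t" "x t"] B'[of t] x(2)[of t] by linarith
        show "(\<lambda>t. 0 :: complex) \<in> L2" by (simp add: L2_def)
        show "?d t = refl_op v c ?d t + ?w (\<lambda>t. 0) t" for t
          using refl_op_diff[OF c v zc B' x, of t] zfp[of t] fp[of t] by (simp add: decay_conv_def)
      qed
      then show ?thesis by (simp add: L2_norm_def)
    qed
    show "\<exists>x\<in>W12. (AE t in lebesgue. opL v x t - \<mu> * x t = y t) \<and>
        (\<forall>z\<in>W12. (AE t in lebesgue. opL v z t - \<mu> * z t = y t) \<longrightarrow> (AE t in lebesgue. z t = x t))"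
    proof (intro bexI[OF _ sol(1)] conjI ballI impI)
      show "AE t in lebesgue. opL v x t - \<mu> * x t = y t" by (rule sol(2))
      fix z assume "z \<in> W12" "AE t in lebesgue. opL v z t - \<mu> * z t = y t"
      then show "AE t in lebesgue. z t = x t" by (intro AE_I2) (rule uniq)
    qed
  next
    show "\<exists>C. \<forall>x\<in>W12. L2_norm x \<le> C * L2_norm (\<lambda>t. opL v x t - \<mu> * x t)"
    proof (intro exI[of _ "(L2_norm v * K + 1) / Im \<mu>"] ballI)
      fix x assume x: "x \<in> W12"
      let ?y = "\<lambda>t. opL v x t - \<mu> * x t"
      have y: "?y \<in> L2" by (rule opL_shift_L2[OF v x])
      obtain B where B: "\<And>t. norm (x t) \<le> B" using W12_bounded[OF x] by blast
      have fp: "x t = refl_op v c x t + ?w ?y t" for t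
        unfolding c_def by (rule opL_solution_fixed_point[OF v x y \<mu>0]) simp
      have "L2_norm x \<le> (L2_norm v * (K * L2_norm ?y) + L2_norm ?y) / Im \<mu>"
        by (rule fixed_point_opL_solution(3)[OF v y \<mu>0 W12_continuous[OF x] bound[OF W12_continuous[OF x] B y fp] fp[unfolded c_def]])
      then show "L2_norm x \<le> (L2_norm v * K + 1) / Im \<mu> * L2_norm ?y"
        by (simp add: algebra_simps)
    qed
  qed
qed

lemma W12_reflect:
  assumes "x \<in> W12"
  shows "(\<lambda>t. x (- t)) \<in> W12"
proof -
  obtain x' where x': "x' \<in> L2" and d: "AE t in lebesgue. (x has_vector_derivative x' t) (at t)"
    using W12_derivative[OF assms] by blast
  have x: "x \<in> L2" by (rule W12_L2[OF assms])
  have AC: "absolutely_continuous_on {a..b} x" for a b by (rule W12_absolutely_continuous[OF assms])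
  have "(\<lambda>t. - x' (- t)) \<in> L2" using L2_scale(1)[OF L2_reflect(1)[OF x'], of "-1"] by simp
  then show ?thesis
    by (rule W12I[OF L2_reflect(1)[OF x] absolutely_continuous_on_reflect(1)[OF AC x' d] _
          absolutely_continuous_on_reflect(2)[OF AC x' d]])
qed

text \<open>
  Reflection conjugates the operator with potential \<open>v\<close> to minus the one with potential \<open>- v(-\<cdot>)\<close>, and
  so exchanges the upper and the lower half plane.
\<close>

lemma opL_reflect_AE:
  assumes "x \<in> W12"
  shows "AE t in lebesgue. opL v x t - \<mu> * x t =
    - (opL (\<lambda>t. - v (- t)) (\<lambda>t. x (- t)) (- t) - (- \<mu>) * x (- (- t)))"
proof -
  obtain x' where x': "x' \<in> L2" and d: "AE t in lebesgue. (x has_vector_derivative x' t) (at t)"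
    using W12_derivative[OF assms] by blast
  have AC: "absolutely_continuous_on {a..b} x" for a b by (rule W12_absolutely_continuous[OF assms])
  show ?thesis
    using opL_shift_AE[OF d, of v \<mu>]
      AE_lebesgue_reflect[OF opL_shift_AE[OF absolutely_continuous_on_reflect(2)[OF AC x' d], of "\<lambda>t. - v (- t)" "- \<mu>"]]
    by eventually_elim simp
qed

lemma resolvent_set_reflect:
  assumes v: "v \<in> L2" and res: "- \<mu> \<in> L2_resolvent_set W12 (opL (\<lambda>t. - v (- t)))"
  shows "\<mu> \<in> L2_resolvent_set W12 (opL v)"
proof -
  let ?v = "\<lambda>t. - v (- t)"
  let ?r = "\<lambda>(x :: real \<Rightarrow> complex) t. x (- t)"
  from res have ex: "\<And>y. y \<in> L2 \<Longrightarrow> \<exists>x\<in>W12. (AE t in lebesgue. opL ?v x t - (- \<mu>) * x t = y t) \<and>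
      (\<forall>z\<in>W12. (AE t in lebesgue. opL ?v z t - (- \<mu>) * z t = y t) \<longrightarrow> (AE t in lebesgue. z t = x t))"
    and bd: "\<exists>C. \<forall>x\<in>W12. L2_norm x \<le> C * L2_norm (\<lambda>t. opL ?v x t - (- \<mu>) * x t)"
    unfolding L2_resolvent_set_def by blast+
  have v': "?v \<in> L2" using L2_scale(1)[OF L2_reflect(1)[OF v], of "-1"] by simp
  have equiv: "(AE t in lebesgue. opL v z t - \<mu> * z t = y t) \<longleftrightarrow>
      (AE t in lebesgue. opL ?v (?r z) t - (- \<mu>) * ?r z t = - y (- t))" if z: "z \<in> W12" for z y
  proof
    assume "AE t in lebesgue. opL v z t - \<mu> * z t = y t"
    from AE_lebesgue_reflect[OF this] AE_lebesgue_reflect[OF opL_reflect_AE[OF z, of v \<mu>]]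
    show "AE t in lebesgue. opL ?v (?r z) t - (- \<mu>) * ?r z t = - y (- t)"
      by eventually_elim (simp add: equation_minus_iff)
  next
    assume "AE t in lebesgue. opL ?v (?r z) t - (- \<mu>) * ?r z t = - y (- t)"
    from AE_lebesgue_reflect[OF this] opL_reflect_AE[OF z, of v \<mu>]
    show "AE t in lebesgue. opL v z t - \<mu> * z t = y t"
      by eventually_elim simp
  qed
  show ?thesis
    unfolding L2_resolvent_set_def
  proof (intro CollectI conjI ballI)
    fix y :: "real \<Rightarrow> complex" assume y: "y \<in> L2"
    have "(\<lambda>t. - y (- t)) \<in> L2" using L2_scale(1)[OF L2_reflect(1)[OF y], of "-1"] by simp
    from ex[OF this] obtain x where x: "x \<in> W12"
      and sol: "AE t in lebesgue. opL ?v x t - (- \<mu>) * x t = - y (- t)"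
      and uniq: "\<And>z. z \<in> W12 \<Longrightarrow> (AE t in lebesgue. opL ?v z t - (- \<mu>) * z t = - y (- t)) \<Longrightarrow> (AE t in lebesgue. z t = x t)"
      by blast
    have rx: "?r x \<in> W12" by (rule W12_reflect[OF x])
    show "\<exists>x\<in>W12. (AE t in lebesgue. opL v x t - \<mu> * x t = y t) \<and>
        (\<forall>z\<in>W12. (AE t in lebesgue. opL v z t - \<mu> * z t = y t) \<longrightarrow> (AE t in lebesgue. z t = x t))"
    proof (intro bexI[OF _ rx] conjI ballI impI)
      show "AE t in lebesgue. opL v (?r x) t - \<mu> * ?r x t = y t"
        using sol unfolding equiv[OF rx] by simp
      fix z assume z: "z \<in> W12" and "AE t in lebesgue. opL v z t - \<mu> * z t = y t"
      then have "AE t in lebesgue. opL ?v (?r z) t - (- \<mu>) * ?r z t = - y (- t)"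
        unfolding equiv[OF z] by simp
      from AE_lebesgue_reflect[OF uniq[OF W12_reflect[OF z] this]]
      show "AE t in lebesgue. z t = ?r x t" by simp
    qed
  next
    obtain C where C: "\<And>x. x \<in> W12 \<Longrightarrow> L2_norm x \<le> C * L2_norm (\<lambda>t. opL ?v x t - (- \<mu>) * x t)"
      using bd by blast
    show "\<exists>C. \<forall>x\<in>W12. L2_norm x \<le> C * L2_norm (\<lambda>t. opL v x t - \<mu> * x t)"
    proof (intro exI[of _ C] ballI)
      fix x assume x: "x \<in> W12"
      have x2: "x \<in> L2" by (rule W12_L2[OF x])
      let ?y = "\<lambda>t. opL ?v (?r x) t - (- \<mu>) * ?r x t"
      have y: "?y \<in> L2" by (rule opL_shift_L2[OF v' W12_reflect[OF x]])
      have ny: "(\<lambda>t. - ?y (- t)) \<in> L2" "L2_norm (\<lambda>t. - ?y (- t)) = L2_norm ?y"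
        using L2_scale[OF L2_reflect(1)[OF y], of "-1"] L2_reflect(2)[OF y] by simp_all
      have "L2_norm (\<lambda>t. opL v x t - \<mu> * x t) = L2_norm ?y"
        using L2_cong_AE(2)[OF ny(1) opL_reflect_AE[OF x, of v \<mu>]] ny(2) by simp
      moreover have "L2_norm (?r x) = L2_norm x" by (rule L2_reflect(2)[OF x2])
      ultimately show "L2_norm x \<le> C * L2_norm (\<lambda>t. opL v x t - \<mu> * x t)"
        using C[OF W12_reflect[OF x]] by simp
    qed
  qed
qed

theorem theorem1p1:
  fixes v :: "real \<Rightarrow> complex"
  assumes "v \<in> L2"
  shows "\<exists>f :: real \<Rightarrow> real. continuous_on UNIV f \<and> f \<in> L2 \<and>
    (\<forall>\<mu>\<in>L2_spectrum W12 (opL v). \<bar>Im \<mu>\<bar> \<le> f (Re \<mu>))"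
proof -
  define v' where "v' = (\<lambda>t. - v (- t))"
  define M where "M u = 39 * L2_norm u ^ 3 + 3 * L2_norm u" for u :: "real \<Rightarrow> complex"
  define g where "g u a = M u * spectral_profile u a" for u a
  have v': "v' \<in> L2"
    using L2_scale(1)[OF L2_reflect(1)[OF assms], of "-1"] by (simp add: v'_def)
  have M0: "0 \<le> M u" for u by (simp add: M_def L2_norm_nonneg)
  have g0: "0 \<le> g u a" for u a using M0 by (simp add: g_def spectral_profile_nonneg)
  have gc: "continuous_on UNIV (g u)" if "u \<in> L2" for u
    unfolding g_def by (intro continuous_intros continuous_on_spectral_profile that)
  have g2: "g u \<in> L2" if "u \<in> L2" for u
  proof (rule L2_dominated(1)[OF continuous_imp_lebesgue_measurable[OF gc[OF that]] spectral_profile_L2[OF that]])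
    show "norm (g u a) \<le> M u * norm (spectral_profile u a)" for a
      using M0 by (simp add: g_def abs_mult)
  qed
  define f where "f a = g v a + g v' (- a)" for a
  have "continuous_on UNIV f"
    unfolding f_def by (intro continuous_on_add gc assms continuous_on_compose2[OF gc[OF v']] continuous_intros) auto
  moreover have "f \<in> L2"
    unfolding f_def by (rule L2_add(1)[OF g2[OF assms] L2_reflect(1)[OF g2[OF v']]])
  moreover have "\<bar>Im \<mu>\<bar> \<le> f (Re \<mu>)" if "\<mu> \<in> L2_spectrum W12 (opL v)" for \<mu>
  proof -
    have "\<not> Im \<mu> > g v (Re \<mu>)"
      using upper_half_plane_resolvent[OF assms] that by (auto simp: L2_spectrum_def g_def M_def)
    moreover have "\<not> Im (- \<mu>) > g v' (Re (- \<mu>))"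
      using resolvent_set_reflect[OF assms, folded v'_def, OF upper_half_plane_resolvent[OF v']] that
      by (auto simp: L2_spectrum_def g_def M_def)
    ultimately show ?thesis
      using g0[of v "Re \<mu>"] g0[of v' "- Re \<mu>"] by (auto simp: f_def)
  qed
  ultimately show ?thesis by blast
qed

end
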